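(* Let $F$ be a field with $\operatorname{char}F\ne2$, let $n\geq 1$, let $\boldsymbol\varepsilon$ be an $n\times n$ elementary quantum matrix over $F$ and let $\tau$ be an arbitrary graded involution of the elementary quantum torus $F_{\boldsymbol\varepsilon}$. Then $(F_{\boldsymbol\varepsilon},\tau)$ is graded isomorphic to exactly one of $$(F_{\mathbf h_{l,n}},* ),\qquad (F_{\mathbf h_{l,n}},\tau_1)\qquad\text{or}\qquad (F_{\mathbf h_{l,n}},\tau_2)$$ (for some $l$), and for each of these $l$ is an invariant of the isomorphism class. Moreover: (i) $(F_{\boldsymbol\varepsilon},* )\cong(F_{\mathbf h_{l,n}},\tau_1)\Longrightarrow l\ge1$; (ii) $(F_{\boldsymbol\varepsilon},* )\cong(F_{\mathbf h_{l,n}},\tau_2)\Longrightarrow l\ge2$; (iii) $(F_{\mathbf h_{l,n}},\tau_1)\cong_\Lambda(F_{\mathbf h_{l-1,n-3}\times\mathbf m_3},* )$ for $l\ge1$; (iv) $(F_{\mathbf h_{l,n}},\tau_2)\cong_\Lambda(F_{\mathbf h_{l-2,n-4}\times\mathbf m_4},* )$ for $l\ge2$. In particular, $(F_{\boldsymbol\varepsilon},\tau)$ is graded isomorphic to exactly one of $(F_{\mathbf h_{0,n}},\tau_1)$, $(F_{\mathbf h_{1,n}},\tau_2)$ or $(F_{\boldsymbol\eta},* )$ for some elementary quantum matrix $\boldsymbol\eta$.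
   Context: A quantum matrix is an $n\times n$ matrix $\mathbf q=(q_{ij})$ over $F$ with $q_{ii}=1$, $q_{ji}=q_{ij}^{-1}$; it is elementary if all $q_{ij}\in\{1,-1\}$. The quantum torus $F_{\mathbf q}=F_{\mathbf q}[t_1^{\pm1},\dots,t_n^{\pm1}]$ is the unital associative $F$-algebra with generators $t_i^{\pm1}$ and relations $t_it_i^{-1}=t_i^{-1}t_i=1$, $t_jt_i=q_{ij}t_it_j$. It is called elementary if $\mathbf q$ is elementary. $\Lambda$ is the free abelian group of rank $n$. A toral $\Lambda$-grading of $F_{\mathbf q}$ is one obtained from a basis $\boldsymbol\sigma_1,\dots,\boldsymbol\sigma_n$ of $\Lambda$ by giving $t_1^{\alpha_1}\cdots t_n^{\alpha_n}$ degree $\alpha_1\boldsymbol\sigma_1+\cdots+\alpha_n\boldsymbol\sigma_n$. Quantum tori are always considered with toral gradings. A graded involution is an $F$-linear anti-automorphism of period at most $2$ preserving the homogeneous components of a toral grading. For $a_i=\pm1$ and $\boldsymbol\varepsilon$ elementary there is a unique involution $\tau$ of $F_{\boldsymbol\varepsilon}$ with $\tau(t_i)=a_it_i$ for all $i$; it is said to be of type $(a_1,\dots,a_n)$, written $\tau=(a_1,\dots,a_n)$, and every graded involution is of this form. The main involution is $*=(1,\dots,1)$. $(A,\tau)\cong(B,\rho)$ means that there is an algebra isomorphism $f:A\to B$ with $f\tau=\rho f$. $\cong_\Lambda$ ("graded isomorphic") means that such an $f$ exists which is an isomorphism of $\Lambda$-graded algebras for suitable toral gradings. $A_1\times\cdots\times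 A_r$ is the block matrix with diagonal blocks $A_1,\dots,A_r$ and all other entries $1$; $\mathbf 1_k$ is the $k\times k$ all-ones matrix; $\mathbf h=\begin{pmatrix}1&-1\\-1&1\end{pmatrix}$; $\mathbf h_{l,n}=\mathbf h\times\cdots\times\mathbf h\times\mathbf 1_{n-2l}$ ($l$ copies of $\mathbf h$, $0\le 2l\le n$). $\mathbf m_3$ (resp. $\mathbf m_4$) is the $3\times3$ (resp. $4\times4$) matrix with diagonal entries $1$ and all off-diagonal entries $-1$. On $F_{\mathbf h_{l,n}}$: $\tau_1$ (defined when $n>2l$, $l\ge0$) is the graded involution of type $(1,\dots,1,-1,1,\dots,1)$ with $-1$ only in position $2l+1$; $\tau_2$ (defined when $l\ge1$) is the graded involution of type $(1,\dots,1,-1,-1,1,\dots,1)$ with $-1$ only in positions $2l-1$ and $2l$. *)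

theory Defs
  imports
    "HOL-Algebra.QuotRing"
    "HOL-Algebra.Free_Abelian_Groups"
    "Jordan_Normal_Form.Matrix"
begin

text \<open>The free monoid, written additively as required by the product of \<^typ>\<open>'a \<Rightarrow>\<^sub>0 'b\<close>.\<close>

datatype 'a word_monoid = Word (letters: "'a list")

instantiation word_monoid :: (type) monoid_add
begin

definition "0 = Word []"

definition "v + w = Word (letters v @ letters w)"

instance
  by standard (simp_all add: zero_word_monoid_def plus_word_monoid_def)

end

text \<open>\<open>Gen i\<close> and \<open>GenInv i\<close> stand for $t_{i+1}$ and $t_{i+1}^{-1}$: all indices start at 0.\<close>

datatype gen = Gen nat | GenInv nat

definition gens :: "nat \<Rightarrow> gen set" where
  "gens n = Gen ` {..<n} \<union> GenInv ` {..<n}"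

text \<open>With the convolution product of \<^theory>\<open>HOL-Library.Poly_Mapping\<close>, the finitely supported
  functions on words form the (noncommutative) monoid algebra of the free monoid.\<close>

type_synonym 'f free_alg = "gen word_monoid \<Rightarrow>\<^sub>0 'f"

definition free_algebra :: "nat \<Rightarrow> 'f::field free_alg ring" where
  "free_algebra n =
     \<lparr>carrier = {p. \<forall>w \<in> Poly_Mapping.keys p. set (letters w) \<subseteq> gens n},
      monoid.mult = (*), monoid.one = 1, ring.zero = 0, ring.add = (+)\<rparr>"

definition const :: "'f::field \<Rightarrow> 'f free_alg" where
  "const c = Poly_Mapping.single 0 c"

definition letter :: "gen \<Rightarrow> 'f::field free_alg" where
  "letter g = Poly_Mapping.single (Word [g]) 1"

text \<open>The condition $q_{ji} = q_{ij}^{-1}$ is written multiplicatively because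
  \<open>inverse 0 = 0\<close> in HOL.\<close>

definition quantum_matrix :: "nat \<Rightarrow> 'f::field mat \<Rightarrow> bool" where
  "quantum_matrix n q \<longleftrightarrow> q \<in> carrier_mat n n \<and> (\<forall>i<n. q $$ (i, i) = 1) \<and>
     (\<forall>i<n. \<forall>j<n. q $$ (i, j) * q $$ (j, i) = 1)"

definition elementary_quantum_matrix :: "nat \<Rightarrow> 'f::field mat \<Rightarrow> bool" where
  "elementary_quantum_matrix n q \<longleftrightarrow>
     quantum_matrix n q \<and> (\<forall>i<n. \<forall>j<n. q $$ (i, j) \<in> {1, -1})"

definition relators :: "'f::field mat \<Rightarrow> 'f free_alg set" where
  "relators q =
     {letter (Gen i) * letter (GenInv i) - 1 | i. i < dim_row q} \<union>
     {letter (GenInv i) * letter (Gen i) - 1 | i. i < dim_row q} \<union>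
     {letter (Gen j) * letter (Gen i) - const (q $$ (i, j)) * letter (Gen i) * letter (Gen j)
       | i j. i < dim_row q \<and> j < dim_row q}"

definition relation_ideal :: "'f::field mat \<Rightarrow> 'f free_alg set" where
  "relation_ideal q = Idl\<^bsub>free_algebra (dim_row q)\<^esub> (relators q)"

definition qt_class :: "'f::field mat \<Rightarrow> 'f free_alg \<Rightarrow> 'f free_alg set" where
  "qt_class q p = relation_ideal q +>\<^bsub>free_algebra (dim_row q)\<^esub> p"

text \<open>The record type \<^typ>\<open>('f, 'a) module\<close> serves as a carrier for an \<open>F\<close>-algebra; the scalar \<open>c\<close>
  acts as multiplication by the class of the constant \<open>c\<close>.\<close>

definition quantum_torus :: "'f::field mat \<Rightarrow> ('f, 'f free_alg set) module" where
  "quantum_torus q =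
     (let Q = free_algebra (dim_row q) Quot relation_ideal q in
      \<lparr>carrier = carrier Q, monoid.mult = monoid.mult Q, monoid.one = \<one>\<^bsub>Q\<^esub>, ring.zero = \<zero>\<^bsub>Q\<^esub>, ring.add = ring.add Q,
       module.smult = (\<lambda>c x. qt_class q (const c) \<otimes>\<^bsub>Q\<^esub> x)\<rparr>)"

definition qt_gen :: "'f::field mat \<Rightarrow> nat \<Rightarrow> 'f free_alg set" where
  "qt_gen q i = qt_class q (letter (Gen i))"

text \<open>$t_1^{\alpha_1} \cdots t_n^{\alpha_n}$, factors in this order; the values \<open>\<alpha> i\<close> with
  \<open>i \<ge> n\<close> play no role.\<close>

definition qt_monomial :: "'f::field mat \<Rightarrow> (nat \<Rightarrow> int) \<Rightarrow> 'f free_alg set" where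
  "qt_monomial q \<alpha> =
     foldr (\<lambda>i x. (qt_gen q i [^]\<^bsub>quantum_torus q\<^esub> \<alpha> i) \<otimes>\<^bsub>quantum_torus q\<^esub> x)
       [0..<dim_row q] \<one>\<^bsub>quantum_torus q\<^esub>"

text \<open>\<open>\<Lambda>\<close> is written additively: the operation of \<^const>\<open>free_Abelian_group\<close> is \<open>+\<close>.\<close>

definition Lambda :: "nat \<Rightarrow> (nat \<Rightarrow>\<^sub>0 int) set" where
  "Lambda n = carrier (free_Abelian_group {..<n})"

definition int_comb :: "nat \<Rightarrow> (nat \<Rightarrow> nat \<Rightarrow>\<^sub>0 int) \<Rightarrow> (nat \<Rightarrow> int) \<Rightarrow> (nat \<Rightarrow>\<^sub>0 int)" where
  "int_comb n \<sigma> \<alpha> = (\<Sum>i<n. frag_cmul (\<alpha> i) (\<sigma> i))"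

definition Lambda_basis :: "nat \<Rightarrow> (nat \<Rightarrow> nat \<Rightarrow>\<^sub>0 int) \<Rightarrow> bool" where
  "Lambda_basis n \<sigma> \<longleftrightarrow> (\<forall>i<n. \<sigma> i \<in> Lambda n) \<and>
     (\<forall>d\<in>Lambda n. \<exists>\<alpha>. d = int_comb n \<sigma> \<alpha>) \<and>
     (\<forall>\<alpha>. int_comb n \<sigma> \<alpha> = 0 \<longrightarrow> (\<forall>i<n. \<alpha> i = 0))"

text \<open>For a basis \<open>\<sigma>\<close> exactly one monomial has degree \<open>d\<close>, so its scalar multiples are the whole
  homogeneous component.\<close>

definition toral_component ::
  "'f::field mat \<Rightarrow> (nat \<Rightarrow> nat \<Rightarrow>\<^sub>0 int) \<Rightarrow> (nat \<Rightarrow>\<^sub>0 int) \<Rightarrow> 'f free_alg set set" where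
  "toral_component q \<sigma> d =
     {c \<odot>\<^bsub>quantum_torus q\<^esub> qt_monomial q \<alpha> | c \<alpha>. int_comb (dim_row q) \<sigma> \<alpha> = d}"

definition anti_automorphism :: "('f, 'a) module \<Rightarrow> ('a \<Rightarrow> 'a) \<Rightarrow> bool" where
  "anti_automorphism A \<tau> \<longleftrightarrow> bij_betw \<tau> (carrier A) (carrier A) \<and>
     (\<forall>x\<in>carrier A. \<forall>y\<in>carrier A. \<tau> (x \<oplus>\<^bsub>A\<^esub> y) = \<tau> x \<oplus>\<^bsub>A\<^esub> \<tau> y) \<and>
     (\<forall>c. \<forall>x\<in>carrier A. \<tau> (c \<odot>\<^bsub>A\<^esub> x) = c \<odot>\<^bsub>A\<^esub> \<tau> x) \<and>
     (\<forall>x\<in>carrier A. \<forall>y\<in>carrier A. \<tau> (x \<otimes>\<^bsub>A\<^esub> y) = \<tau> y \<otimes>\<^bsub>A\<^esub> \<tau> x) \<and>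
     \<tau> \<one>\<^bsub>A\<^esub> = \<one>\<^bsub>A\<^esub>"

definition involution :: "('f, 'a) module \<Rightarrow> ('a \<Rightarrow> 'a) \<Rightarrow> bool" where
  "involution A \<tau> \<longleftrightarrow> anti_automorphism A \<tau> \<and> (\<forall>x\<in>carrier A. \<tau> (\<tau> x) = x)"

definition graded_involution ::
  "'f::field mat \<Rightarrow> ('f free_alg set \<Rightarrow> 'f free_alg set) \<Rightarrow> bool" where
  "graded_involution q \<tau> \<longleftrightarrow> involution (quantum_torus q) \<tau> \<and>
     (\<exists>\<sigma>. Lambda_basis (dim_row q) \<sigma> \<and>
       (\<forall>d\<in>Lambda (dim_row q). \<tau> ` toral_component q \<sigma> d \<subseteq> toral_component q \<sigma> d))"

text \<open>The involution of type $(a_1, \dots, a_n)$. Extensionality makes it unique as a total HOL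
  function; only its values on the carrier matter.\<close>

definition involution_of_type ::
  "'f::field mat \<Rightarrow> (nat \<Rightarrow> 'f) \<Rightarrow> 'f free_alg set \<Rightarrow> 'f free_alg set" where
  "involution_of_type q a =
     (THE \<tau>. \<tau> \<in> extensional (carrier (quantum_torus q)) \<and> involution (quantum_torus q) \<tau> \<and>
       (\<forall>i<dim_row q. \<tau> (qt_gen q i) = a i \<odot>\<^bsub>quantum_torus q\<^esub> qt_gen q i))"

definition main_involution :: "'f::field mat \<Rightarrow> 'f free_alg set \<Rightarrow> 'f free_alg set" where
  "main_involution q = involution_of_type q (\<lambda>_. 1)"

definition algebra_iso :: "('f, 'a) module \<Rightarrow> ('f, 'b) module \<Rightarrow> ('a \<Rightarrow> 'b) set" where
  "algebra_iso A B =
     {f \<in> ring_iso A B. \<forall>c. \<forall>x\<in>carrier A. f (c \<odot>\<^bsub>A\<^esub> x) = c \<odot>\<^bsub>B\<^esub> f x}"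

text \<open>$(F_q, \tau) \cong (F_r, \rho)$\<close>

definition iso_inv ::
  "'f::field mat \<Rightarrow> ('f free_alg set \<Rightarrow> 'f free_alg set) \<Rightarrow>
   'f mat \<Rightarrow> ('f free_alg set \<Rightarrow> 'f free_alg set) \<Rightarrow> bool" where
  "iso_inv q \<tau> r \<rho> \<longleftrightarrow> (\<exists>f \<in> algebra_iso (quantum_torus q) (quantum_torus r).
     \<forall>x\<in>carrier (quantum_torus q). f (\<tau> x) = \<rho> (f x))"

text \<open>$(F_q, \tau) \cong_\Lambda (F_r, \rho)$, both graded by the same group \<open>\<Lambda>\<close>\<close>

definition graded_iso_inv ::
  "'f::field mat \<Rightarrow> ('f free_alg set \<Rightarrow> 'f free_alg set) \<Rightarrow>
   'f mat \<Rightarrow> ('f free_alg set \<Rightarrow> 'f free_alg set) \<Rightarrow> bool" where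
  "graded_iso_inv q \<tau> r \<rho> \<longleftrightarrow> dim_row r = dim_row q \<and>
     (\<exists>f \<in> algebra_iso (quantum_torus q) (quantum_torus r).
       (\<forall>x\<in>carrier (quantum_torus q). f (\<tau> x) = \<rho> (f x)) \<and>
       (\<exists>\<sigma> \<sigma>'. Lambda_basis (dim_row q) \<sigma> \<and> Lambda_basis (dim_row r) \<sigma>' \<and>
         (\<forall>d\<in>Lambda (dim_row q). f ` toral_component q \<sigma> d = toral_component r \<sigma>' d)))"

definition ones_mat :: "nat \<Rightarrow> nat \<Rightarrow> 'f::field mat" where
  "ones_mat m n = mat m n (\<lambda>_. 1)"

definition block_prod :: "'f::field mat \<Rightarrow> 'f mat \<Rightarrow> 'f mat" where
  "block_prod A B =
     four_block_mat A (ones_mat (dim_row A) (dim_col B)) (ones_mat (dim_row B) (dim_col A)) B"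

definition h_mat :: "'f::field mat" where
  "h_mat = mat_of_rows_list 2 [[1, -1], [-1, 1]]"

text \<open>$\mathbf h_{l,n}$; an \<open>n \<times> n\<close> matrix only if \<open>2 * l \<le> n\<close>, because of the truncated subtraction.\<close>

definition hl_mat :: "nat \<Rightarrow> nat \<Rightarrow> 'f::field mat" where
  "hl_mat l n = (block_prod h_mat ^^ l) (ones_mat (n - 2 * l) (n - 2 * l))"

text \<open>\<open>m_mat 3\<close> and \<open>m_mat 4\<close> are $\mathbf m_3$ and $\mathbf m_4$.\<close>

definition m_mat :: "nat \<Rightarrow> 'f::field mat" where
  "m_mat k = mat k k (\<lambda>(i, j). if i = j then 1 else -1)"

text \<open>Meaningful for \<open>2 * l < n\<close>; \<open>tau2 l n\<close> below for \<open>1 \<le> l\<close> and \<open>2 * l \<le> n\<close>. Position \<open>2l + 1\<close> is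
  index \<open>2 * l\<close>, and positions \<open>2l - 1\<close>, \<open>2l\<close> are indices \<open>2 * l - 2\<close>, \<open>2 * l - 1\<close>.\<close>

definition tau1 :: "nat \<Rightarrow> nat \<Rightarrow> 'f::field free_alg set \<Rightarrow> 'f free_alg set" where
  "tau1 l n = involution_of_type (hl_mat l n) (\<lambda>i. if i = 2 * l then -1 else 1)"

definition tau2 :: "nat \<Rightarrow> nat \<Rightarrow> 'f::field free_alg set \<Rightarrow> 'f free_alg set" where
  "tau2 l n =
     involution_of_type (hl_mat l n) (\<lambda>i. if i = 2 * l - 2 \<or> i = 2 * l - 1 then -1 else 1)"

definition exactly_one :: "bool \<Rightarrow> bool \<Rightarrow> bool \<Rightarrow> bool" where
  "exactly_one P Q R \<longleftrightarrow>
     (P \<and> \<not> Q \<and> \<not> R) \<or> (\<not> P \<and> Q \<and> \<not> R) \<or> (\<not> P \<and> \<not> Q \<and> R)"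

end

theory Submission
  imports Defs "HOL-Combinatorics.Transposition"
begin

text \<open>Let $q$ be elementary of size $n$. Modulo signs the generators of $F_q$ commute, so
  $F_q$ has the basis of monomials $t^\alpha$ and $t^\alpha t^\beta = (-1)^{b(\alpha,\beta)}
  t^{\alpha+\beta}$ with a biadditive $b$ on $\Lambda$. A graded involution multiplies each
  $t^\alpha$ by a sign $(-1)^{Q(\alpha)}$, and being an anti-automorphism means exactly that $Q$
  modulo 2 is a quadratic form whose polar form is the commutator form of $F_q$. So a torus with a
  graded involution is the same thing as a quadratic form modulo 2 on $\Lambda$, with values 0 on
  the generators $t_i$ for the main involution.

  The bridge is \<open>iso_iff_forms_equiv\<close>: both kinds of isomorphism between two such
  pairs amount to an automorphism of the group $\Lambda$ carrying one form to the other. In one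
  direction, a totally ordered grading group forces every unit of $F_q$ to be a scalar multiple of
  a monomial, so that every algebra isomorphism maps the lines spanned by monomials to such lines.
  In the other direction, the two cocycles $b$ differ by a cocycle that is symmetric modulo 2, and
  such a cocycle is the coboundary of an explicit sign; correcting by this sign turns the
  automorphism of $\Lambda$ into an algebra isomorphism.

  What remains is the theory of quadratic forms over the field with two elements, with base
  changes made over the integers. Splitting off hyperbolic pairs gives a basis in which the polar
  form is standard. Among these bases, take one with as few vectors of odd value as possible. If a
  vector orthogonal to all others modulo 2 has odd value, it can be added to all the others of odd
  value; otherwise at most one pair has odd values, for two pairs of the form $x^2+xy+y^2$ can be
  exchanged for two hyperbolic ones (\<open>quadratic_form_classification\<close>). These three
  outcomes are $*$, $\tau_1$ and $\tau_2$. The number $2^{n-2l}$ of classes modulo 2 in the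
  radical recovers $l$, and the sum of the signs $(-1)^Q$ over $\Lambda/2\Lambda$ is positive,
  zero or negative in the three cases (\<open>standard_form_unique\<close>).

  For a main involution the zeros of $Q$ generate $\Lambda$. This fails for $\tau_1$ with $l=0$
  and for $\tau_2$ with $l=1$, where all zeros have an even first coordinate. In the other cases
  of $\tau_1$ and $\tau_2$, adding the sum of a hyperbolic pair to the vectors of odd value gives
  a basis of zeros of $Q$, whose commutator matrix contains the block $\mathbf m_3$ or $\mathbf
  m_4$.\<close>

section \<open>Linear extension\<close>

abbreviation "single \<equiv> Poly_Mapping.single"

abbreviation "lookup \<equiv> Poly_Mapping.lookup"

abbreviation "keys \<equiv> Poly_Mapping.keys"

lemma poly_mapping_eq_sum_single: "p = (\<Sum>a\<in>keys p. single a (lookup p a))"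
proof (rule poly_mapping_eqI)
  fix k
  have "lookup (\<Sum>a\<in>keys p. single a (lookup p a)) k
      = (\<Sum>a\<in>keys p. if a = k then lookup p a else 0)"
    unfolding lookup_sum by (rule sum.cong) (auto simp: lookup_single)
  also have "\<dots> = lookup p k"
    by (simp add: in_keys_iff)
  finally show "lookup p k
      = lookup (\<Sum>a\<in>keys p. single a (lookup p a)) k"
    by simp
qed

text \<open>Identities between additive maps are checked on multiples of basis elements. The set
  $A$ lets $P$ include membership in a submodule spanned by basis elements.\<close>

lemma poly_mapping_additive_induct [consumes 1, case_names zero single add]:
  fixes p :: "'a \<Rightarrow>\<^sub>0 'b::comm_monoid_add"
  assumes "keys p \<subseteq> A" and "P 0"
    and "\<And>a c. a \<in> A \<Longrightarrow> P (single a c)"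
    and "\<And>x y. P x \<Longrightarrow> P y \<Longrightarrow> P (x + y)"
  shows "P p"
proof -
  have "P (\<Sum>a\<in>B. single a (lookup p a))" if "finite B" "B \<subseteq> A" for B
    using that by (induction B rule: finite_induct) (auto intro: assms)
  from this[of "keys p"] show ?thesis
    using assms(1) poly_mapping_eq_sum_single[of p] by simp
qed

text \<open>In a monoid algebra, multiplication by \<open>single 0 c\<close> is the scalar action
  of $c$. This makes the ring axioms of the type available for scalars.\<close>

lemma lookup_scale:
  fixes p :: "'a::monoid_add \<Rightarrow>\<^sub>0 'f::comm_ring_1"
  shows "lookup (single 0 c * p) a = c * lookup p a"
  by (simp flip: mult_map_scale_conv_mult add: Poly_Mapping.map.rep_eq when_def)

lemma scale_commute:
  fixes p :: "'a::monoid_add \<Rightarrow>\<^sub>0 'f::comm_ring_1"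
  shows "p * single 0 c = single 0 c * p"
  using subset_UNIV[of "keys p"]
  by (induction rule: poly_mapping_additive_induct) (auto simp: mult_single algebra_simps)

lemma keys_scale_subset:
  fixes p :: "'a::monoid_add \<Rightarrow>\<^sub>0 'f::comm_ring_1"
  shows "keys (single 0 c * p) \<subseteq> keys p"
  by (auto simp: in_keys_iff lookup_scale)

definition lext :: "('a \<Rightarrow> 'b::monoid_add \<Rightarrow>\<^sub>0 'f::comm_ring_1) \<Rightarrow> ('a \<Rightarrow>\<^sub>0 'f) \<Rightarrow> 'b \<Rightarrow>\<^sub>0 'f" where
  "lext \<phi> p = (\<Sum>a\<in>keys p. single 0 (lookup p a) * \<phi> a)"

lemma lext_superset:
  assumes "finite A" "keys p \<subseteq> A"
  shows "lext \<phi> p = (\<Sum>a\<in>A. single 0 (lookup p a) * \<phi> a)"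
  unfolding lext_def by (rule sum.mono_neutral_left) (use assms in \<open>auto simp: in_keys_iff\<close>)

lemma lext_zero [simp]: "lext \<phi> 0 = 0"
  by (simp add: lext_def)

lemma lext_add: "lext \<phi> (p + q) = lext \<phi> p + lext \<phi> q"
proof -
  let ?A = "keys p \<union> keys q"
  have "keys (p + q) \<subseteq> ?A"
    by (rule Poly_Mapping.keys_add)
  then show ?thesis
    by (simp add: lext_superset[of ?A] lookup_add single_add algebra_simps sum.distrib)
qed

lemma lext_single [simp]: "lext \<phi> (single a c) = single 0 c * \<phi> a"
  by (cases "c = 0") (simp_all add: lext_def)

lemma lext_scale: "lext \<phi> (single 0 c * p) = single 0 c * lext \<phi> p"
  using subset_UNIV[of "keys p"]
  by (induction rule: poly_mapping_additive_induct)
    (auto simp: mult_single lext_add distrib_left simp flip: mult.assoc)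

lemma lext_add_fun: "lext (\<lambda>a. \<phi> a + \<psi> a) p = lext \<phi> p + lext \<psi> p"
  by (simp add: lext_def distrib_left sum.distrib)

lemma lext_scale_fun: "lext (\<lambda>a. single 0 c * \<phi> a) p = single 0 c * lext \<phi> p"
  by (simp add: lext_def sum_distrib_left mult.assoc[symmetric] mult_single mult.commute)

lemma lext_zero_fun [simp]: "lext (\<lambda>a. 0) p = 0"
  by (simp add: lext_def)

lemma keys_lext: "keys (lext \<phi> p) \<subseteq> (\<Union>a\<in>keys p. keys (\<phi> a))"
  unfolding lext_def
  by (rule order_trans[OF keys_sum]) (use keys_scale_subset in blast)

section \<open>Twisted group algebras\<close>

text \<open>Signs are written additively, as integers modulo 2, so that products of signs become
  sums of bilinear forms.\<close>

definition sg :: "int \<Rightarrow> 'f::comm_ring_1" where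
  "sg k = (if even k then 1 else -1)"

lemma sg_add: "sg (j + k) = sg j * sg k"
  by (simp add: sg_def)

lemma sg_simps [simp]: "sg 0 = 1" "sg k * sg k = 1" "sg (- k) = sg k" "sg 1 = -1"
  by (simp_all add: sg_def)

lemma sg_cong: "even j = even k \<Longrightarrow> sg j = sg k"
  by (simp add: sg_def)

text \<open>The product of the group algebra twisted by the cocycle $(-1)^b$.\<close>

definition tmul :: "('a::monoid_add \<Rightarrow> 'a \<Rightarrow> int) \<Rightarrow> ('a \<Rightarrow>\<^sub>0 'f::comm_ring_1) \<Rightarrow> ('a \<Rightarrow>\<^sub>0 'f) \<Rightarrow> 'a \<Rightarrow>\<^sub>0 'f" where
  "tmul b x y = lext (\<lambda>\<alpha>. lext (\<lambda>\<beta>. single (\<alpha> + \<beta>) (sg (b \<alpha> \<beta>))) y) x"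

lemma tmul_zero [simp]: "tmul b 0 y = 0" "tmul b x 0 = 0"
  by (simp_all add: tmul_def)

lemma tmul_add:
  "tmul b (x + x') y = tmul b x y + tmul b x' y" "tmul b x (y + y') = tmul b x y + tmul b x y'"
  by (simp_all add: tmul_def lext_add lext_add_fun)

lemma tmul_scale:
  "tmul b (single 0 c * x) y = single 0 c * tmul b x y"
  "tmul b x (single 0 c * y) = single 0 c * tmul b x y"
  by (simp_all add: tmul_def lext_scale lext_scale_fun)

lemma tmul_single [simp]:
  "tmul b (single \<alpha> c) (single \<beta> d)
    = single (\<alpha> + \<beta>) (c * d * sg (b \<alpha> \<beta>))"
  by (simp add: tmul_def mult_single mult.assoc)

text \<open>The exponent of the sign $q_{ij}$.\<close>

definition eexp :: "'f::field mat \<Rightarrow> nat \<Rightarrow> nat \<Rightarrow> int" where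
  "eexp q i j = (if q $$ (i, j) = 1 then 0 else 1)"

text \<open>The exponent of the sign with $t^\alpha t^\beta = \pm t^{\alpha+\beta}$: moving
  $t_i^{\beta_i}$ to the left past $t_j^{\alpha_j}$ for $i<j$ costs the sign
  $q_{ij}^{\alpha_j\beta_i}$.\<close>

definition bform :: "'f::field mat \<Rightarrow> (nat \<Rightarrow>\<^sub>0 int) \<Rightarrow> (nat \<Rightarrow>\<^sub>0 int) \<Rightarrow> int" where
  "bform q \<alpha> \<beta> = (\<Sum>j<dim_row q. \<Sum>i<j. eexp q i j * lookup \<alpha> j * lookup \<beta> i)"

lemma bform_add:
  "bform q (\<alpha> + \<alpha>') \<beta> = bform q \<alpha> \<beta> + bform q \<alpha>' \<beta>" "bform q \<alpha> (\<beta> + \<beta>') = bform q \<alpha> \<beta> + bform q \<alpha> \<beta>'"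
  by (simp_all add: bform_def lookup_add algebra_simps sum.distrib)

lemma bform_uminus [simp]: "bform q (- \<alpha>) \<beta> = - bform q \<alpha> \<beta>" "bform q \<alpha> (- \<beta>) = - bform q \<alpha> \<beta>"
  by (simp_all add: bform_def sum_negf)

lemma bform_zero [simp]: "bform q 0 \<beta> = 0" "bform q \<alpha> 0 = 0"
  by (simp_all add: bform_def)

lemma bform_frag_of_left:
  assumes "k < dim_row q"
  shows "bform q (frag_of k) \<beta> = (\<Sum>i<k. eexp q i k * lookup \<beta> i)"
proof -
  have "bform q (frag_of k) \<beta>
      = (\<Sum>j<dim_row q. if j = k then (\<Sum>i<k. eexp q i k * lookup \<beta> i) else 0)"
    unfolding bform_def by (rule sum.cong) auto
  then show ?thesis using assms by simp
qed

lemma bform_frag_of: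
  assumes "j < dim_row q"
  shows "bform q (frag_of j) (frag_of i) = (if i < j then eexp q i j else 0)"
proof -
  have "bform q (frag_of j) (frag_of i) = (\<Sum>i'<j. if i' = i then eexp q i j else 0)"
    unfolding bform_frag_of_left[OF assms] by (rule sum.cong) auto
  then show ?thesis by simp
qed

section \<open>Words and their signed degrees\<close>

fun gdeg :: "gen \<Rightarrow> nat \<Rightarrow>\<^sub>0 int" where
  "gdeg (Gen i) = frag_of i" | "gdeg (GenInv i) = - frag_of i"

fun gidx :: "gen \<Rightarrow> nat" where
  "gidx (Gen i) = i" | "gidx (GenInv i) = i"

fun wdeg :: "gen list \<Rightarrow> nat \<Rightarrow>\<^sub>0 int" where
  "wdeg [] = 0" | "wdeg (g # w) = gdeg g + wdeg w"

text \<open>The sign picked up when the word is multiplied out, from the right, in the twisted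
  group algebra.\<close>

fun wsgn :: "'f::field mat \<Rightarrow> gen list \<Rightarrow> int" where
  "wsgn q [] = 0" | "wsgn q (g # w) = bform q (gdeg g) (wdeg w) + wsgn q w"

lemma wdeg_append [simp]: "wdeg (u @ v) = wdeg u + wdeg v"
  by (induction u) (simp_all add: algebra_simps)

lemma wsgn_append: "wsgn q (u @ v) = wsgn q u + wsgn q v + bform q (wdeg u) (wdeg v)"
  by (induction u) (simp_all add: algebra_simps bform_add)

lemma in_gens_iff: "g \<in> gens n \<longleftrightarrow> gidx g < n"
  by (cases g) (auto simp: gens_def)

lemma Lambda_iff: "d \<in> Lambda n \<longleftrightarrow> keys d \<subseteq> {..<n}"
  by (simp add: Lambda_def)

lemma Lambda_closed [simp, intro]:
  "0 \<in> Lambda n" "x \<in> Lambda n \<Longrightarrow> y \<in> Lambda n \<Longrightarrow> x + y \<in> Lambda n"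
  "x \<in> Lambda n \<Longrightarrow> y \<in> Lambda n \<Longrightarrow> x - y \<in> Lambda n" "x \<in> Lambda n \<Longrightarrow> - x \<in> Lambda n"
  "x \<in> Lambda n \<Longrightarrow> frag_cmul c x \<in> Lambda n"
  "k < n \<Longrightarrow> frag_of k \<in> Lambda n"
  using Poly_Mapping.keys_add[of x y] keys_diff[of x y] keys_cmul[of c x]
  by (auto simp: Lambda_iff keys_frag_of)

lemma wdeg_in_Lambda: "set w \<subseteq> gens n \<Longrightarrow> wdeg w \<in> Lambda n"
proof (induction w)
  case (Cons g w)
  then show ?case by (cases g) (auto simp: gens_def)
qed simp

text \<open>The homomorphism from the free algebra to the twisted group algebra. Its kernel will
  turn out to be the ideal of relations, so that the twisted group algebra is a model of the
  quantum torus in which the monomials are visibly independent.\<close>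

definition Phi :: "'f::field mat \<Rightarrow> 'f free_alg \<Rightarrow> (nat \<Rightarrow>\<^sub>0 int) \<Rightarrow>\<^sub>0 'f" where
  "Phi q = lext (\<lambda>w. single (wdeg (letters w)) (sg (wsgn q (letters w))))"

lemma Phi_add: "Phi q (p + r) = Phi q p + Phi q r"
  by (simp add: Phi_def lext_add)

lemma Phi_scale: "Phi q (single 0 c * p) = single 0 c * Phi q p"
  by (simp add: Phi_def lext_scale)

lemma Phi_zero [simp]: "Phi q 0 = 0"
  by (simp add: Phi_def)

lemma Phi_single [simp]:
  "Phi q (single w c) = single (wdeg (letters w)) (c * sg (wsgn q (letters w)))"
  by (simp add: Phi_def mult_single)

lemma Phi_diff: "Phi q (p - r) = Phi q p - Phi q r"
  using Phi_add[of q "p - r" r] by simp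

lemma Phi_mult: "Phi q (p * r) = tmul (bform q) (Phi q p) (Phi q r)"
  using subset_UNIV[of "keys p"]
proof (induction rule: poly_mapping_additive_induct)
  case (single a c)
  show ?case
    using subset_UNIV[of "keys r"]
  proof (induction rule: poly_mapping_additive_induct)
    case (single a c)
    then show ?case
      by (simp add: mult_single plus_word_monoid_def wsgn_append sg_add algebra_simps)
  qed (simp_all add: distrib_left Phi_add tmul_add)
qed (simp_all add: distrib_right Phi_add tmul_add)

lemma elementary_dim: "elementary_quantum_matrix n q \<Longrightarrow> dim_row q = n"
  by (auto simp: elementary_quantum_matrix_def quantum_matrix_def)

text \<open>A sign is its own inverse, so $q_{ji} = q_{ij}^{-1}$ means symmetry.\<close>

lemma elementary_sym:
  assumes "elementary_quantum_matrix n q" "i < n" "j < n"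
  shows "q $$ (j, i) = q $$ (i, j)"
proof -
  have "q $$ (i, j) * q $$ (j, i) = 1" "q $$ (i, j) \<in> {1, -1}"
    using assms by (auto simp: elementary_quantum_matrix_def quantum_matrix_def)
  then show ?thesis by (auto simp: minus_equation_iff)
qed

lemma elementary_entry:
  assumes "elementary_quantum_matrix n q" "i < n" "j < n"
  shows "q $$ (i, j) = sg (eexp q i j)"
  using assms by (auto simp: elementary_quantum_matrix_def eexp_def sg_def)

lemma elementary_eexp:
  assumes "elementary_quantum_matrix n q" "i < n" "j < n"
  shows "eexp q j i = eexp q i j" and "eexp q i i = 0"
  using assms elementary_sym[OF assms]
  by (auto simp: eexp_def elementary_quantum_matrix_def quantum_matrix_def)

lemma letter_mult: "letter g * letter h = single (Word [g, h]) 1"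
  by (simp add: letter_def mult_single plus_word_monoid_def)

lemma Phi_relators:
  assumes q: "elementary_quantum_matrix n q" and p: "p \<in> relators q"
  shows "Phi q p = 0"
proof -
  note dim = elementary_dim[OF q]
  have one: "Phi q 1 = single 0 1"
    by (simp flip: single_one add: zero_word_monoid_def)
  from p consider i where "p = letter (Gen i) * letter (GenInv i) - 1" "i < n"
    | i where "p = letter (GenInv i) * letter (Gen i) - 1" "i < n"
    | i j where "p = letter (Gen j) * letter (Gen i)
        - const (q $$ (i, j)) * letter (Gen i) * letter (Gen j)" "i < n" "j < n"
    unfolding relators_def dim by blast
  then show ?thesis
  proof cases
    case 1
    then show ?thesis
      by (simp add: Phi_diff one letter_mult bform_frag_of dim)
  next
    case 2
    then show ?thesis
      by (simp add: Phi_diff one letter_mult bform_frag_of dim)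
  next
    case 3
    have *: "eexp q i i = 0" "eexp q j i = eexp q i j" "eexp q j j = 0"
      using elementary_eexp[OF q] 3 by auto
    have "Phi q p = single (frag_of j + frag_of i) (sg (bform q (frag_of j) (frag_of i)))
        - single (frag_of i + frag_of j)
            (sg (eexp q i j) * sg (bform q (frag_of i) (frag_of j)))"
      using 3 elementary_entry[OF q, of i j]
      by (simp add: Phi_diff const_def letter_mult mult.assoc Phi_scale mult_single)
    also have "\<dots> = 0"
      using 3 * by (cases i j rule: linorder_cases) (auto simp: bform_frag_of dim add.commute)
    finally show ?thesis .
  qed
qed

section \<open>Reduction of words to monomials\<close>

lemma free_algebra_simps [simp]:
  "p \<in> carrier (free_algebra n) \<longleftrightarrow> (\<forall>w \<in> keys p. set (letters w) \<subseteq> gens n)"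
  "p \<otimes>\<^bsub>free_algebra n\<^esub> r = p * r" "\<one>\<^bsub>free_algebra n\<^esub> = 1"
  "\<zero>\<^bsub>free_algebra n\<^esub> = 0" "p \<oplus>\<^bsub>free_algebra n\<^esub> r = p + r"
  by (simp_all add: free_algebra_def)

lemma free_algebra_closed:
  assumes "p \<in> carrier (free_algebra n)" "r \<in> carrier (free_algebra n)"
  shows "p + r \<in> carrier (free_algebra n)" "p * r \<in> carrier (free_algebra n)"
    "p - r \<in> carrier (free_algebra n)" "- p \<in> carrier (free_algebra n)"
proof -
  show "p + r \<in> carrier (free_algebra n)"
    using assms Poly_Mapping.keys_add[of p r] by fastforce
  show "- p \<in> carrier (free_algebra n)"
    using assms by (auto simp: in_keys_iff)
  show "p - r \<in> carrier (free_algebra n)"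
    using assms keys_diff[of p r] by fastforce
  show "p * r \<in> carrier (free_algebra n)"
    using assms keys_mult[of p r] by (fastforce simp: plus_word_monoid_def)
qed

lemma ring_free_algebra: "ring (free_algebra n :: 'f::field free_alg ring)"
proof (rule ringI)
  show "abelian_group (free_algebra n :: 'f free_alg ring)"
  proof (rule abelian_groupI)
    fix x :: "'f free_alg"
    assume "x \<in> carrier (free_algebra n)"
    then show "\<exists>y\<in>carrier (free_algebra n). y \<oplus>\<^bsub>free_algebra n\<^esub> x = \<zero>\<^bsub>free_algebra n\<^esub>"
      using free_algebra_closed(4) by (intro bexI[of _ "- x"]) auto
  next
    fix x y :: "'f free_alg"
    assume "x \<in> carrier (free_algebra n)" "y \<in> carrier (free_algebra n)"
    then show "x \<oplus>\<^bsub>free_algebra n\<^esub> y \<in> carrier (free_algebra n)"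
      using free_algebra_closed(1) by simp
  qed (simp_all add: algebra_simps)
  show "monoid (free_algebra n :: 'f free_alg ring)"
  proof (rule monoidI)
    fix x y :: "'f free_alg"
    assume "x \<in> carrier (free_algebra n)" "y \<in> carrier (free_algebra n)"
    then show "x \<otimes>\<^bsub>free_algebra n\<^esub> y \<in> carrier (free_algebra n)"
      using free_algebra_closed(2) by simp
  qed (simp_all add: algebra_simps zero_word_monoid_def)
qed (simp_all add: algebra_simps)

abbreviation wmon :: "gen list \<Rightarrow> 'f::field free_alg" where
  "wmon u \<equiv> single (Word u) 1"

lemma wmon_append: "wmon (u @ v) = wmon u * wmon v"
  by (simp add: mult_single plus_word_monoid_def)

lemma wmon_Nil: "wmon [] = 1"
  by (simp flip: zero_word_monoid_def)

lemma wmon_carrier: "set u \<subseteq> gens n \<Longrightarrow> wmon u \<in> carrier (free_algebra n)"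
  by simp

lemma const_carrier: "single 0 c \<in> carrier (free_algebra n)"
  by (simp add: zero_word_monoid_def)

lemma relators_carrier: "relators q \<subseteq> carrier (free_algebra (dim_row q))"
proof
  fix p assume p: "p \<in> relators q"
  have l: "letter g \<in> carrier (free_algebra (dim_row q))" if "gidx g < dim_row q" for g
    using that by (simp add: letter_def in_gens_iff)
  have 1: "1 \<in> carrier (free_algebra (dim_row q))"
    using const_carrier[of 1] by simp
  show "p \<in> carrier (free_algebra (dim_row q))"
    using p unfolding relators_def const_def
    by (elim UnE CollectE exE conjE; hypsubst;
        intro free_algebra_closed l 1 const_carrier) auto
qed

locale elementary_torus =
  fixes q :: "'f::field mat" and n :: nat
  assumes elementary: "elementary_quantum_matrix n q"
begin

lemma dim [simp]: "dim_row q = n"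
  using elementary by (rule elementary_dim)

sublocale FA: ring "free_algebra n :: 'f free_alg ring"
  by (rule ring_free_algebra)

sublocale rel: ideal "relation_ideal q" "free_algebra n :: 'f free_alg ring"
  using FA.genideal_ideal[of "relators q"] relators_carrier[of q]
  by (simp add: relation_ideal_def)

lemma rel_add: "a \<in> relation_ideal q \<Longrightarrow> b \<in> relation_ideal q \<Longrightarrow> a + b \<in> relation_ideal q"
  using rel.a_closed by simp

lemma rel_mult:
  "a \<in> relation_ideal q \<Longrightarrow> x \<in> carrier (free_algebra n) \<Longrightarrow> x * a \<in> relation_ideal q"
  "a \<in> relation_ideal q \<Longrightarrow> x \<in> carrier (free_algebra n) \<Longrightarrow> a * x \<in> relation_ideal q"
  using rel.I_l_closed rel.I_r_closed by (simp_all del: free_algebra_simps(1))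

lemma rel_scale: "a \<in> relation_ideal q \<Longrightarrow> single 0 c * a \<in> relation_ideal q"
  by (rule rel_mult(1)[OF _ const_carrier])

lemma rel_uminus: "a \<in> relation_ideal q \<Longrightarrow> - a \<in> relation_ideal q"
  using rel_scale[of a "-1"] by (simp add: single_uminus)

lemma rel_zero: "0 \<in> relation_ideal q"
  using rel.zero_closed by simp

lemma relators_rel: "relators q \<subseteq> relation_ideal q"
  using FA.genideal_self[of "relators q"] relators_carrier[of q] by (simp add: relation_ideal_def)

text \<open>Two words agree in the quantum torus up to the sign $(-1)^s$. The reduction of words
  below uses no other combinations in the free algebra.\<close>

definition weq :: "int \<Rightarrow> gen list \<Rightarrow> gen list \<Rightarrow> bool" where
  "weq s u v \<longleftrightarrow> set u \<subseteq> gens n \<and> set v \<subseteq> gens n \<and>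
     wmon u - single 0 (sg s) * wmon v \<in> relation_ideal q"

lemma weq_refl: "set u \<subseteq> gens n \<Longrightarrow> weq 0 u u"
  by (simp add: weq_def rel_zero)

lemma weq_parity: "weq s u v \<Longrightarrow> even s = even t \<Longrightarrow> weq t u v"
  using sg_cong[of s t, where 'a='f] by (simp add: weq_def)

lemma weq_trans:
  assumes "weq s u v" "weq t v w"
  shows "weq (s + t) u w"
proof -
  have "(wmon u - single 0 (sg s) * wmon v)
      + single 0 (sg s) * (wmon v - single 0 (sg t) * wmon w)
      \<in> relation_ideal q"
    using assms by (intro rel_add rel_scale) (simp_all add: weq_def)
  then show ?thesis
    using assms by (simp add: weq_def algebra_simps sg_add mult_single flip: mult.assoc)
qed

lemma weq_sym:
  assumes "weq s u v"
  shows "weq s v u"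
proof -
  have "- (single 0 (sg s) * (wmon u - single 0 (sg s) * wmon v))
      \<in> relation_ideal q"
    using assms by (intro rel_uminus rel_scale) (simp add: weq_def)
  then show ?thesis
    using assms by (simp add: weq_def algebra_simps mult_single flip: mult.assoc)
qed

lemma weq_context:
  assumes "weq s u v" "set x \<subseteq> gens n" "set y \<subseteq> gens n"
  shows "weq s (x @ u @ y) (x @ v @ y)"
proof -
  have "wmon x * ((wmon u - single 0 (sg s) * wmon v) * wmon y) \<in> relation_ideal q"
    using assms by (intro rel_mult wmon_carrier) (simp_all add: weq_def)
  moreover have "wmon x * ((wmon u - single 0 (sg s) * wmon v) * wmon y)
      = (wmon (x @ u @ y) :: 'f free_alg) - single 0 (sg s) * wmon (x @ v @ y)"
    unfolding wmon_append
    by (simp only: left_diff_distrib right_diff_distrib mult.assoc[symmetric] scale_commute[of "wmon x"])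
  ultimately show ?thesis
    using assms by (simp add: weq_def)
qed

lemma weq_cancel:
  assumes "i < n"
  shows "weq 0 [Gen i, GenInv i] []" "weq 0 [GenInv i, Gen i] []"
proof -
  have "letter (Gen i) * letter (GenInv i) - 1 \<in> relation_ideal q"
    "letter (GenInv i) * letter (Gen i) - 1 \<in> relation_ideal q"
    by (intro subsetD[OF relators_rel]; use assms in \<open>simp add: relators_def; blast\<close>)+
  then show "weq 0 [Gen i, GenInv i] []" "weq 0 [GenInv i, Gen i] []"
    using assms by (simp_all add: weq_def in_gens_iff letter_mult wmon_Nil)
qed

text \<open>From $ax = \pm xa$ one gets $a^{-1}x = a^{-1}xaa^{-1} = \pm a^{-1}axa^{-1} = \pm
  xa^{-1}$.\<close>

lemma weq_swap_inverse:
  assumes "weq s [a, x] [x, a]" "weq 0 [a, a'] []" "weq 0 [a', a] []"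
  shows "weq s [a', x] [x, a']"
proof -
  have g: "set [a, a', x] \<subseteq> gens n"
    using assms by (auto simp: weq_def)
  have "weq 0 [a', x] [a', x, a, a']"
    using weq_context[OF weq_sym[OF assms(2)], of "[a', x]" "[]"] g by simp
  moreover have "weq s [a', x, a, a'] [a', a, x, a']"
    using weq_context[OF weq_sym[OF assms(1)], of "[a']" "[a']"] g by simp
  moreover have "weq 0 [a', a, x, a'] [x, a']"
    using weq_context[OF assms(3), of "[]" "[x, a']"] g by simp
  ultimately show ?thesis
    using weq_trans weq_parity by (metis add_0 add_0_right)
qed

lemma weq_swap:
  assumes "g \<in> gens n" "h \<in> gens n"
  shows "weq (eexp q (gidx h) (gidx g)) [g, h] [h, g]"
proof -
  have pos: "weq (eexp q i j) [Gen j, Gen i] [Gen i, Gen j]" if "i < n" "j < n" for i j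
  proof -
    have "letter (Gen j) * letter (Gen i) - const (q $$ (i, j)) * letter (Gen i) * letter (Gen j)
        \<in> relation_ideal q"
      by (intro subsetD[OF relators_rel]) (use that in \<open>simp add: relators_def; blast\<close>)
    then show ?thesis
      using that elementary_entry[OF elementary that]
      by (simp add: weq_def in_gens_iff letter_mult const_def mult.assoc)
  qed
  have inv1: "weq (eexp q i j) [GenInv j, Gen i] [Gen i, GenInv j]" if "i < n" "j < n" for i j
    using weq_swap_inverse[OF pos weq_cancel] that by blast
  have inv2: "weq (eexp q i j) [h, GenInv i] [GenInv i, h]"
    if "i < n" "weq (eexp q i j) [h, Gen i] [Gen i, h]" for i j h
    using weq_sym[OF weq_swap_inverse[OF weq_sym[OF that(2)] weq_cancel]] that by blast
  show ?thesis
  proof (cases h)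
    case (Gen i)
    then show ?thesis
      using assms pos inv1 by (cases g) (simp_all add: in_gens_iff)
  next
    case (GenInv i)
    then have "weq (eexp q i (gidx g)) [g, Gen i] [Gen i, g]"
      using assms pos inv1 by (cases g) (simp_all add: in_gens_iff)
    with GenInv show ?thesis
      using assms by (simp add: in_gens_iff inv2)
  qed
qed

lemma weq_swap_replicate:
  assumes "weq s [g, h] [h, g]"
  shows "weq (s * int m) (g # replicate m h) (replicate m h @ [g])"
proof (induction m)
  case 0
  then show ?case using assms by (simp add: weq_def rel_zero)
next
  case (Suc m)
  have g: "set [g, h] \<subseteq> gens n"
    using assms by (auto simp: weq_def)
  then have r: "set (replicate m h) \<subseteq> gens n"
    by (auto simp: set_replicate_conv_if)
  have "weq s (g # h # replicate m h) (h # g # replicate m h)"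
    using weq_context[OF assms _ r, of "[]"] by simp
  moreover have "weq (s * int m) (h # g # replicate m h) (h # replicate m h @ [g])"
    using weq_context[OF Suc, of "[h]" "[]"] g by auto
  ultimately have "weq (s + s * int m) (g # h # replicate m h) (h # replicate m h @ [g])"
    by (rule weq_trans)
  then show ?case by (simp add: algebra_simps)
qed

text \<open>The word for $t_i^k$; negative powers are words in the letter $t_i^{-1}$.\<close>

definition block :: "nat \<Rightarrow> int \<Rightarrow> gen list" where
  "block i k = (if k \<ge> 0 then replicate (nat k) (Gen i) else replicate (nat (- k)) (GenInv i))"

lemma block_gens: "i < n \<Longrightarrow> set (block i k) \<subseteq> gens n"
  by (auto simp: block_def in_gens_iff)

lemma weq_swap_block:
  assumes "g \<in> gens n" "i < n"
  shows "weq (eexp q i (gidx g) * k) (g # block i k) (block i k @ [g])"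
proof (cases "k \<ge> 0")
  case True
  have "weq (eexp q i (gidx g)) [g, Gen i] [Gen i, g]"
    using weq_swap[OF assms(1), of "Gen i"] assms(2) by (simp add: in_gens_iff)
  from weq_swap_replicate[OF this, of "nat k"] True show ?thesis
    by (simp add: block_def)
next
  case False
  have "weq (eexp q i (gidx g)) [g, GenInv i] [GenInv i, g]"
    using weq_swap[OF assms(1), of "GenInv i"] assms(2) by (simp add: in_gens_iff)
  from weq_swap_replicate[OF this, of "nat (- k)"]
  have "weq (eexp q i (gidx g) * int (nat (- k))) (g # block i k) (block i k @ [g])"
    using False by (simp add: block_def)
  moreover have "int (nat (- k)) = - k" using False by simp
  ultimately show ?thesis
    by (metis weq_parity even_minus mult_minus_right)
qed

lemma weq_absorb:
  assumes "i < n"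
  shows "weq 0 (Gen i # block i k) (block i (k + 1))" "weq 0 (GenInv i # block i k) (block i (k - 1))"
proof -
  have g: "Gen i \<in> gens n" "GenInv i \<in> gens n"
    using assms by (simp_all add: in_gens_iff)
  show "weq 0 (Gen i # block i k) (block i (k + 1))"
  proof (cases "k \<ge> 0")
    case True
    then have "Gen i # block i k = block i (k + 1)"
      by (simp add: block_def nat_add_distrib)
    then show ?thesis using weq_refl[OF block_gens[OF assms]] by simp
  next
    case False
    then have "nat (- k) = Suc (nat (- (k + 1)))" by simp
    then have "block i k = GenInv i # block i (k + 1)"
      using False by (auto simp: block_def)
    then show ?thesis
      using weq_context[OF weq_cancel(1)[OF assms], of "[]"] block_gens[OF assms] by fastforce
  qed
  show "weq 0 (GenInv i # block i k) (block i (k - 1))"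
  proof (cases "k \<le> 0")
    case True
    then have "nat (1 - k) = Suc (nat (- k))" by simp
    then have "GenInv i # block i k = block i (k - 1)"
      using True by (auto simp: block_def)
    then show ?thesis using weq_refl[OF block_gens[OF assms]] by simp
  next
    case False
    then have "nat k = Suc (nat (k - 1))" by simp
    then have "block i k = Gen i # block i (k - 1)"
      using False by (auto simp: block_def)
    then show ?thesis
      using weq_context[OF weq_cancel(2)[OF assms], of "[]"] block_gens[OF assms] by fastforce
  qed
qed

text \<open>The word for $t_m^{d_m} \cdots t_{n-1}^{d_{n-1}}$. The lower end $m$ is variable
  because letters are inserted by induction from the right end.\<close>

definition nword :: "nat \<Rightarrow> (nat \<Rightarrow>\<^sub>0 int) \<Rightarrow> gen list" where
  "nword m d = concat (map (\<lambda>i. block i (lookup d i)) [m..<n])"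

lemma nword_gens: "set (nword m d) \<subseteq> gens n"
  using block_gens by (fastforce simp: nword_def)

lemma nword_Cons: "m < n \<Longrightarrow> nword m d = block m (lookup d m) @ nword (Suc m) d"
  by (simp add: nword_def upt_conv_Cons)

lemma nword_cong:
  "(\<And>i. m \<le> i \<Longrightarrow> i < n \<Longrightarrow> lookup d i = lookup d' i) \<Longrightarrow> nword m d = nword m d'"
  unfolding nword_def by (rule arg_cong[where f = concat]) simp

text \<open>A letter in front is moved to the right through the blocks of smaller index, each at
  the cost of a commutation sign, and absorbed in its own block.\<close>

lemma weq_insert:
  assumes g: "g \<in> gens n" and "m \<le> gidx g"
  shows "weq (\<Sum>i=m..<gidx g. eexp q i (gidx g) * lookup d i)
    (g # nword m d) (nword m (d + gdeg g))"
  using assms(2)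
proof (induction m rule: inc_induct)
  case base
  let ?k = "gidx g"
  have k: "?k < n" using g by (simp add: in_gens_iff)
  have "weq 0 (g # block ?k (lookup d ?k)) (block ?k (lookup (d + gdeg g) ?k))"
    using weq_absorb[OF k] by (cases g) (auto simp: lookup_add lookup_minus)
  from weq_context[OF this, of "[]" "nword (Suc ?k) d"]
  have "weq 0 (g # nword ?k d) (block ?k (lookup (d + gdeg g) ?k) @ nword (Suc ?k) d)"
    using nword_gens k by (simp add: nword_Cons)
  moreover have "nword (Suc ?k) d = nword (Suc ?k) (d + gdeg g)"
    by (rule nword_cong) (cases g; simp add: lookup_add lookup_minus)
  ultimately show ?case
    using k by (simp add: nword_Cons)
next
  case (step m)
  let ?k = "gidx g"
  have k: "?k < n" using g by (simp add: in_gens_iff)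
  then have m: "m < n" using step by simp
  have "weq (eexp q m ?k * lookup d m) (g # block m (lookup d m) @ nword (Suc m) d)
      (block m (lookup d m) @ g # nword (Suc m) d)"
    using weq_context[OF weq_swap_block[OF g m], of "[]" "nword (Suc m) d"] nword_gens by auto
  moreover have "weq (\<Sum>i=Suc m..<?k. eexp q i ?k * lookup d i)
      (block m (lookup d m) @ g # nword (Suc m) d)
      (block m (lookup d m) @ nword (Suc m) (d + gdeg g))"
    using weq_context[OF step.IH, of "block m (lookup d m)" "[]"] block_gens[OF m] by auto
  ultimately have "weq (eexp q m ?k * lookup d m + (\<Sum>i=Suc m..<?k. eexp q i ?k * lookup d i))
      (g # nword m d) (block m (lookup d m) @ nword (Suc m) (d + gdeg g))"
    using weq_trans m by (simp add: nword_Cons)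
  moreover have "lookup (d + gdeg g) m = lookup d m"
    using step.hyps by (cases g) (auto simp: lookup_add lookup_minus)
  moreover have "(\<Sum>i=m..<?k. eexp q i ?k * lookup d i)
     = eexp q m ?k * lookup d m + (\<Sum>i=Suc m..<?k. eexp q i ?k * lookup d i)"
    using step.hyps by (simp add: sum.atLeast_Suc_lessThan)
  ultimately show ?case
    using m by (simp add: nword_Cons)
qed

lemma weq_normal_form:
  assumes "set w \<subseteq> gens n"
  shows "weq (wsgn q w) w (nword 0 (wdeg w))"
  using assms
proof (induction w)
  case Nil
  have "nword 0 0 = []" by (simp add: nword_def block_def)
  then show ?case using weq_refl[of "[]"] by simp
next
  case (Cons g w)
  then have g: "g \<in> gens n" by simp
  have *: "even (bform q (gdeg g) (wdeg w)) \<longleftrightarrow>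
      even (\<Sum>i=0..<gidx g. eexp q i (gidx g) * lookup (wdeg w) i)"
    using g by (cases g) (simp_all add: bform_frag_of_left in_gens_iff atLeast0LessThan)
  have "weq (wsgn q w) (g # w) (g # nword 0 (wdeg w))"
    using weq_context[OF Cons.IH, of "[g]" "[]"] Cons.prems by simp
  moreover have "weq (bform q (gdeg g) (wdeg w)) (g # nword 0 (wdeg w)) (nword 0 (wdeg w + gdeg g))"
    using weq_parity[OF weq_insert[OF g]] * by simp
  ultimately show ?case
    using weq_trans by (fastforce simp: add.commute)
qed

lemma wdeg_replicate:
  "wdeg (replicate m (Gen i)) = frag_cmul (int m) (frag_of i)"
  "wdeg (replicate m (GenInv i)) = frag_cmul (- int m) (frag_of i)"
  by (induction m) (simp_all add: frag_cmul_distrib frag_cmul_diff_distrib flip: minus_frag_cmul)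

lemma wdeg_block: "wdeg (block i k) = frag_cmul k (frag_of i)"
  by (simp add: block_def wdeg_replicate)

lemma wdeg_nword: "wdeg (nword m d) = (\<Sum>i=m..<n. frag_cmul (lookup d i) (frag_of i))"
proof -
  have "wdeg (concat ws) = sum_list (map wdeg ws)" for ws
    by (induction ws) simp_all
  then show ?thesis
    by (simp add: nword_def wdeg_block o_def interv_sum_list_conv_sum_set_nat)
qed

lemma wdeg_nword_Lambda:
  assumes "d \<in> Lambda n"
  shows "wdeg (nword 0 d) = d"
proof (rule poly_mapping_eqI)
  fix k
  have "lookup (wdeg (nword 0 d)) k = (\<Sum>i<n. if i = k then lookup d k else 0)"
    unfolding wdeg_nword lookup_sum atLeast0LessThan by (rule sum.cong) auto
  also have "\<dots> = lookup d k"
    using assms by (auto simp: Lambda_iff in_keys_iff)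
  finally show "lookup (wdeg (nword 0 d)) k = lookup d k" .
qed

text \<open>Ordered words involve no reordering: the form $b(\alpha,\beta)$ only sees indices of
  $\alpha$ that are larger than those of $\beta$.\<close>

lemma wsgn_nword: "wsgn q (nword m d) = 0"
proof -
  have b: "bform q (frag_of i) (wdeg (nword m d)) = 0" if "i \<le> m" "m \<le> n" "i < n" for i m
  proof -
    have "lookup (wdeg (nword m d)) j = 0" if "j < i" for j
      using that \<open>i \<le> m\<close> by (auto simp: wdeg_nword lookup_sum)
    then show ?thesis using that by (simp add: bform_frag_of_left)
  qed
  have r: "bform q (frag_of i) (frag_cmul k (frag_of i)) = 0" if "i < n" for i k
    using that by (auto simp: bform_frag_of_left)
  have "wsgn q (block i k) = 0" if "i < n" for i k
  proof -
    have "wsgn q (replicate m (Gen i)) = 0" "wsgn q (replicate m (GenInv i)) = 0" for m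
      using r[OF that] by (induction m) (simp_all add: wdeg_replicate)
    then show ?thesis by (simp add: block_def)
  qed
  note blk = this
  show ?thesis
  proof (cases "m \<le> n")
    case True
    then show ?thesis
    proof (induction m rule: inc_induct)
      case base
      then show ?case by (simp add: nword_def)
    next
      case (step m)
      have "bform q (frag_cmul k (frag_of m)) x = k * bform q (frag_of m) x" for k x
        by (simp add: bform_def sum_distrib_left mult_ac)
      then show ?case
        using step b[of m "Suc m"] blk
        by (simp add: nword_Cons wsgn_append wdeg_block)
    qed
  qed (simp add: nword_def)
qed

text \<open>The claim is additive in $p$, and for a single word it is the reduction above. Thus an
  element of the free algebra is determined modulo the relations by its image in the twisted group
  algebra.\<close>

lemma rel_normal_form:
  assumes "p \<in> carrier (free_algebra n)"
  shows "p - lext (\<lambda>d. wmon (nword 0 d)) (Phi q p) \<in> relation_ideal q"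
proof -
  have "keys p \<subseteq> {w. set (letters w) \<subseteq> gens n}"
    using assms by auto
  then show ?thesis
  proof (induction rule: poly_mapping_additive_induct)
    case zero
    then show ?case by (simp add: rel_zero)
  next
    case (single a c)
    then have "weq (wsgn q (letters a)) (letters a) (nword 0 (wdeg (letters a)))"
      by (intro weq_normal_form) simp
    then have "single 0 c * (wmon (letters a)
        - single 0 (sg (wsgn q (letters a))) * wmon (nword 0 (wdeg (letters a)))) \<in> relation_ideal q"
      by (intro rel_scale) (simp add: weq_def)
    moreover have "single 0 c * (wmon (letters a)
        - single 0 (sg (wsgn q (letters a))) * wmon (nword 0 (wdeg (letters a))))
      = single a c - lext (\<lambda>d. wmon (nword 0 d)) (Phi q (single a c))"
      by (simp add: right_diff_distrib mult_single flip: mult.assoc)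
    ultimately show ?case by simp
  next
    case (add x y)
    from rel_add[OF this] show ?case
      by (simp add: Phi_add lext_add algebra_simps)
  qed
qed

lemma Phi_carrier:
  assumes "p \<in> carrier (free_algebra n)"
  shows "keys (Phi q p) \<subseteq> Lambda n"
proof -
  have "(\<Union>w\<in>keys p.
      keys (single (wdeg (letters w)) (sg (wsgn q (letters w)) :: 'f))) \<subseteq> Lambda n"
    using assms by (auto simp: keys_single intro!: wdeg_in_Lambda split: if_splits)
  then show ?thesis
    unfolding Phi_def using keys_lext by blast
qed

lemma Phi_surj:
  assumes "keys y \<subseteq> Lambda n"
  shows "\<exists>p \<in> carrier (free_algebra n). Phi q p = y"
  using assms
proof (induction rule: poly_mapping_additive_induct)
  case zero
  show ?case by (rule bexI[of _ 0]) auto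
next
  case (single a c)
  show ?case
    using single nword_gens[of 0 a] wmon_carrier[of "nword 0 a"]
    by (intro bexI[of _ "single 0 c * wmon (nword 0 a)"])
      (auto simp: wsgn_nword wdeg_nword_Lambda mult_single)
next
  case (add x y)
  then show ?case using free_algebra_closed(1) Phi_add by metis
qed

text \<open>One inclusion is the reduction to ordered words; the other holds because the kernel is
  an ideal containing the relators.\<close>

lemma Phi_eq_0_iff:
  assumes "p \<in> carrier (free_algebra n)"
  shows "Phi q p = 0 \<longleftrightarrow> p \<in> relation_ideal q"
proof
  assume "Phi q p = 0"
  then show "p \<in> relation_ideal q"
    using rel_normal_form[OF assms] by simp
next
  let ?K = "{p \<in> carrier (free_algebra n). Phi q p = 0}"
  have "ideal ?K (free_algebra n)"
  proof (rule idealI)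
    show "ring (free_algebra n :: 'f free_alg ring)" by (rule ring_free_algebra)
    show "subgroup ?K (add_monoid (free_algebra n))"
    proof (rule group.subgroupI)
      show "group (add_monoid (free_algebra n :: 'f free_alg ring))" by (rule FA.a_group)
      show "?K \<subseteq> carrier (add_monoid (free_algebra n))" by auto
      have "0 \<in> ?K" by auto
      then show "?K \<noteq> {}" by blast
      fix a assume a: "a \<in> ?K"
      have "\<ominus>\<^bsub>free_algebra n\<^esub> a = - a"
        using a free_algebra_closed(4)[of a n a] by (intro FA.minus_equality) auto
      then show "inv\<^bsub>add_monoid (free_algebra n)\<^esub> a \<in> ?K"
        using a free_algebra_closed(4)[of a n a] Phi_diff[of q 0 a]
        by (simp add: a_inv_def del: free_algebra_simps(1))
      fix b assume "b \<in> ?K"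
      then show "a \<otimes>\<^bsub>add_monoid (free_algebra n)\<^esub> b \<in> ?K"
        using a free_algebra_closed(1)[of a n b] by (simp add: Phi_add del: free_algebra_simps(1))
    qed
  next
    fix a x :: "'f free_alg"
    assume "a \<in> ?K" "x \<in> carrier (free_algebra n)"
    then show "x \<otimes>\<^bsub>free_algebra n\<^esub> a \<in> ?K" "a \<otimes>\<^bsub>free_algebra n\<^esub> x \<in> ?K"
      using free_algebra_closed(2)[of x n a] free_algebra_closed(2)[of a n x]
      by (simp_all add: Phi_mult del: free_algebra_simps(1))
  qed
  moreover have "relators q \<subseteq> ?K"
    using relators_carrier[of q] Phi_relators[OF elementary] unfolding dim by blast
  ultimately have "relation_ideal q \<subseteq> ?K"
    unfolding relation_ideal_def dim by (rule FA.genideal_minimal)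
  then show "p \<in> relation_ideal q \<Longrightarrow> Phi q p = 0" by blast
qed

end

section \<open>The quantum torus as a twisted group algebra\<close>

lemma algebra_iso_comp:
  assumes "f \<in> algebra_iso A B" "g \<in> algebra_iso B C"
  shows "g \<circ> f \<in> algebra_iso A C"
  using assms ring_iso_set_trans[of f A B g C]
  by (auto simp: algebra_iso_def ring_iso_def Ring.ring_hom_def Pi_iff)

lemma algebra_iso_inv:
  assumes "f \<in> algebra_iso A B" "ring A" "\<And>c x. x \<in> carrier A \<Longrightarrow> c \<odot>\<^bsub>A\<^esub> x \<in> carrier A"
  shows "inv_into (carrier A) f \<in> algebra_iso B A"
proof -
  have f: "bij_betw f (carrier A) (carrier B)"
    using assms by (auto simp: algebra_iso_def ring_iso_def)
  have "inv_into (carrier A) f (c \<odot>\<^bsub>B\<^esub> y) = c \<odot>\<^bsub>A\<^esub> inv_into (carrier A) f y" if y: "y \<in> carrier B" for c y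
  proof -
    let ?x = "inv_into (carrier A) f y"
    have x: "?x \<in> carrier A" "f ?x = y"
      using f y by (auto simp: bij_betw_def inv_into_into f_inv_into_f)
    have "c \<odot>\<^bsub>B\<^esub> y = f (c \<odot>\<^bsub>A\<^esub> ?x)"
      using assms(1) x by (simp add: algebra_iso_def)
    then show ?thesis
      using assms(3) x f by (simp add: bij_betw_def)
  qed
  then show ?thesis
    using ring_iso_set_sym[OF assms(2)] assms(1) by (auto simp: algebra_iso_def)
qed

text \<open>The part of the algebra axioms that is needed to transport structures along
  isomorphisms.\<close>

definition closed_algebra :: "('f, 'a) module \<Rightarrow> bool" where
  "closed_algebra A \<longleftrightarrow> ring A \<and> (\<forall>c. \<forall>x\<in>carrier A. c \<odot>\<^bsub>A\<^esub> x \<in> carrier A)"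

lemma algebra_isoD:
  assumes "f \<in> algebra_iso A B"
  shows "bij_betw f (carrier A) (carrier B)"
    "x \<in> carrier A \<Longrightarrow> f x \<in> carrier B"
    "x \<in> carrier A \<Longrightarrow> y \<in> carrier A \<Longrightarrow> f x = f y \<Longrightarrow> x = y"
    "x \<in> carrier A \<Longrightarrow> y \<in> carrier A \<Longrightarrow> f (x \<otimes>\<^bsub>A\<^esub> y) = f x \<otimes>\<^bsub>B\<^esub> f y"
    "x \<in> carrier A \<Longrightarrow> y \<in> carrier A \<Longrightarrow> f (x \<oplus>\<^bsub>A\<^esub> y) = f x \<oplus>\<^bsub>B\<^esub> f y"
    "f \<one>\<^bsub>A\<^esub> = \<one>\<^bsub>B\<^esub>"
    "x \<in> carrier A \<Longrightarrow> f (c \<odot>\<^bsub>A\<^esub> x) = c \<odot>\<^bsub>B\<^esub> f x"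
proof -
  show b: "bij_betw f (carrier A) (carrier B)"
    using assms by (simp add: algebra_iso_def ring_iso_def)
  show "x \<in> carrier A \<Longrightarrow> y \<in> carrier A \<Longrightarrow> f x = f y \<Longrightarrow> x = y"
    using b by (auto simp: bij_betw_def inj_on_def)
qed (use assms in \<open>auto simp: algebra_iso_def ring_iso_def Ring.ring_hom_def\<close>)

lemma anti_automorphismD:
  assumes "anti_automorphism A \<tau>"
  shows "bij_betw \<tau> (carrier A) (carrier A)"
    "x \<in> carrier A \<Longrightarrow> \<tau> x \<in> carrier A"
    "x \<in> carrier A \<Longrightarrow> y \<in> carrier A \<Longrightarrow> \<tau> (x \<oplus>\<^bsub>A\<^esub> y) = \<tau> x \<oplus>\<^bsub>A\<^esub> \<tau> y"
    "x \<in> carrier A \<Longrightarrow> \<tau> (c \<odot>\<^bsub>A\<^esub> x) = c \<odot>\<^bsub>A\<^esub> \<tau> x"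
    "x \<in> carrier A \<Longrightarrow> y \<in> carrier A \<Longrightarrow> \<tau> (x \<otimes>\<^bsub>A\<^esub> y) = \<tau> y \<otimes>\<^bsub>A\<^esub> \<tau> x"
    "\<tau> \<one>\<^bsub>A\<^esub> = \<one>\<^bsub>A\<^esub>"
  using assms by (auto simp: anti_automorphism_def bij_betw_def)

lemma involution_cong:
  assumes "closed_algebra A" "involution A \<tau>" "\<And>x. x \<in> carrier A \<Longrightarrow> \<tau> x = \<tau>' x"
  shows "involution A \<tau>'"
proof -
  interpret ring A using assms(1) by (simp add: closed_algebra_def)
  have "\<tau>' x \<in> carrier A" if "x \<in> carrier A" for x
    using assms(2,3) that anti_automorphismD(2)[of A \<tau> x] by (simp add: involution_def)
  then show ?thesis
    using assms bij_betw_cong[of "carrier A" \<tau> \<tau>' "carrier A"]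
    by (auto simp: involution_def anti_automorphism_def closed_algebra_def bij_betw_def)
qed

lemma involution_transport:
  assumes f: "f \<in> algebra_iso A B" and g: "g \<in> algebra_iso B A"
    and gf: "\<And>x. x \<in> carrier A \<Longrightarrow> g (f x) = x" and fg: "\<And>y. y \<in> carrier B \<Longrightarrow> f (g y) = y"
    and \<tau>: "involution A \<tau>"
  shows "involution B (\<lambda>y. f (\<tau> (g y)))"
proof -
  have a: "anti_automorphism A \<tau>"
    using \<tau> by (simp add: involution_def)
  note [simp] = algebra_isoD(2,4-)[OF f] algebra_isoD(2,4-)[OF g] anti_automorphismD(2-)[OF a] gf fg
  have "bij_betw (f \<circ> (\<tau> \<circ> g)) (carrier B) (carrier B)"
    by (intro bij_betw_trans[OF bij_betw_trans[OF algebra_isoD(1)[OF g] anti_automorphismD(1)[OF a]]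
          algebra_isoD(1)[OF f]])
  then show ?thesis
    using \<tau> by (simp add: involution_def anti_automorphism_def o_def)
qed

definition torus_model :: "'f::field mat \<Rightarrow> ('f, (nat \<Rightarrow>\<^sub>0 int) \<Rightarrow>\<^sub>0 'f) module" where
  "torus_model q = \<lparr>carrier = {y. keys y \<subseteq> Lambda (dim_row q)},
     monoid.mult = tmul (bform q), monoid.one = 1, ring.zero = 0, ring.add = (+),
     module.smult = (\<lambda>c y. single 0 c * y)\<rparr>"

lemma torus_model_simps [simp]:
  "y \<in> carrier (torus_model q) \<longleftrightarrow> keys y \<subseteq> Lambda (dim_row q)"
  "x \<otimes>\<^bsub>torus_model q\<^esub> y = tmul (bform q) x y" "\<one>\<^bsub>torus_model q\<^esub> = 1"
  "\<zero>\<^bsub>torus_model q\<^esub> = 0" "x \<oplus>\<^bsub>torus_model q\<^esub> y = x + y" "c \<odot>\<^bsub>torus_model q\<^esub> y = single 0 c * y"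
  by (simp_all add: torus_model_def)

text \<open>The isomorphism induced by the homomorphism above on cosets: it takes the single value
  attained on the coset.\<close>

definition Theta :: "'f::field mat \<Rightarrow> 'f free_alg set \<Rightarrow> (nat \<Rightarrow>\<^sub>0 int) \<Rightarrow>\<^sub>0 'f" where
  "Theta q X = the_elem (Phi q ` X)"

context elementary_torus
begin

lemma Phi_ring_hom: "Phi q \<in> Ring.ring_hom (free_algebra n) (torus_model q)"
proof (rule ring_hom_memI)
  show "Phi q \<one>\<^bsub>free_algebra n\<^esub> = \<one>\<^bsub>torus_model q\<^esub>"
    by (simp flip: single_one) (simp add: zero_word_monoid_def)
qed (use Phi_carrier in \<open>auto simp: Phi_mult Phi_add\<close>)

lemma Phi_image: "Phi q ` carrier (free_algebra n) = carrier (torus_model q)"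
proof
  show "Phi q ` carrier (free_algebra n) \<subseteq> carrier (torus_model q)"
    using Phi_carrier by (simp add: image_subset_iff)
  show "carrier (torus_model q) \<subseteq> Phi q ` carrier (free_algebra n)"
    using Phi_surj by (fastforce simp: image_iff simp del: free_algebra_simps(1))
qed

sublocale model: ring "torus_model q"
proof -
  have "torus_model q \<lparr>carrier := Phi q ` carrier (free_algebra n), zero := Phi q \<zero>\<^bsub>free_algebra n\<^esub>\<rparr>
      = torus_model q"
    unfolding Phi_image by (simp add: torus_model_def)
  then show "ring (torus_model q)"
    using FA.ring_hom_imp_img_ring[OF Phi_ring_hom] by simp
qed

sublocale Phi: ring_hom_ring "free_algebra n" "torus_model q" "Phi q"
  by (rule ring_hom_ringI2) (rule ring_free_algebra, rule model.ring_axioms, rule Phi_ring_hom)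

lemma kernel_Phi: "a_kernel (free_algebra n) (torus_model q) (Phi q) = relation_ideal q"
proof -
  have "relation_ideal q \<subseteq> carrier (free_algebra n)"
    by (rule rel.a_subset)
  then show ?thesis
    using Phi_eq_0_iff unfolding a_kernel_def' by (auto simp del: free_algebra_simps(1))
qed

lemma Theta_class: "p \<in> carrier (free_algebra n) \<Longrightarrow> Theta q (qt_class q p) = Phi q p"
  using Phi.the_elem_simp[of p] by (simp add: Theta_def qt_class_def kernel_Phi del: free_algebra_simps(1))

lemma carrier_quantum_torus: "carrier (quantum_torus q) = carrier (free_algebra n Quot relation_ideal q)"
  by (simp add: quantum_torus_def Let_def)

lemma qt_class_carrier: "p \<in> carrier (free_algebra n) \<Longrightarrow> qt_class q p \<in> carrier (quantum_torus q)"
  unfolding carrier_quantum_torus FactRing_def A_RCOSETS_def' qt_class_def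
  by (auto simp del: free_algebra_simps(1))

lemma Theta_ring_iso: "Theta q \<in> ring_iso (free_algebra n Quot relation_ideal q) (torus_model q)"
proof -
  have "Theta q = (\<lambda>X. the_elem (Phi q ` X))"
    by (simp add: fun_eq_iff Theta_def)
  then show ?thesis
    using Phi.FactRing_iso_set[OF Phi_image] by (simp add: kernel_Phi)
qed

sublocale Quot: ring "free_algebra n Quot relation_ideal q :: 'f free_alg set ring"
  by (rule rel.quotient_is_ring)

lemma closed_algebra_quantum_torus: "closed_algebra (quantum_torus q)"
proof -
  let ?Q = "free_algebra n Quot relation_ideal q :: 'f free_alg set ring"
  have "id \<in> Ring.ring_hom ?Q (quantum_torus q)"
    by (rule ring_hom_memI) (simp_all add: quantum_torus_def Let_def)
  from Quot.ring_hom_imp_img_ring[OF this] have "ring (quantum_torus q)"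
    by (simp add: quantum_torus_def Let_def)
  moreover have "c \<odot>\<^bsub>quantum_torus q\<^esub> x \<in> carrier (quantum_torus q)" if "x \<in> carrier (quantum_torus q)" for c x
    using that qt_class_carrier[OF const_carrier, of c] Quot.m_closed
    by (simp add: quantum_torus_def Let_def const_def)
  ultimately show ?thesis by (simp add: closed_algebra_def)
qed

sublocale QT: ring "quantum_torus q"
  using closed_algebra_quantum_torus by (simp add: closed_algebra_def)

lemma tmul_const: "tmul (bform q) (single 0 c) y = single 0 c * y"
proof -
  have "tmul (bform q) (single 0 c) y = single 0 c * tmul (bform q) 1 y"
    using tmul_scale(1)[of "bform q" c 1 y] by simp
  also have "tmul (bform q) 1 y = y"
    using subset_UNIV[of "keys y"]
  proof (induction rule: poly_mapping_additive_induct)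
    case (single a c)
    then show ?case by (simp flip: single_one)
  qed (simp_all add: tmul_add)
  finally show ?thesis .
qed

lemma Theta_iso: "Theta q \<in> algebra_iso (quantum_torus q) (torus_model q)"
proof -
  let ?Q = "free_algebra n Quot relation_ideal q :: 'f free_alg set ring"
  have hom: "Theta q \<in> Ring.ring_hom ?Q (torus_model q)"
    and bij: "bij_betw (Theta q) (carrier ?Q) (carrier (torus_model q))"
    using Theta_ring_iso by (auto simp: ring_iso_def)
  have "Theta q \<in> Ring.ring_hom (quantum_torus q) (torus_model q)"
    using hom by (simp add: quantum_torus_def Let_def Ring.ring_hom_def)
  moreover have "Theta q (c \<odot>\<^bsub>quantum_torus q\<^esub> x) = c \<odot>\<^bsub>torus_model q\<^esub> Theta q x"
    if x: "x \<in> carrier (quantum_torus q)" for c x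
  proof -
    have "Theta q (qt_class q (const c)) = single 0 c"
      using Theta_class[OF const_carrier, of c] by (simp add: const_def) (simp add: zero_word_monoid_def)
    then show ?thesis
      using Ring.ring_hom_mult[OF hom qt_class_carrier[OF const_carrier, of c, unfolded carrier_quantum_torus],
          of x] x
      by (simp add: quantum_torus_def Let_def const_def tmul_const)
  qed
  ultimately show ?thesis
    using bij by (simp add: algebra_iso_def ring_iso_def carrier_quantum_torus)
qed

definition Theta_inv :: "((nat \<Rightarrow>\<^sub>0 int) \<Rightarrow>\<^sub>0 'f) \<Rightarrow> 'f free_alg set" where
  "Theta_inv = inv_into (carrier (quantum_torus q)) (Theta q)"

lemma Theta_inv_iso: "Theta_inv \<in> algebra_iso (torus_model q) (quantum_torus q)"
  unfolding Theta_inv_def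
  by (rule algebra_iso_inv[OF Theta_iso])
    (use closed_algebra_quantum_torus in \<open>auto simp: closed_algebra_def\<close>)

lemma Theta_inverse:
  "x \<in> carrier (quantum_torus q) \<Longrightarrow> Theta_inv (Theta q x) = x"
  "y \<in> carrier (torus_model q) \<Longrightarrow> Theta q (Theta_inv y) = y"
  using algebra_isoD(1)[OF Theta_iso]
  by (simp_all add: Theta_inv_def bij_betw_inv_into_left bij_betw_inv_into_right del: torus_model_simps(1))

lemma qt_gen_carrier: "i < n \<Longrightarrow> qt_gen q i \<in> carrier (quantum_torus q)"
  unfolding qt_gen_def letter_def by (intro qt_class_carrier) (simp add: in_gens_iff)

lemma Theta_gen: "i < n \<Longrightarrow> Theta q (qt_gen q i) = single (frag_of i) 1"
  unfolding qt_gen_def letter_def by (subst Theta_class) (simp_all add: in_gens_iff)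

lemma bform_triangular:
  assumes "\<And>i. i < m \<Longrightarrow> lookup \<beta> i = 0" "m < n"
  shows "bform q (frag_cmul k (frag_of m)) \<beta> = 0"
proof -
  have "bform q (frag_cmul k (frag_of m)) \<beta> = k * bform q (frag_of m) \<beta>"
    by (simp add: bform_def sum_distrib_left mult_ac)
  then show ?thesis using assms by (simp add: bform_frag_of_left)
qed

text \<open>The powers in \<^const>\<open>qt_monomial\<close> use the inverse in the monoid of the
  quantum torus; injectivity of the isomorphism identifies it with the preimage of the monomial of
  opposite degree.\<close>

lemma Theta_gen_pow:
  assumes i: "i < n"
  shows "qt_gen q i [^]\<^bsub>quantum_torus q\<^esub> (k::int) \<in> carrier (quantum_torus q)"
    and "Theta q (qt_gen q i [^]\<^bsub>quantum_torus q\<^esub> (k::int)) = single (frag_cmul k (frag_of i)) 1"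
proof -
  note iso = algebra_isoD[OF Theta_iso] and inv = algebra_isoD(2)[OF Theta_inv_iso]
  have diag: "bform q (frag_cmul j (frag_of i)) (frag_cmul k (frag_of i)) = 0" for j k
    using i by (intro bform_triangular) auto
  have pow: "Theta q (qt_gen q i [^]\<^bsub>quantum_torus q\<^esub> (m::nat)) = single (frag_cmul (int m) (frag_of i)) 1"
    for m
  proof (induction m)
    case 0
    then show ?case using iso(6) by simp
  next
    case (Suc m)
    then show ?case
      using i iso(4)[of "qt_gen q i [^]\<^bsub>quantum_torus q\<^esub> m" "qt_gen q i"] diag[of "int m" 1]
      by (simp add: qt_gen_carrier Theta_gen frag_cmul_distrib add.commute)
  qed
  have "qt_gen q i [^]\<^bsub>quantum_torus q\<^esub> k \<in> carrier (quantum_torus q) \<and>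
      Theta q (qt_gen q i [^]\<^bsub>quantum_torus q\<^esub> k) = single (frag_cmul k (frag_of i)) 1"
  proof (cases "k < 0")
    case True
    let ?x = "qt_gen q i [^]\<^bsub>quantum_torus q\<^esub> nat (- k)"
    let ?s = "single (frag_cmul k (frag_of i)) (1::'f)"
    let ?y = "Theta_inv ?s"
    have s: "?s \<in> carrier (torus_model q)" using i by auto
    have "?x \<in> carrier (quantum_torus q)"
      by (intro QT.nat_pow_closed qt_gen_carrier[OF i])
    moreover have "Theta q ?x = single (frag_cmul (- k) (frag_of i)) 1"
      using pow[of "nat (- k)"] True by simp
    ultimately have x: "?x \<in> carrier (quantum_torus q)"
      "Theta q ?x = single (frag_cmul (- k) (frag_of i)) 1"
      by blast+
    have y: "?y \<in> carrier (quantum_torus q)" "Theta q ?y = ?s"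
      using inv s Theta_inverse(2) by blast+
    have "Theta q (?x \<otimes>\<^bsub>quantum_torus q\<^esub> ?y) = Theta q \<one>\<^bsub>quantum_torus q\<^esub>"
      "Theta q (?y \<otimes>\<^bsub>quantum_torus q\<^esub> ?x) = Theta q \<one>\<^bsub>quantum_torus q\<^esub>"
      using x y diag by (simp_all add: iso(4,6) flip: frag_cmul_distrib)
    then have "inv\<^bsub>quantum_torus q\<^esub> ?x = ?y"
      using x y iso(3) by (intro QT.inv_char) auto
    then have "qt_gen q i [^]\<^bsub>quantum_torus q\<^esub> k = ?y"
      by (simp only: int_pow_def2 True if_True)
    then show ?thesis using y by simp
  next
    case False
    then have "qt_gen q i [^]\<^bsub>quantum_torus q\<^esub> k = qt_gen q i [^]\<^bsub>quantum_torus q\<^esub> nat k"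
      by (simp only: int_pow_def2 if_False)
    moreover have "qt_gen q i [^]\<^bsub>quantum_torus q\<^esub> nat k \<in> carrier (quantum_torus q)"
      by (intro QT.nat_pow_closed qt_gen_carrier[OF i])
    moreover have "Theta q (qt_gen q i [^]\<^bsub>quantum_torus q\<^esub> nat k) = single (frag_cmul k (frag_of i)) 1"
      using pow[of "nat k"] False by simp
    ultimately show ?thesis by metis
  qed
  then show "qt_gen q i [^]\<^bsub>quantum_torus q\<^esub> (k::int) \<in> carrier (quantum_torus q)"
    and "Theta q (qt_gen q i [^]\<^bsub>quantum_torus q\<^esub> (k::int)) = single (frag_cmul k (frag_of i)) 1"
    by auto
qed

lemma Theta_monomial:
  "qt_monomial q \<alpha> \<in> carrier (quantum_torus q)"
  "Theta q (qt_monomial q \<alpha>) = single (int_comb n frag_of \<alpha>) 1"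
proof -
  let ?f = "\<lambda>m. foldr (\<lambda>i x. (qt_gen q i [^]\<^bsub>quantum_torus q\<^esub> \<alpha> i) \<otimes>\<^bsub>quantum_torus q\<^esub> x)
       [m..<n] \<one>\<^bsub>quantum_torus q\<^esub>"
  have "?f m \<in> carrier (quantum_torus q) \<and>
      Theta q (?f m) = single (\<Sum>i=m..<n. frag_cmul (\<alpha> i) (frag_of i)) 1" if "m \<le> n" for m
    using that
  proof (induction m rule: inc_induct)
    case base
    then show ?case using algebra_isoD(6)[OF Theta_iso] by simp
  next
    case (step m)
    have "bform q (frag_cmul (\<alpha> m) (frag_of m)) (\<Sum>i=Suc m..<n. frag_cmul (\<alpha> i) (frag_of i)) = 0"
      using step by (intro bform_triangular) (auto simp: lookup_sum)
    then show ?case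
      using step Theta_gen_pow[of m "\<alpha> m"] algebra_isoD(4)[OF Theta_iso]
      by (simp add: upt_conv_Cons sum.atLeast_Suc_lessThan)
  qed
  from this[of 0] show "qt_monomial q \<alpha> \<in> carrier (quantum_torus q)"
    "Theta q (qt_monomial q \<alpha>) = single (int_comb n frag_of \<alpha>) 1"
    by (simp_all add: qt_monomial_def int_comb_def atLeast0LessThan)
qed

end

section \<open>Involutions and quadratic forms\<close>

text \<open>The exponent of the sign by which the involution of type $(a_1,\dots,a_n)$ multiplies
  $t^d$: reversing the order of the factors of $t^d$ costs $(-1)^{b(d,d)}$.\<close>

definition qform :: "'f::field mat \<Rightarrow> (nat \<Rightarrow> 'f) \<Rightarrow> (nat \<Rightarrow>\<^sub>0 int) \<Rightarrow> int" where
  "qform q a d = (\<Sum>i<dim_row q. (if a i = 1 then 0 else 1) * lookup d i) + bform q d d"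

lemma qform_add: "qform q a (d + d') = qform q a d + qform q a d' + bform q d d' + bform q d' d"
  by (simp add: qform_def lookup_add bform_add algebra_simps sum.distrib)

lemma qform_frag_of:
  assumes "i < dim_row q"
  shows "qform q a (frag_of i) = (if a i = 1 then 0 else 1)"
proof -
  have "(\<Sum>j<dim_row q. (if a j = 1 then 0 else 1) * lookup (frag_of i) j)
      = (\<Sum>j<dim_row q. if j = i then (if a i = 1 then 0 else 1 :: int) else 0)"
    by (rule sum.cong) auto
  then show ?thesis
    using assms by (simp add: qform_def bform_frag_of)
qed

definition diag :: "('a \<Rightarrow> int) \<Rightarrow> ('a::monoid_add \<Rightarrow>\<^sub>0 'f::comm_ring_1) \<Rightarrow> 'a \<Rightarrow>\<^sub>0 'f" where
  "diag k = lext (\<lambda>d. single d (sg (k d)))"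

lemma diag_simps [simp]:
  "diag k 0 = 0" "diag k (x + y) = diag k x + diag k y"
  "diag k (single 0 c * x) = single 0 c * diag k x"
  "diag k (single d c) = single d (c * sg (k d))"
  by (simp_all add: diag_def lext_add lext_scale mult_single)

lemma diag_diag [simp]: "diag k (diag k y) = y"
  using subset_UNIV[of "keys y"]
  by (induction rule: poly_mapping_additive_induct) (simp_all add: mult.assoc)

lemma keys_diag: "keys (diag k y) \<subseteq> keys y"
  unfolding diag_def by (rule order_trans[OF keys_lext]) (auto simp: keys_single split: if_splits)

text \<open>Anti-multiplicativity is the identity $Q(\alpha+\beta) = Q(\alpha) + Q(\beta) +
  b(\alpha,\beta) + b(\beta,\alpha)$.\<close>

lemma diag_tmul:
  "diag (qform q a) (tmul (bform q) x y) = tmul (bform q) (diag (qform q a) y) (diag (qform q a) x)"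
  using subset_UNIV[of "keys x"]
proof (induction rule: poly_mapping_additive_induct)
  case (single \<alpha> c)
  show ?case
    using subset_UNIV[of "keys y"]
  proof (induction rule: poly_mapping_additive_induct)
    case (single \<beta> c')
    have "sg (bform q \<alpha> \<beta>) * sg (qform q a (\<alpha> + \<beta>))
        = (sg (qform q a \<alpha>) * sg (qform q a \<beta>) * sg (bform q \<beta> \<alpha>) :: 'a)"
      unfolding sg_add[symmetric] by (rule sg_cong) (auto simp: qform_add)
    then show ?case
      by (simp add: mult_ac add.commute)
  qed (simp_all add: tmul_add)
qed (simp_all add: tmul_add)

lemma diag_involution: "involution (torus_model q) (diag (qform q a))"
proof -
  have "bij_betw (diag (qform q a)) (carrier (torus_model q)) (carrier (torus_model q))"
    by (rule bij_betw_byWitness[where f' = "diag (qform q a)"]) (use keys_diag in force)+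
  moreover have "diag (qform q a) 1 = 1"
    unfolding single_one[symmetric] diag_simps by (simp add: qform_def)
  ultimately show ?thesis
    by (simp add: involution_def anti_automorphism_def diag_tmul)
qed

text \<open>Left multiplication by a monomial is a signed shift of the coefficients. This is how
  equations are divided by monomials.\<close>

lemma lookup_tmul_shift:
  fixes \<alpha> :: "nat \<Rightarrow>\<^sub>0 int"
  shows "lookup (tmul b (single \<alpha> s) y) (\<alpha> + \<gamma>)
    = s * sg (b \<alpha> \<gamma>) * lookup y \<gamma>"
  using subset_UNIV[of "keys y"]
  by (induction rule: poly_mapping_additive_induct)
    (auto simp: lookup_single when_def tmul_add lookup_add algebra_simps)

lemma int_comb_diff: "int_comb n \<sigma> (\<lambda>i. \<alpha> i - \<beta> i) = int_comb n \<sigma> \<alpha> - int_comb n \<sigma> \<beta>"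
  by (simp add: int_comb_def frag_cmul_diff_distrib sum_subtractf)

lemma int_comb_delta: "i < n \<Longrightarrow> int_comb n \<sigma> (\<lambda>j. if j = i then 1 else 0) = \<sigma> i"
proof -
  assume "i < n"
  have "int_comb n \<sigma> (\<lambda>j. if j = i then 1 else 0) = (\<Sum>j<n. if j = i then \<sigma> i else 0)"
    unfolding int_comb_def by (rule sum.cong) auto
  then show ?thesis using \<open>i < n\<close> by simp
qed

lemma int_comb_cong: "(\<And>i. i < n \<Longrightarrow> \<alpha> i = \<beta> i) \<Longrightarrow> int_comb n \<sigma> \<alpha> = int_comb n \<sigma> \<beta>"
  by (simp add: int_comb_def)

lemma Lambda_sum: "(\<And>i. i \<in> A \<Longrightarrow> f i \<in> Lambda n) \<Longrightarrow> sum f A \<in> Lambda n"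
  by (induction A rule: infinite_finite_induct) auto

lemma int_comb_Lambda: "(\<And>i. i < n \<Longrightarrow> \<sigma> i \<in> Lambda n) \<Longrightarrow> int_comb n \<sigma> \<alpha> \<in> Lambda n"
  unfolding int_comb_def by (intro Lambda_sum Lambda_closed) auto

lemma Lambda_basis_unique:
  assumes "Lambda_basis n \<sigma>" "int_comb n \<sigma> \<alpha> = int_comb n \<sigma> \<beta>" "i < n"
  shows "\<alpha> i = \<beta> i"
proof -
  have "int_comb n \<sigma> (\<lambda>i. \<alpha> i - \<beta> i) = 0"
    using assms(2) by (simp add: int_comb_diff)
  then have "\<alpha> i - \<beta> i = 0"
    using assms(1,3) unfolding Lambda_basis_def by blast
  then show ?thesis by simp
qed

text \<open>Membership in the carrier is included since an arbitrary function on sets of words may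
  leave the quantum torus. All values of the type are signs, which keeps index bounds out of the
  statements about types.\<close>

definition has_type :: "'f::field mat \<Rightarrow> (nat \<Rightarrow> 'f) \<Rightarrow> ('f free_alg set \<Rightarrow> 'f free_alg set) \<Rightarrow> bool" where
  "has_type q a \<tau> \<longleftrightarrow> (\<forall>i. a i \<in> {1, -1}) \<and>
     (\<forall>x\<in>carrier (quantum_torus q). \<tau> x \<in> carrier (quantum_torus q) \<and> Theta q (\<tau> x) = diag (qform q a) (Theta q x))"

context elementary_torus
begin

text \<open>The degrees at which the claim holds contain those of the generators and are closed
  under differences, because $t^{\alpha-\beta}t^\beta$ is a multiple of $t^\alpha$.\<close>

lemma anti_automorphism_single:
  assumes T: "anti_automorphism (torus_model q) T"
    and gen: "\<And>i. i < n \<Longrightarrow> T (single (frag_of i) 1)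
      = single (frag_of i) (sg (qform q a (frag_of i)))"
    and "d \<in> Lambda n"
  shows "T (single d 1) = single d (sg (qform q a d))"
proof -
  note T = anti_automorphismD[OF T, simplified]
  have "keys d \<subseteq> {..<n}"
    using assms(3) by (simp add: Lambda_iff)
  then have "d \<in> Lambda n \<and> T (single d 1) = single d (sg (qform q a d))"
  proof (induction rule: frag_induction)
    case zero
    then show ?case using T(6) by (simp add: qform_def)
  next
    case (one i)
    then show ?case using gen by auto
  next
    case (diff \<alpha> \<beta>)
    let ?x = "single (\<alpha> - \<beta>) (1::'f)"
    let ?t = "sg (bform q (\<alpha> - \<beta>) \<beta>) :: 'f"
    have L: "\<alpha> - \<beta> \<in> Lambda n" using diff by auto
    have "tmul (bform q) ?x (single \<beta> 1) = single 0 ?t * single \<alpha> 1"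
      by (simp add: mult_single)
    then have "T (tmul (bform q) ?x (single \<beta> 1))
        = single 0 ?t * T (single \<alpha> 1)"
      using T(4)[of "single \<alpha> 1" ?t] diff by simp
    moreover have "T (tmul (bform q) ?x (single \<beta> 1))
        = tmul (bform q) (T (single \<beta> 1)) (T ?x)"
      using T(5)[of ?x "single \<beta> 1"] diff L by simp
    ultimately have *: "tmul (bform q) (single \<beta> (sg (qform q a \<beta>))) (T ?x)
        = single \<alpha> (?t * sg (qform q a \<alpha>))"
      using diff by (simp add: mult_single)
    have "lookup (T ?x) \<gamma> = lookup (single (\<alpha> - \<beta>) (sg (qform q a (\<alpha> - \<beta>)))) \<gamma>" for \<gamma>
    proof -
      have "sg (qform q a \<beta>) * sg (bform q \<beta> \<gamma>) * lookup (T ?x) \<gamma>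
          = (?t * sg (qform q a \<alpha>) when \<alpha> = \<beta> + \<gamma>)"
        using lookup_tmul_shift[of "bform q" \<beta> "sg (qform q a \<beta>)" "T ?x" \<gamma>] *
        by (simp add: lookup_single)
      then have "sg (qform q a \<beta> + bform q \<beta> \<gamma>) * (sg (qform q a \<beta> + bform q \<beta> \<gamma>) * lookup (T ?x) \<gamma>)
          = sg (qform q a \<beta> + bform q \<beta> \<gamma>) * (?t * sg (qform q a \<alpha>) when \<alpha> = \<beta> + \<gamma>)"
        by (simp add: sg_add)
      then have "lookup (T ?x) \<gamma>
          = sg (qform q a \<beta> + bform q \<beta> \<gamma>) * (?t * sg (qform q a \<alpha>) when \<alpha> = \<beta> + \<gamma>)"
        by (simp flip: mult.assoc)
      also have "\<dots> = (sg (qform q a (\<alpha> - \<beta>)) when \<alpha> - \<beta> = \<gamma>)"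
      proof (cases "\<alpha> - \<beta> = \<gamma>")
        case True
        then have \<alpha>: "\<alpha> = \<beta> + \<gamma>" by auto
        have "sg (qform q a \<beta> + bform q \<beta> \<gamma> + (bform q (\<alpha> - \<beta>) \<beta> + qform q a \<alpha>)) = (sg (qform q a \<gamma>) :: 'f)"
          unfolding \<alpha> by (rule sg_cong) (simp add: qform_add)
        then show ?thesis
          by (simp add: \<alpha> sg_add)
      next
        case False
        then have "\<alpha> \<noteq> \<beta> + \<gamma>" by auto
        with False show ?thesis by simp
      qed
      finally show ?thesis by (simp add: lookup_single)
    qed
    then show ?case using L by (auto intro: poly_mapping_eqI)
  qed
  then show ?thesis by blast
qed

lemma anti_automorphism_eq_diag:
  assumes T: "anti_automorphism (torus_model q) T"
    and gen: "\<And>i. i < n \<Longrightarrow> T (single (frag_of i) 1)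
      = single (frag_of i) (sg (qform q a (frag_of i)))"
    and y: "keys y \<subseteq> Lambda n"
  shows "T y = diag (qform q a) y"
proof -
  note T' = anti_automorphismD[OF T, simplified]
  from y have "keys y \<subseteq> Lambda n \<and> T y = diag (qform q a) y"
  proof (induction rule: poly_mapping_additive_induct)
    case zero
    have "T 0 = 0" using T'(4)[of 0 0] by simp
    then show ?case by simp
  next
    case (single d c)
    have "T (single 0 c * single d 1) = single 0 c * T (single d 1)"
      using T'(4) single by simp
    then show ?case
      using anti_automorphism_single[OF T gen single] single by (simp add: mult_single)
  next
    case (add x y)
    then show ?case using T'(3)[of x y] Poly_Mapping.keys_add[of x y] by auto
  qed
  then show ?thesis by blast
qed

lemma has_typeI:
  assumes \<tau>: "involution (quantum_torus q) \<tau>" and a: "\<And>i. a i \<in> {1, -1}"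
    and gen: "\<And>i. i < n \<Longrightarrow> \<tau> (qt_gen q i) = a i \<odot>\<^bsub>quantum_torus q\<^esub> qt_gen q i"
  shows "has_type q a \<tau>"
proof -
  let ?T = "\<lambda>y. Theta q (\<tau> (Theta_inv y))"
  have "involution (torus_model q) ?T"
    by (rule involution_transport[OF Theta_iso Theta_inv_iso _ _ \<tau>]) (use Theta_inverse in auto)
  then have T: "anti_automorphism (torus_model q) ?T"
    by (simp add: involution_def)
  have "?T (single (frag_of i) 1) = single (frag_of i) (sg (qform q a (frag_of i)))"
    if "i < n" for i
  proof -
    have "Theta_inv (single (frag_of i) 1) = qt_gen q i"
      using Theta_inverse(1)[OF qt_gen_carrier[OF that]] Theta_gen[OF that] by simp
    moreover have "a i = sg (qform q a (frag_of i))"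
      using a[of i] that by (auto simp: qform_frag_of)
    ultimately show ?thesis
      using algebra_isoD(7)[OF Theta_iso qt_gen_carrier[OF that], of "a i"] gen[OF that] Theta_gen[OF that]
      by (simp add: mult_single)
  qed
  note * = anti_automorphism_eq_diag[OF T this]
  have "\<tau> x \<in> carrier (quantum_torus q) \<and> Theta q (\<tau> x) = diag (qform q a) (Theta q x)"
    if x: "x \<in> carrier (quantum_torus q)" for x
  proof -
    have "keys (Theta q x) \<subseteq> Lambda n"
      using algebra_isoD(2)[OF Theta_iso x] by simp
    from *[OF _ this] show ?thesis
      using Theta_inverse(1)[OF x] x anti_automorphismD(2)[of "quantum_torus q" \<tau> x] \<tau>
      by (simp add: involution_def)
  qed
  then show ?thesis using a by (simp add: has_type_def)
qed

text \<open>Existence is transported from the model. Uniqueness, needed for the definite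
  description, holds because two involutions of the same type agree on the carrier and
  extensionality fixes them elsewhere.\<close>

lemma has_type_involution_of_type:
  assumes a: "\<And>i. a i \<in> {1, -1}"
  shows "has_type q a (involution_of_type q a)"
proof -
  let ?C = "carrier (quantum_torus q)"
  define \<tau> where "\<tau> = restrict (\<lambda>x. Theta_inv (diag (qform q a) (Theta q x))) ?C"
  have "involution (quantum_torus q) (\<lambda>x. Theta_inv (diag (qform q a) (Theta q x)))"
    by (rule involution_transport[OF Theta_inv_iso Theta_iso _ _ diag_involution]) (use Theta_inverse in auto)
  then have inv: "involution (quantum_torus q) \<tau>"
    by (rule involution_cong[OF closed_algebra_quantum_torus]) (simp add: \<tau>_def)
  have gen: "\<tau> (qt_gen q i) = a i \<odot>\<^bsub>quantum_torus q\<^esub> qt_gen q i" if i: "i < n" for i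
  proof -
    have "diag (qform q a) (Theta q (qt_gen q i)) = a i \<odot>\<^bsub>torus_model q\<^esub> Theta q (qt_gen q i)"
      using i a[of i] by (auto simp: Theta_gen qform_frag_of mult_single)
    also have "\<dots> = Theta q (a i \<odot>\<^bsub>quantum_torus q\<^esub> qt_gen q i)"
      using algebra_isoD(7)[OF Theta_iso qt_gen_carrier[OF i]] by simp
    finally show ?thesis
      using Theta_inverse(1) qt_gen_carrier[OF i] closed_algebra_quantum_torus
      by (simp add: \<tau>_def closed_algebra_def)
  qed
  have "involution_of_type q a = \<tau>"
    unfolding involution_of_type_def
  proof (rule the_equality)
    show "\<tau> \<in> extensional ?C \<and> involution (quantum_torus q) \<tau> \<and>
       (\<forall>i<dim_row q. \<tau> (qt_gen q i) = a i \<odot>\<^bsub>quantum_torus q\<^esub> qt_gen q i)"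
      using inv gen by (simp add: \<tau>_def)
  next
    fix \<rho>
    assume \<rho>: "\<rho> \<in> extensional ?C \<and> involution (quantum_torus q) \<rho> \<and>
       (\<forall>i<dim_row q. \<rho> (qt_gen q i) = a i \<odot>\<^bsub>quantum_torus q\<^esub> qt_gen q i)"
    have "has_type q a \<rho>" "has_type q a \<tau>"
      using \<rho> a inv gen by (auto intro!: has_typeI)
    then have "\<rho> x = \<tau> x" if "x \<in> ?C" for x
      using that algebra_isoD(3)[OF Theta_iso] by (simp add: has_type_def)
    then show "\<rho> = \<tau>"
      using \<rho> by (intro extensionalityI[of \<rho> ?C \<tau>]) (simp_all add: \<tau>_def)
  qed
  then show ?thesis
    using has_typeI[OF inv a gen] by simp
qed

text \<open>Components of a toral grading are lines, so each generator is an eigenvector; the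
  eigenvalue squares to 1, and in a field this makes it a sign.\<close>

lemma graded_involution_has_type:
  assumes "graded_involution q \<tau>"
  shows "\<exists>a. has_type q a \<tau>"
proof -
  let ?Q = "quantum_torus q"
  obtain \<sigma> where \<tau>: "involution ?Q \<tau>" and \<sigma>: "Lambda_basis n \<sigma>"
    and comp: "\<And>d. d \<in> Lambda n \<Longrightarrow> \<tau> ` toral_component q \<sigma> d \<subseteq> toral_component q \<sigma> d"
    using assms by (auto simp: graded_involution_def)
  have "\<exists>c\<in>{1, -1}. \<tau> (qt_gen q i) = c \<odot>\<^bsub>?Q\<^esub> qt_gen q i" if i: "i < n" for i
  proof -
    let ?\<delta> = "\<lambda>j. if j = i then 1 else 0 :: int"
    note t = qt_gen_carrier[OF i]
    have mono: "qt_monomial q \<alpha> = qt_gen q i" if "\<And>j. j < n \<Longrightarrow> \<alpha> j = ?\<delta> j" for \<alpha>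
      using int_comb_cong[OF that, where \<sigma> = frag_of] int_comb_delta[OF i, of frag_of]
      by (intro algebra_isoD(3)[OF Theta_iso] Theta_monomial t) (simp add: Theta_monomial Theta_gen i)
    have one: "1 \<odot>\<^bsub>?Q\<^esub> qt_gen q i = qt_gen q i"
      using closed_algebra_quantum_torus t algebra_isoD(7)[OF Theta_iso t, of 1]
      by (intro algebra_isoD(3)[OF Theta_iso]) (auto simp: closed_algebra_def)
    have "qt_gen q i \<in> toral_component q \<sigma> (int_comb n \<sigma> ?\<delta>)"
      unfolding toral_component_def dim
      by (intro CollectI exI[of _ 1] exI[of _ ?\<delta>] conjI refl) (simp add: mono one)
    moreover have "int_comb n \<sigma> ?\<delta> \<in> Lambda n"
      using \<sigma> by (intro int_comb_Lambda) (simp add: Lambda_basis_def)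
    ultimately have "\<tau> (qt_gen q i) \<in> toral_component q \<sigma> (int_comb n \<sigma> ?\<delta>)"
      using comp by blast
    then obtain c \<alpha> where c: "\<tau> (qt_gen q i) = c \<odot>\<^bsub>?Q\<^esub> qt_monomial q \<alpha>"
      and \<alpha>: "int_comb n \<sigma> \<alpha> = int_comb n \<sigma> ?\<delta>"
      by (auto simp: toral_component_def)
    have "qt_monomial q \<alpha> = qt_gen q i"
      using Lambda_basis_unique[OF \<sigma> \<alpha>] by (rule mono)
    with c have c: "\<tau> (qt_gen q i) = c \<odot>\<^bsub>?Q\<^esub> qt_gen q i" by simp
    have anti: "anti_automorphism ?Q \<tau>" using \<tau> by (simp add: involution_def)
    have ct: "c \<odot>\<^bsub>?Q\<^esub> qt_gen q i \<in> carrier ?Q"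
      using closed_algebra_quantum_torus t by (simp add: closed_algebra_def)
    have "qt_gen q i = \<tau> (\<tau> (qt_gen q i))"
      using \<tau> t by (simp add: involution_def)
    also have "\<dots> = c \<odot>\<^bsub>?Q\<^esub> (c \<odot>\<^bsub>?Q\<^esub> qt_gen q i)"
      using anti_automorphismD(4)[OF anti t, of c] c by simp
    finally have "single (frag_of i) (1::'f) = single (frag_of i) (c * c)"
      using algebra_isoD(7)[OF Theta_iso ct, of c] algebra_isoD(7)[OF Theta_iso t, of c] Theta_gen[OF i]
      by (simp add: mult_single)
    then have "c * c = 1" by (metis lookup_single_eq)
    then have "c \<in> {1, -1}" by (simp add: square_eq_1_iff)
    with c show ?thesis by blast
  qed
  then obtain c where c: "\<And>i. i < n \<Longrightarrow> c i \<in> {1, -1} \<and> \<tau> (qt_gen q i) = c i \<odot>\<^bsub>?Q\<^esub> qt_gen q i"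
    by metis
  have "has_type q (\<lambda>i. if i < n then c i else 1) \<tau>"
    using c by (intro has_typeI[OF \<tau>]) auto
  then show ?thesis by blast
qed

end

section \<open>Equivalence of forms and bases of the degree group\<close>

text \<open>Equivalence modulo 2 under the automorphisms of $\Lambda$. These are required to be
  additive on $\Lambda$ only, which makes the relation evidently symmetric and transitive.\<close>

definition forms_equiv :: "nat \<Rightarrow> ((nat \<Rightarrow>\<^sub>0 int) \<Rightarrow> int) \<Rightarrow> ((nat \<Rightarrow>\<^sub>0 int) \<Rightarrow> int) \<Rightarrow> bool" where
  "forms_equiv n Q Q' \<longleftrightarrow> (\<exists>M. bij_betw M (Lambda n) (Lambda n) \<and>
     (\<forall>x\<in>Lambda n. \<forall>y\<in>Lambda n. M (x + y) = M x + M y) \<and>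
     (\<forall>x\<in>Lambda n. even (Q x) = even (Q' (M x))))"

lemma forms_equiv_trans:
  assumes "forms_equiv n Q Q'" "forms_equiv n Q' Q''"
  shows "forms_equiv n Q Q''"
proof -
  obtain M where M: "bij_betw M (Lambda n) (Lambda n)"
     "\<forall>x\<in>Lambda n. \<forall>y\<in>Lambda n. M (x + y) = M x + M y" "\<forall>x\<in>Lambda n. even (Q x) = even (Q' (M x))"
    using assms(1) unfolding forms_equiv_def by blast
  obtain M' where M': "bij_betw M' (Lambda n) (Lambda n)"
     "\<forall>x\<in>Lambda n. \<forall>y\<in>Lambda n. M' (x + y) = M' x + M' y" "\<forall>x\<in>Lambda n. even (Q' x) = even (Q'' (M' x))"
    using assms(2) unfolding forms_equiv_def by blast
  have "M x \<in> Lambda n" if "x \<in> Lambda n" for x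
    using bij_betw_apply[OF M(1) that] .
  then show ?thesis
    unfolding forms_equiv_def using bij_betw_trans[OF M(1) M'(1)] M(2,3) M'(2,3)
    by (intro exI[of _ "M' \<circ> M"]) simp
qed

lemma forms_equiv_sym:
  assumes "forms_equiv n Q Q'"
  shows "forms_equiv n Q' Q"
proof -
  obtain M where M: "bij_betw M (Lambda n) (Lambda n)"
     "\<And>x y. x \<in> Lambda n \<Longrightarrow> y \<in> Lambda n \<Longrightarrow> M (x + y) = M x + M y"
     "\<And>x. x \<in> Lambda n \<Longrightarrow> even (Q x) = even (Q' (M x))"
    using assms unfolding forms_equiv_def by blast
  let ?N = "inv_into (Lambda n) M"
  have N: "?N x \<in> Lambda n" "M (?N x) = x" "?N (M x) = x" if "x \<in> Lambda n" for x
    using M(1) that bij_betw_inv_into_right[OF M(1)] bij_betw_inv_into_left[OF M(1)]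
      bij_betw_apply[OF bij_betw_inv_into[OF M(1)]] by blast+
  have "?N (x + y) = ?N x + ?N y" if "x \<in> Lambda n" "y \<in> Lambda n" for x y
    using N(3)[of "?N x + ?N y"] M(2)[of "?N x" "?N y"] N that by simp
  then show ?thesis
    unfolding forms_equiv_def using bij_betw_inv_into[OF M(1)] M(3) N by (intro exI[of _ ?N]) auto
qed

lemma frag_extend_eq_int_comb:
  assumes "d \<in> Lambda n"
  shows "frag_extend v d = int_comb n v (lookup d)"
  unfolding frag_extend_def int_comb_def
  by (rule sum.mono_neutral_left) (use assms in \<open>auto simp: Lambda_iff in_keys_iff\<close>)

lemma int_comb_eq_frag_extend: "int_comb n v \<alpha> = frag_extend v (int_comb n frag_of \<alpha>)"
  by (simp add: int_comb_def frag_extend_sum o_def frag_extend_cmul)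

lemma lookup_int_comb: "lookup (int_comb n frag_of \<alpha>) i = (if i < n then \<alpha> i else 0)"
proof -
  have "lookup (int_comb n frag_of \<alpha>) i = (\<Sum>j<n. if j = i then \<alpha> i else 0)"
    unfolding int_comb_def lookup_sum by (rule sum.cong) auto
  then show ?thesis by simp
qed

lemma int_comb_lookup: "d \<in> Lambda n \<Longrightarrow> int_comb n frag_of (lookup d) = d"
  using frag_extend_eq_int_comb[of d n frag_of] frag_expansion[of d] by simp

lemma Lambda_basis_frag_of: "Lambda_basis n frag_of"
proof -
  have "\<alpha> i = 0" if "int_comb n frag_of \<alpha> = 0" "i < n" for \<alpha> i
    using lookup_int_comb[of n \<alpha> i] that by simp
  moreover have "\<exists>\<alpha>. d = int_comb n frag_of \<alpha>" if "d \<in> Lambda n" for d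
    using int_comb_lookup[OF that] by metis
  ultimately show ?thesis by (auto simp: Lambda_basis_def)
qed

text \<open>This lets an equivalence be treated as the map given by the images of the generators,
  which is additive everywhere.\<close>

lemma Lambda_additive_eq:
  assumes "\<And>x y. x \<in> Lambda n \<Longrightarrow> y \<in> Lambda n \<Longrightarrow> M (x + y) = M x + M y" and "d \<in> Lambda n"
  shows "M d = frag_extend (\<lambda>i. M (frag_of i)) d"
proof -
  have "keys d \<subseteq> {..<n}"
    using assms(2) by (simp add: Lambda_iff)
  then have "d \<in> Lambda n \<and> M d = frag_extend (\<lambda>i. M (frag_of i)) d"
  proof (induction rule: frag_induction)
    case zero
    then show ?case using assms(1)[of 0 0] by simp
  next
    case (diff a b)
    then show ?case
      using assms(1)[of "a - b" b] by (auto simp: frag_extend_diff)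
  qed auto
  then show ?thesis by blast
qed

lemma Lambda_basis_bij:
  assumes "Lambda_basis n v"
  shows "bij_betw (frag_extend v) (Lambda n) (Lambda n)"
proof (rule bij_betw_imageI)
  show "inj_on (frag_extend v) (Lambda n)"
  proof (rule inj_onI)
    fix x y assume x: "x \<in> Lambda n" "y \<in> Lambda n" "frag_extend v x = frag_extend v y"
    then have "lookup x i = lookup y i" if "i < n" for i
      using Lambda_basis_unique[OF assms _ that] by (simp add: frag_extend_eq_int_comb)
    then show "x = y"
      using int_comb_cong[of n "lookup x" "lookup y" frag_of] x int_comb_lookup
      by simp
  qed
  have "frag_extend v x \<in> Lambda n" if "x \<in> Lambda n" for x
    using assms that by (auto simp: frag_extend_eq_int_comb Lambda_basis_def intro: int_comb_Lambda)
  moreover have "d \<in> frag_extend v ` Lambda n" if d: "d \<in> Lambda n" for d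
  proof -
    obtain \<alpha> where "d = int_comb n v \<alpha>"
      using assms d unfolding Lambda_basis_def by blast
    then have "d = frag_extend v (int_comb n frag_of \<alpha>)"
      using int_comb_eq_frag_extend by (rule trans)
    moreover have "int_comb n frag_of \<alpha> \<in> Lambda n"
      by (rule int_comb_Lambda) auto
    ultimately show ?thesis by blast
  qed
  ultimately show "frag_extend v ` Lambda n = Lambda n" by blast
qed

lemma bij_Lambda_basis:
  assumes "bij_betw (frag_extend v) (Lambda n) (Lambda n)"
  shows "Lambda_basis n v"
proof -
  have "v i \<in> Lambda n" if "i < n" for i
    using bij_betw_apply[OF assms, of "frag_of i"] that by auto
  moreover have "\<exists>\<alpha>. d = int_comb n v \<alpha>" if "d \<in> Lambda n" for d
  proof -
    from assms that have "d \<in> frag_extend v ` Lambda n"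
      by (simp add: bij_betw_def)
    then show ?thesis
      using frag_extend_eq_int_comb[of _ n v] by blast
  qed
  moreover have "\<alpha> i = 0" if "int_comb n v \<alpha> = 0" "i < n" for \<alpha> i
  proof -
    have "int_comb n frag_of \<alpha> \<in> Lambda n"
      by (rule int_comb_Lambda) auto
    moreover have "frag_extend v (int_comb n frag_of \<alpha>) = frag_extend v 0"
      using that(1) int_comb_eq_frag_extend[of n v \<alpha>] by simp
    ultimately have "int_comb n frag_of \<alpha> = 0"
      using assms by (auto simp: bij_betw_def inj_on_def)
    then show ?thesis using lookup_int_comb[of n \<alpha> i] that by simp
  qed
  ultimately show ?thesis by (auto simp: Lambda_basis_def)
qed

section \<open>Isomorphisms induce equivalences\<close>

lemma neg_one_neq_one:
  assumes "CHAR('f::field) \<noteq> 2"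
  shows "(-1::'f) \<noteq> 1"
proof
  assume "(-1::'f) = 1"
  then have "(of_nat 2 :: 'f) = 0" by (simp add: neg_eq_iff_add_eq_0)
  then have "CHAR('f) dvd 2" by (simp only: of_nat_eq_0_iff_char_dvd)
  then have "CHAR('f) \<le> 2" "CHAR('f) \<noteq> 0"
    by (auto dest: dvd_imp_le intro!: Nat.gr0I)
  moreover have "CHAR('f) \<noteq> 1"
    by simp
  ultimately show False using assms by linarith
qed

lemma lookup_lext:
  "lookup (lext \<phi> p) d = (\<Sum>a\<in>keys p. lookup p a * lookup (\<phi> a) d)"
  by (simp add: lext_def lookup_sum lookup_scale)

text \<open>No cancellation occurs at a degree that is a sum of degrees of the factors in only one
  way.\<close>

lemma lookup_tmul_unique:
  fixes x y :: "'a::monoid_add \<Rightarrow>\<^sub>0 'f::field"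
  assumes u: "u \<in> keys x" and v: "v \<in> keys y"
    and uniq: "\<And>\<alpha> \<beta>. \<alpha> \<in> keys x \<Longrightarrow> \<beta> \<in> keys y \<Longrightarrow> \<alpha> + \<beta> = u + v \<Longrightarrow> \<alpha> = u \<and> \<beta> = v"
  shows "lookup (tmul b x y) (u + v) \<noteq> 0"
proof -
  let ?c = "lookup x u * (lookup y v * sg (b u v))"
  have "lookup (tmul b x y) (u + v)
     = (\<Sum>\<alpha>\<in>keys x. \<Sum>\<beta>\<in>keys y. lookup x \<alpha> *
         (lookup y \<beta> * (sg (b \<alpha> \<beta>) when \<alpha> + \<beta> = u + v)))"
    by (simp add: tmul_def lookup_lext lookup_single sum_distrib_left)
  also have "\<dots> = (\<Sum>\<alpha>\<in>keys x. \<Sum>\<beta>\<in>keys y. if \<beta> = v then (if \<alpha> = u then ?c else 0) else 0)"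
    using uniq by (intro sum.cong refl) (auto simp: when_def)
  also have "\<dots> = ?c"
    using u v by simp
  finally show ?thesis
    using u v by (simp add: in_keys_iff sg_def)
qed

lemma single_eq_iff:
  assumes "c \<noteq> 0"
  shows "single a c = single b e \<longleftrightarrow> a = b \<and> c = e"
  using assms by (metis lookup_single_eq lookup_single_not_eq)

text \<open>In a totally ordered group, the sums of the largest and of the smallest degrees of the
  factors are attained only once. Both therefore survive in the product, which is 1, and so
  vanish; hence the largest and the smallest degree of $x$ agree.\<close>

lemma tmul_unit_single:
  fixes x y :: "'a::{linorder, ordered_cancel_comm_monoid_add} \<Rightarrow>\<^sub>0 'f::field"
  assumes "tmul b x y = 1"
  shows "\<exists>d c. c \<noteq> 0 \<and> x = single d c"
proof -
  let ?X = "keys x" and ?Y = "keys y"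
  have ne: "?X \<noteq> {}" "?Y \<noteq> {}"
    using assms by auto
  have supp: "u + v = 0" if "u \<in> ?X" "v \<in> ?Y"
    "\<And>\<alpha> \<beta>. \<alpha> \<in> ?X \<Longrightarrow> \<beta> \<in> ?Y \<Longrightarrow> \<alpha> + \<beta> = u + v \<Longrightarrow> \<alpha> = u \<and> \<beta> = v" for u v
  proof -
    have "lookup (tmul b x y) (u + v) \<noteq> 0"
      by (rule lookup_tmul_unique[OF that(1,2)]) (rule that(3))
    then show ?thesis
      unfolding assms lookup_one by (simp only: when_neq_zero)
  qed
  have "Max ?X + Max ?Y = 0"
  proof (rule supp)
    fix \<alpha> \<beta> assume a: "\<alpha> \<in> ?X" "\<beta> \<in> ?Y" "\<alpha> + \<beta> = Max ?X + Max ?Y"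
    then have "\<alpha> \<le> Max ?X" "\<beta> \<le> Max ?Y" by auto
    with a(3) show "\<alpha> = Max ?X \<and> \<beta> = Max ?Y"
      using add_less_le_mono[of \<alpha> "Max ?X" \<beta> "Max ?Y"] add_le_less_mono[of \<alpha> "Max ?X" \<beta> "Max ?Y"]
      by (metis order.irrefl order.order_iff_strict)
  qed (use ne in auto)
  moreover have "Min ?X + Min ?Y = 0"
  proof (rule supp)
    fix \<alpha> \<beta> assume a: "\<alpha> \<in> ?X" "\<beta> \<in> ?Y" "\<alpha> + \<beta> = Min ?X + Min ?Y"
    then have "Min ?X \<le> \<alpha>" "Min ?Y \<le> \<beta>" by auto
    with a(3) show "\<alpha> = Min ?X \<and> \<beta> = Min ?Y"
      using add_less_le_mono[of "Min ?X" \<alpha> "Min ?Y" \<beta>] add_le_less_mono[of "Min ?X" \<alpha> "Min ?Y" \<beta>]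
      by (metis order.irrefl order.order_iff_strict)
  qed (use ne in auto)
  moreover have "Min ?X \<le> Max ?X" "Min ?Y \<le> Max ?Y"
    using ne by auto
  ultimately have "Min ?X = Max ?X"
    using add_less_le_mono[of "Min ?X" "Max ?X" "Min ?Y" "Max ?Y"]
    by (metis order.irrefl order.order_iff_strict)
  then have "\<alpha> = Max ?X" if "\<alpha> \<in> ?X" for \<alpha>
    using Max_ge[OF finite_keys that] Min_le[OF finite_keys that] by (metis order.antisym)
  then obtain d where d: "?X = {d}" using ne by blast
  then have "x = single d (lookup x d)"
    using poly_mapping_eq_sum_single[of x] by simp
  moreover have "lookup x d \<noteq> 0"
    using d by (auto simp flip: in_keys_iff)
  ultimately show ?thesis by blast
qed

locale two_tori = src: elementary_torus q n + tgt: elementary_torus r n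
  for q r :: "'f::field mat" and n
begin

text \<open>Monomials are units, so their images are multiples of monomials.\<close>

lemma model_iso_single:
  assumes F: "F \<in> algebra_iso (torus_model q) (torus_model r)" and d: "d \<in> Lambda n"
  shows "\<exists>e c. e \<in> Lambda n \<and> c \<noteq> 0 \<and> F (single d 1) = single e c"
proof -
  note F' = algebra_isoD[OF F, simplified]
  \<comment> \<open>The sign makes the product of the two monomials equal to 1.\<close>
  let ?x = "single d (1::'f)" and ?y = "single (- d) (sg (bform q d (- d)) :: 'f)"
  have k: "keys ?x \<subseteq> Lambda n" "keys ?y \<subseteq> Lambda n"
    using d by (auto simp: keys_single)
  have "tmul (bform q) ?x ?y = 1"
    by simp
  then have "tmul (bform r) (F ?x) (F ?y) = 1"
    using F'(4)[OF k] F'(6) by simp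
  from tmul_unit_single[OF this] obtain e c where e: "c \<noteq> 0" "F ?x = single e c"
    by blast
  moreover have "e \<in> Lambda n"
    using F'(2)[OF k(1)] e by simp
  ultimately show ?thesis by blast
qed

end

text \<open>Any isomorphism sends $t^d$ to a multiple of $t^{M(d)}$, whether it is assumed graded
  or not. Compatibility with the involutions says that $(-1)^{Q(d)}$ and $(-1)^{Q'(M(d))}$ are
  equal in $F$, which gives equal parities when $-1 \ne 1$ in $F$.\<close>

lemma iso_inv_imp_forms_equiv:
  fixes q r :: "'f::field mat"
  assumes q: "elementary_quantum_matrix n q" and r: "elementary_quantum_matrix n r"
    and char: "CHAR('f) \<noteq> 2"
    and \<tau>: "has_type q a \<tau>" and \<rho>: "has_type r a' \<rho>" and iso: "iso_inv q \<tau> r \<rho>"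
  shows "forms_equiv n (qform q a) (qform r a')"
proof -
  interpret two_tori q r n
    using q r by (simp add: two_tori_def elementary_torus_def)
  interpret rev: two_tori r q n
    using q r by (simp add: two_tori_def elementary_torus_def)
  obtain f where f: "f \<in> algebra_iso (quantum_torus q) (quantum_torus r)"
    and f\<tau>: "\<And>x. x \<in> carrier (quantum_torus q) \<Longrightarrow> f (\<tau> x) = \<rho> (f x)"
    using iso by (auto simp: iso_inv_def)
  define F where "F = Theta r \<circ> (f \<circ> src.Theta_inv)"
  have F: "F \<in> algebra_iso (torus_model q) (torus_model r)"
    unfolding F_def by (rule algebra_iso_comp[OF algebra_iso_comp[OF src.Theta_inv_iso f] tgt.Theta_iso])
  note F' = algebra_isoD[OF F, simplified]
  define G where "G = inv_into (carrier (torus_model q)) F"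
  have G: "G \<in> algebra_iso (torus_model r) (torus_model q)"
    unfolding G_def
  proof (rule algebra_iso_inv[OF F src.model.ring_axioms])
    fix c and x :: "(nat \<Rightarrow>\<^sub>0 int) \<Rightarrow>\<^sub>0 'f"
    assume "x \<in> carrier (torus_model q)"
    then show "c \<odot>\<^bsub>torus_model q\<^esub> x \<in> carrier (torus_model q)"
      using keys_scale_subset[of c x] by auto
  qed
  have FG: "F (G y) = y" if "keys y \<subseteq> Lambda n" for y
    unfolding G_def by (rule bij_betw_inv_into_right[OF algebra_isoD(1)[OF F]]) (simp add: that)
  have "\<forall>d\<in>Lambda n. \<exists>e c. e \<in> Lambda n \<and> c \<noteq> 0 \<and> F (single d 1) = single e c"
    using model_iso_single[OF F] by blast
  then obtain M c where M: "\<And>d. d \<in> Lambda n \<Longrightarrow> M d \<in> Lambda n"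
    and c: "\<And>d. d \<in> Lambda n \<Longrightarrow> c d \<noteq> 0"
    and F1: "\<And>d. d \<in> Lambda n \<Longrightarrow> F (single d 1) = single (M d) (c d)"
    by metis
  have Fs: "F (single d e) = single (M d) (e * c d)" if "d \<in> Lambda n" for d e
    using F'(7)[of "single d 1" e] F1[OF that] that by (simp add: mult_single)
  have "inj_on M (Lambda n)"
  proof (rule inj_onI)
    fix d d' assume d: "d \<in> Lambda n" "d' \<in> Lambda n" "M d = M d'"
    then have "F (single d (c d')) = F (single d' (c d))"
      by (simp add: Fs mult.commute)
    then have "single d (c d') = single d' (c d)"
      using F'(3) d by (auto simp: keys_single)
    then show "d = d'"
      using c d by (simp add: single_eq_iff)
  qed
  moreover have "d \<in> M ` Lambda n" if d: "d \<in> Lambda n" for d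
  proof -
    obtain e k where e: "e \<in> Lambda n" "k \<noteq> 0" "G (single d 1) = single e k"
      using rev.model_iso_single[OF G d] by blast
    then have "single d 1 = single (M e) (k * c e)"
      using FG[of "single d 1"] Fs d by simp
    then have "d = M e"
      by (simp add: single_eq_iff)
    with e show ?thesis by blast
  qed
  ultimately have bij: "bij_betw M (Lambda n) (Lambda n)"
    using M by (auto simp: bij_betw_def)
  have add: "M (x + y) = M x + M y" if xy: "x \<in> Lambda n" "y \<in> Lambda n" for x y
  proof -
    have "F (tmul (bform q) (single x 1) (single y 1))
        = tmul (bform r) (F (single x 1)) (F (single y 1))"
      using F'(4)[of "single x 1" "single y 1"] xy by simp
    then have "single (M (x + y)) (sg (bform q x y) * c (x + y))
        = single (M x + M y) (c x * c y * sg (bform r (M x) (M y)))"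
      using xy by (simp add: Fs)
    then show ?thesis
      using c[of "x + y"] xy by (subst (asm) single_eq_iff) (auto simp: sg_def)
  qed
  have "(-1::'f) \<noteq> 1"
    by (rule neg_one_neq_one[OF char])
  then have sg_inj: "even j = even k" if "sg j = (sg k :: 'f)" for j k
    using that by (metis sg_def)
  have "even (qform q a d) = even (qform r a' (M d))" if d: "d \<in> Lambda n" for d
  proof -
    let ?s = "single d (1::'f)"
    have s: "?s \<in> carrier (torus_model q)" using d by simp
    define x where "x = src.Theta_inv ?s"
    have x: "x \<in> carrier (quantum_torus q)" "Theta q x = ?s"
      unfolding x_def using src.Theta_inverse(2)[OF s] algebra_isoD(2)[OF src.Theta_inv_iso s] by simp_all
    have \<tau>x: "\<tau> x \<in> carrier (quantum_torus q)" "Theta q (\<tau> x) = single d (sg (qform q a d))"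
      using \<tau> x by (auto simp: has_type_def)
    have fx: "f x \<in> carrier (quantum_torus r)" using algebra_isoD(2)[OF f x(1)] .
    have F\<Theta>: "F (Theta q z) = Theta r (f z)" if "z \<in> carrier (quantum_torus q)" for z
      using src.Theta_inverse(1)[OF that] by (simp add: F_def)
    have "Theta r (f (\<tau> x)) = diag (qform r a') (Theta r (f x))"
      using f\<tau>[OF x(1)] \<rho> fx by (simp add: has_type_def)
    then have "F (single d (sg (qform q a d))) = diag (qform r a') (F ?s)"
      using F\<Theta>[OF \<tau>x(1)] F\<Theta>[OF x(1)] \<tau>x(2) x(2) by simp
    then have "single (M d) (sg (qform q a d) * c d)
        = single (M d) (c d * sg (qform r a' (M d)))"
      using d by (simp add: Fs)
    then have "sg (qform q a d) * c d = c d * sg (qform r a' (M d))"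
      by (metis lookup_single_eq)
    then have "sg (qform q a d) = (sg (qform r a' (M d)) :: 'f)"
      using c[OF d] by (metis mult.commute mult_left_cancel)
    then show ?thesis by (rule sg_inj)
  qed
  then show ?thesis
    unfolding forms_equiv_def using bij add by blast
qed

section \<open>Equivalences induce graded isomorphisms\<close>

lemma sum_square_split:
  fixes f :: "nat \<Rightarrow> nat \<Rightarrow> 'a::comm_monoid_add"
  shows "(\<Sum>i<n. \<Sum>j<n. f i j) = (\<Sum>j<n. f j j + (\<Sum>i<j. f i j + f j i))"
  by (induction n) (simp_all add: sum.distrib add_ac)

lemma Lambda_additive_expand:
  fixes h :: "(nat \<Rightarrow>\<^sub>0 int) \<Rightarrow> int"
  assumes "\<And>x y. h (x + y) = h x + h y" and "x \<in> Lambda n"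
  shows "h x = (\<Sum>i<n. lookup x i * h (frag_of i))"
proof -
  have d: "h (x - y) = h x - h y" for x y
    using assms(1)[of "x - y" y] by simp
  have "keys x \<subseteq> {..<n}"
    using assms(2) by (simp add: Lambda_iff)
  then show ?thesis
  proof (induction rule: frag_induction)
    case zero
    then show ?case using assms(1)[of 0 0] by simp
  next
    case (one k)
    have "(\<Sum>i<n. lookup (frag_of k) i * h (frag_of i)) = (\<Sum>i<n. if i = k then h (frag_of k) else 0)"
      by (rule sum.cong) auto
    then show ?case using one by simp
  next
    case (diff a b)
    then show ?case by (simp add: d lookup_minus left_diff_distrib sum_subtractf)
  qed
qed

text \<open>On the free group $\Lambda$ a biadditive form that is symmetric modulo 2 is a
  coboundary modulo 2. With $g_{ij}$ its values on the basis, a primitive is $s(x) = \sum_j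
  g_{jj}\binom{x_j}{2} + \sum_{i<j} g_{ij}x_ix_j$; the binomial coefficient replaces half of the
  square.\<close>

lemma symmetric_coboundary:
  fixes \<beta> :: "(nat \<Rightarrow>\<^sub>0 int) \<Rightarrow> (nat \<Rightarrow>\<^sub>0 int) \<Rightarrow> int"
  assumes left: "\<And>x x' y. \<beta> (x + x') y = \<beta> x y + \<beta> x' y"
    and right: "\<And>x y y'. \<beta> x (y + y') = \<beta> x y + \<beta> x y'"
    and sym: "\<And>x y. x \<in> Lambda n \<Longrightarrow> y \<in> Lambda n \<Longrightarrow> even (\<beta> x y) = even (\<beta> y x)"
  shows "\<exists>s. \<forall>x\<in>Lambda n. \<forall>y\<in>Lambda n. even (s (x + y) + s x + s y + \<beta> x y)"
proof -
  let ?g = "\<lambda>i j. \<beta> (frag_of i) (frag_of j)"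
  define t where "t k = k * (k - 1) div 2" for k :: int
  have t: "t (k + l) = t k + t l + k * l" for k l
  proof -
    have e: "even (k * (k - 1))" for k :: int by auto
    have "2 * t k = k * (k - 1)" for k
      unfolding t_def using e[of k] by simp
    from this[of k] this[of l] this[of "k + l"] show ?thesis
      by (simp add: algebra_simps)
  qed
  let ?x = "\<lambda>x i. lookup x i :: int"
  define s where "s x = (\<Sum>j<n. ?g j j * t (?x x j) + (\<Sum>i<j. ?g i j * (?x x i * ?x x j)))" for x
  have "even (s (x + y) + s x + s y + \<beta> x y)" if xy: "x \<in> Lambda n" "y \<in> Lambda n" for x y
  proof -
    have "\<beta> x y = (\<Sum>i<n. ?x x i * \<beta> (frag_of i) y)"
      by (rule Lambda_additive_expand[where h = "\<lambda>x. \<beta> x y"]) (use left xy in auto)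
    also have "\<dots> = (\<Sum>i<n. \<Sum>j<n. ?x x i * ?x y j * ?g i j)"
      using Lambda_additive_expand[where h = "\<beta> (frag_of i)" for i, OF right xy(2)]
      by (simp add: sum_distrib_left mult_ac)
    also have "\<dots> = (\<Sum>j<n. ?x x j * ?x y j * ?g j j
        + (\<Sum>i<j. ?x x i * ?x y j * ?g i j + ?x x j * ?x y i * ?g j i))"
      by (rule sum_square_split)
    finally have \<beta>: "\<beta> x y = (\<Sum>j<n. ?x x j * ?x y j * ?g j j
        + (\<Sum>i<j. ?x x i * ?x y j * ?g i j + ?x x j * ?x y i * ?g j i))" .
    have "s (x + y) + s x + s y + \<beta> x y
      = (\<Sum>j<n. 2 * (?g j j * (t (?x x j) + t (?x y j) + ?x x j * ?x y j))
          + (\<Sum>i<j. 2 * (?g i j * (?x x i * ?x x j + ?x y i * ?x y j + ?x x i * ?x y j))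
              + ?x y i * ?x x j * (?g i j + ?g j i)))"
      unfolding \<beta> s_def sum.distrib[symmetric]
    proof (intro sum.cong refl)
      fix j
      have diag: "?g j j * t (?x (x + y) j) + ?g j j * t (?x x j) + ?g j j * t (?x y j) + ?x x j * ?x y j * ?g j j
          = 2 * (?g j j * (t (?x x j) + t (?x y j) + ?x x j * ?x y j))"
        by (simp add: lookup_add t algebra_simps)
      have off: "(\<Sum>i<j. ?g i j * (?x (x + y) i * ?x (x + y) j)) + (\<Sum>i<j. ?g i j * (?x x i * ?x x j))
          + (\<Sum>i<j. ?g i j * (?x y i * ?x y j)) + (\<Sum>i<j. ?x x i * ?x y j * ?g i j + ?x x j * ?x y i * ?g j i)
          = (\<Sum>i<j. 2 * (?g i j * (?x x i * ?x x j + ?x y i * ?x y j + ?x x i * ?x y j))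
              + ?x y i * ?x x j * (?g i j + ?g j i))"
        unfolding sum.distrib[symmetric]
        by (intro sum.cong refl) (simp add: lookup_add algebra_simps)
      show "?g j j * t (?x (x + y) j) + (\<Sum>i<j. ?g i j * (?x (x + y) i * ?x (x + y) j))
          + (?g j j * t (?x x j) + (\<Sum>i<j. ?g i j * (?x x i * ?x x j)))
          + (?g j j * t (?x y j) + (\<Sum>i<j. ?g i j * (?x y i * ?x y j)))
          + (?x x j * ?x y j * ?g j j + (\<Sum>i<j. ?x x i * ?x y j * ?g i j + ?x x j * ?x y i * ?g j i))
        = 2 * (?g j j * (t (?x x j) + t (?x y j) + ?x x j * ?x y j))
          + (\<Sum>i<j. 2 * (?g i j * (?x x i * ?x x j + ?x y i * ?x y j + ?x x i * ?x y j))
              + ?x y i * ?x x j * (?g i j + ?g j i))"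
        unfolding diag[symmetric] off[symmetric] by (simp only: add_ac)
    qed
    also have "even \<dots>"
    proof (intro dvd_sum)
      fix j assume "j \<in> {..<n}"
      then have "even (?g i j + ?g j i)" if "i < j" for i
        using sym[of "frag_of i" "frag_of j"] that by auto
      then have "even (\<Sum>i<j. 2 * (?g i j * (?x x i * ?x x j + ?x y i * ?x y j + ?x x i * ?x y j))
              + ?x y i * ?x x j * (?g i j + ?g j i))"
        by (intro dvd_sum) simp
      then show "even (2 * (?g j j * (t (?x x j) + t (?x y j) + ?x x j * ?x y j))
          + (\<Sum>i<j. 2 * (?g i j * (?x x i * ?x x j + ?x y i * ?x y j + ?x x i * ?x y j))
              + ?x y i * ?x x j * (?g i j + ?g j i)))"
        by simp
    qed
    finally show ?thesis .
  qed
  then show ?thesis by blast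
qed

text \<open>Equivalent forms have the same polar form modulo 2, which says that the difference of
  the two cocycles is symmetric modulo 2.\<close>

lemma forms_equiv_polar:
  assumes "\<And>x y. M (x + y) = M x + M y"
    and "\<And>x. x \<in> Lambda n \<Longrightarrow> even (qform q a x) = even (qform r a' (M x))"
    and xy: "x \<in> Lambda n" "y \<in> Lambda n"
  shows "even (bform q x y + bform r (M x) (M y)) = even (bform q y x + bform r (M y) (M x))"
  using assms(2)[OF xy(1)] assms(2)[OF xy(2)] assms(2)[of "x + y"] xy
  by (auto simp: assms(1) qform_add)

text \<open>The map $t^d \mapsto (-1)^{s(d)} t^{M(d)}$ is multiplicative exactly when $s$ is a
  primitive of the difference of the two cocycles.\<close>

lemma forms_equiv_imp_model_iso:
  fixes q r :: "'f::field mat"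
  assumes q: "elementary_quantum_matrix n q" and r: "elementary_quantum_matrix n r"
    and M: "bij_betw M (Lambda n) (Lambda n)" and add: "\<And>x y. M (x + y) = M x + M y"
    and Q: "\<And>x. x \<in> Lambda n \<Longrightarrow> even (qform q a x) = even (qform r a' (M x))"
  shows "\<exists>F s. F \<in> algebra_iso (torus_model q) (torus_model r) \<and>
    (\<forall>d\<in>Lambda n. \<forall>c. F (single d c) = single (M d) (c * sg (s d))) \<and>
    (\<forall>y\<in>carrier (torus_model q). F (diag (qform q a) y) = diag (qform r a') (F y))"
proof -
  have dim [simp]: "dim_row q = n" "dim_row r = n"
    using elementary_dim q r by blast+
  have "\<exists>s. \<forall>x\<in>Lambda n. \<forall>y\<in>Lambda n.
      even (s (x + y) + s x + s y + (bform q x y + bform r (M x) (M y)))"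
    by (rule symmetric_coboundary) (simp add: add bform_add, simp add: add bform_add,
        rule forms_equiv_polar[OF add Q])
  then obtain s where s: "\<And>x y. x \<in> Lambda n \<Longrightarrow> y \<in> Lambda n \<Longrightarrow>
      even (s (x + y) + s x + s y + (bform q x y + bform r (M x) (M y)))"
    by blast
  let ?N = "inv_into (Lambda n) M"
  define F where "F = lext (\<lambda>d. single (M d) (sg (s d) :: 'f))"
  define G where "G = lext (\<lambda>d. single (?N d) (sg (s (?N d)) :: 'f))"
  have F [simp]: "F 0 = 0" "F (x + y) = F x + F y" "F (single 0 c * x) = single 0 c * F x"
    "F (single d c) = single (M d) (c * sg (s d))" for x y c d
    by (simp_all add: F_def lext_add lext_scale mult_single)
  have G [simp]: "G 0 = 0" "G (x + y) = G x + G y"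
    "G (single d c) = single (?N d) (c * sg (s (?N d)))" for x y c d
    by (simp_all add: G_def lext_add lext_scale mult_single)
  have M_Lam: "M d \<in> Lambda n" if "d \<in> Lambda n" for d
    using bij_betw_apply[OF M that] .
  have N_Lam: "?N d \<in> Lambda n" "?N (M d) = d" "M (?N d) = d" if "d \<in> Lambda n" for d
    using bij_betw_apply[OF bij_betw_inv_into[OF M] that] bij_betw_inv_into_left[OF M that]
      bij_betw_inv_into_right[OF M that] .
  have F_Lam: "keys (F x) \<subseteq> Lambda n" if "keys x \<subseteq> Lambda n" for x
    unfolding F_def by (rule order_trans[OF keys_lext]) (use that M_Lam in \<open>auto simp: keys_single split: if_splits\<close>)
  have G_Lam: "keys (G x) \<subseteq> Lambda n" if "keys x \<subseteq> Lambda n" for x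
    unfolding G_def by (rule order_trans[OF keys_lext]) (use that N_Lam in \<open>auto simp: keys_single split: if_splits\<close>)
  have GF: "G (F x) = x" if "keys x \<subseteq> Lambda n" for x
    using that by (induction rule: poly_mapping_additive_induct) (auto simp: N_Lam mult.assoc)
  have FG: "F (G x) = x" if "keys x \<subseteq> Lambda n" for x
    using that by (induction rule: poly_mapping_additive_induct) (auto simp: N_Lam mult.assoc)
  have "bij_betw F (carrier (torus_model q)) (carrier (torus_model r))"
    by (rule bij_betw_byWitness[where f' = G]) (use GF FG F_Lam G_Lam in auto)
  moreover have "F (tmul (bform q) x y) = tmul (bform r) (F x) (F y)"
    if "keys x \<subseteq> Lambda n" and y: "keys y \<subseteq> Lambda n" for x y
    using that(1)
  proof (induction rule: poly_mapping_additive_induct)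
    case (single \<alpha> c)
    note \<alpha> = single
    show ?case
      using y
    proof (induction rule: poly_mapping_additive_induct)
      case (single \<beta> e)
      have "sg (bform q \<alpha> \<beta>) * sg (s (\<alpha> + \<beta>)) = (sg (s \<alpha>) * sg (s \<beta>) * sg (bform r (M \<alpha>) (M \<beta>)) :: 'f)"
        unfolding sg_add[symmetric] by (rule sg_cong) (use s[OF \<alpha> single] in auto)
      then show ?case by (simp add: add mult_ac)
    qed (simp_all add: tmul_add)
  qed (simp_all add: tmul_add)
  moreover have "F 1 = 1"
  proof -
    have "M 0 = 0" using add[of 0 0] by simp
    moreover have "even (s 0)" using s[of 0 0] \<open>M 0 = 0\<close> by simp
    ultimately have "F (single 0 1) = single 0 1"
      unfolding F by (simp add: sg_def)
    then show ?thesis by simp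
  qed
  ultimately have "F \<in> algebra_iso (torus_model q) (torus_model r)"
    using F_Lam by (auto simp: algebra_iso_def ring_iso_def Ring.ring_hom_def)
  moreover have "F (diag (qform q a) y) = diag (qform r a') (F y)" if "y \<in> carrier (torus_model q)" for y
  proof -
    have "keys y \<subseteq> Lambda n" using that by simp
    then show ?thesis
    proof (induction rule: poly_mapping_additive_induct)
      case (single d c)
      have "sg (qform q a d) = (sg (qform r a' (M d)) :: 'f)"
        by (rule sg_cong[OF Q[OF single]])
      then show ?case by (simp add: mult_ac)
    qed simp_all
  qed
  ultimately show ?thesis using F(4) by blast
qed

lemma (in elementary_torus) Theta_toral_component:
  "Theta q ` toral_component q \<sigma> d
    = {single (int_comb n frag_of \<alpha>) c | c \<alpha>. int_comb n \<sigma> \<alpha> = d}" (is "?L = ?R")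
  and toral_component_carrier: "toral_component q \<sigma> d \<subseteq> carrier (quantum_torus q)"
proof -
  have m: "Theta q (c \<odot>\<^bsub>quantum_torus q\<^esub> qt_monomial q \<alpha>) = single (int_comb n frag_of \<alpha>) c" for c \<alpha>
    using algebra_isoD(7)[OF Theta_iso Theta_monomial(1)] by (simp add: Theta_monomial(2) mult_single)
  show "?L = ?R"
  proof
    show "?L \<subseteq> ?R"
      unfolding toral_component_def using m by auto
    show "?R \<subseteq> ?L"
    proof
      fix y assume "y \<in> ?R"
      then obtain c \<alpha> where y: "y = single (int_comb n frag_of \<alpha>) c" "int_comb n \<sigma> \<alpha> = d"
        by blast
      then have "c \<odot>\<^bsub>quantum_torus q\<^esub> qt_monomial q \<alpha> \<in> toral_component q \<sigma> d"
        unfolding toral_component_def dim by blast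
      then show "y \<in> ?L"
        using m y(1) by (metis image_eqI)
    qed
  qed
  show "toral_component q \<sigma> d \<subseteq> carrier (quantum_torus q)"
    using closed_algebra_quantum_torus Theta_monomial(1)
    by (auto simp: toral_component_def closed_algebra_def)
qed

text \<open>The isomorphism sends $t^\alpha$ to a multiple of $t^{M(\alpha)}$. It is graded when
  the generators of the source get the degrees $M(e_i)$ and those of the target the degrees
  $e_i$.\<close>

lemma forms_equiv_imp_graded_iso_inv:
  fixes q r :: "'f::field mat"
  assumes q: "elementary_quantum_matrix n q" and r: "elementary_quantum_matrix n r"
    and \<tau>: "has_type q a \<tau>" and \<rho>: "has_type r a' \<rho>"
    and eq: "forms_equiv n (qform q a) (qform r a')"
  shows "graded_iso_inv q \<tau> r \<rho>"
proof -
  interpret two_tori q r n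
    using q r by (simp add: two_tori_def elementary_torus_def)
  obtain M0 where M0: "bij_betw M0 (Lambda n) (Lambda n)"
     "\<And>x y. x \<in> Lambda n \<Longrightarrow> y \<in> Lambda n \<Longrightarrow> M0 (x + y) = M0 x + M0 y"
     "\<And>x. x \<in> Lambda n \<Longrightarrow> even (qform q a x) = even (qform r a' (M0 x))"
    using eq unfolding forms_equiv_def by blast
  define v where "v i = M0 (frag_of i)" for i
  define M where "M = frag_extend v"
  have MM0: "M0 d = M d" if "d \<in> Lambda n" for d
    unfolding M_def v_def by (rule Lambda_additive_eq[OF M0(2) that])
  have bij: "bij_betw M (Lambda n) (Lambda n)"
    using M0(1) bij_betw_cong[of "Lambda n" M0 M "Lambda n"] MM0 by blast
  have basis: "Lambda_basis n v"
    using bij bij_Lambda_basis unfolding M_def by blast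
  obtain F s where F: "F \<in> algebra_iso (torus_model q) (torus_model r)"
    and Fs: "\<And>d c. d \<in> Lambda n \<Longrightarrow> F (single d c) = single (M d) (c * sg (s d))"
    and Fd: "\<And>y. y \<in> carrier (torus_model q) \<Longrightarrow> F (diag (qform q a) y) = diag (qform r a') (F y)"
    using forms_equiv_imp_model_iso[OF q r bij, of a a'] M0(3) MM0 by (auto simp: M_def frag_extend_add)
  define f where "f = tgt.Theta_inv \<circ> (F \<circ> Theta q)"
  have f: "f \<in> algebra_iso (quantum_torus q) (quantum_torus r)"
    unfolding f_def by (rule algebra_iso_comp[OF algebra_iso_comp[OF src.Theta_iso F] tgt.Theta_inv_iso])
  have \<Theta>f: "Theta r (f x) = F (Theta q x)" if "x \<in> carrier (quantum_torus q)" for x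
    using tgt.Theta_inverse(2)[OF algebra_isoD(2)[OF F algebra_isoD(2)[OF src.Theta_iso that]]]
    by (simp add: f_def)
  have f\<tau>: "f (\<tau> x) = \<rho> (f x)" if x: "x \<in> carrier (quantum_torus q)" for x
  proof (rule algebra_isoD(3)[OF tgt.Theta_iso])
    have t: "\<tau> x \<in> carrier (quantum_torus q)" "Theta q (\<tau> x) = diag (qform q a) (Theta q x)"
      using \<tau> x by (auto simp: has_type_def)
    have fx: "f x \<in> carrier (quantum_torus r)" using algebra_isoD(2)[OF f x] .
    show "f (\<tau> x) \<in> carrier (quantum_torus r)" using algebra_isoD(2)[OF f t(1)] .
    show "\<rho> (f x) \<in> carrier (quantum_torus r)" using \<rho> fx by (simp add: has_type_def)
    show "Theta r (f (\<tau> x)) = Theta r (\<rho> (f x))"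
      using \<rho> fx Fd[OF algebra_isoD(2)[OF src.Theta_iso x]] by (simp add: has_type_def \<Theta>f t x)
  qed
  have comp: "f ` toral_component q v d = toral_component r frag_of d" if d: "d \<in> Lambda n" for d
  proof -
    have e: "int_comb n frag_of \<alpha> \<in> Lambda n" for \<alpha>
      by (rule int_comb_Lambda) auto
    have Me: "M (int_comb n frag_of \<alpha>) = int_comb n v \<alpha>" for \<alpha>
      unfolding M_def by (rule int_comb_eq_frag_extend[symmetric])
    obtain \<alpha>0 where "d = int_comb n v \<alpha>0"
      using basis d unfolding Lambda_basis_def by blast
    note \<alpha>0 = this[symmetric]
    have "Theta r ` f ` toral_component q v d = F ` Theta q ` toral_component q v d"
      unfolding image_image by (rule image_cong[OF refl]) (use \<Theta>f src.toral_component_carrier in blast)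
    also have "\<dots> = {single d c | c :: 'f. True}"
      unfolding src.Theta_toral_component
    proof (intro equalityI subsetI)
      fix y assume "y \<in> F ` {single (int_comb n frag_of \<alpha>) (c :: 'f) | c \<alpha>. int_comb n v \<alpha> = d}"
      then show "y \<in> {single d c | c :: 'f. True}"
        using Fs[OF e] Me by auto
    next
      fix y assume "y \<in> {single d c | c :: 'f. True}"
      then obtain c where y: "y = single d c" by blast
      let ?k = "sg (s (int_comb n frag_of \<alpha>0)) :: 'f"
      have "y = F (single (int_comb n frag_of \<alpha>0) (c * ?k))"
        using Fs[OF e, of \<alpha>0 "c * ?k"] Me[of \<alpha>0] \<alpha>0 y by (simp add: mult.assoc)
      then show "y \<in> F ` {single (int_comb n frag_of \<alpha>) (c :: 'f) | c \<alpha>. int_comb n v \<alpha> = d}"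
        using \<alpha>0 by blast
    qed
    also have "\<dots> = Theta r ` toral_component r frag_of d"
      unfolding tgt.Theta_toral_component
      by (rule Collect_cong) (metis int_comb_lookup[OF d])
    finally have "Theta r ` f ` toral_component q v d = Theta r ` toral_component r frag_of d" .
    moreover have "inj_on (Theta r) (carrier (quantum_torus r))"
      using algebra_isoD(1)[OF tgt.Theta_iso] by (simp add: bij_betw_def)
    moreover have "f ` toral_component q v d \<subseteq> carrier (quantum_torus r)"
      using src.toral_component_carrier algebra_isoD(2)[OF f] by blast
    ultimately show ?thesis
      using inj_on_image_eq_iff[of "Theta r" "carrier (quantum_torus r)" "f ` toral_component q v d"
          "toral_component r frag_of d"] tgt.toral_component_carrier by blast
  qed
  show ?thesis
    unfolding graded_iso_inv_def src.dim tgt.dim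
    by (intro conjI refl bexI[of _ f] exI[of _ v] exI[of _ frag_of] ballI f f\<tau> comp basis Lambda_basis_frag_of)
qed

lemma graded_iso_inv_imp_iso_inv: "graded_iso_inv q \<tau> r \<rho> \<Longrightarrow> iso_inv q \<tau> r \<rho>"
  by (auto simp: graded_iso_inv_def iso_inv_def)

text \<open>Both relations reduce to the same condition on forms, because an isomorphism respects
  the lines spanned by monomials without being assumed to.\<close>

theorem iso_iff_forms_equiv:
  fixes q r :: "'f::field mat"
  assumes "elementary_quantum_matrix n q" "elementary_quantum_matrix n r"
    and "CHAR('f) \<noteq> 2" "has_type q a \<tau>" "has_type r a' \<rho>"
  shows "iso_inv q \<tau> r \<rho> \<longleftrightarrow> forms_equiv n (qform q a) (qform r a')"
    and "graded_iso_inv q \<tau> r \<rho> \<longleftrightarrow> forms_equiv n (qform q a) (qform r a')"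
  using iso_inv_imp_forms_equiv[OF assms] forms_equiv_imp_graded_iso_inv[OF assms(1,2,4,5)]
    graded_iso_inv_imp_iso_inv by blast+

section \<open>Classification of quadratic forms modulo 2\<close>

text \<open>All base changes below, apart from permutations, are of this kind: multiples of the
  vectors with index in $K$ are added to the other vectors.\<close>

lemma Lambda_basis_shear:
  assumes v: "Lambda_basis n v" and K: "K \<subseteq> {..<n}"
    and wK: "\<And>j. j \<in> K \<Longrightarrow> w j = v j"
    and w: "\<And>i. i < n \<Longrightarrow> i \<notin> K \<Longrightarrow> w i = v i + (\<Sum>j\<in>K. frag_cmul (c i j) (v j))"
  shows "Lambda_basis n w"
proof -
  have fin: "finite K" using K finite_subset by blast
  let ?J = "{..<n} - K"
  define T where "T \<alpha> j = (if j \<in> K then \<alpha> j + (\<Sum>i\<in>?J. \<alpha> i * c i j) else \<alpha> j)" for \<alpha> :: "nat \<Rightarrow> int" and j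
  have split: "int_comb n u \<alpha> = (\<Sum>i\<in>?J. frag_cmul (\<alpha> i) (u i)) + (\<Sum>j\<in>K. frag_cmul (\<alpha> j) (u j))" for u \<alpha>
    unfolding int_comb_def using sum.subset_diff[OF K] by blast
  have wT: "int_comb n w \<alpha> = int_comb n v (T \<alpha>)" for \<alpha>
  proof -
    have "(\<Sum>i\<in>?J. frag_cmul (\<alpha> i) (w i))
        = (\<Sum>i\<in>?J. frag_cmul (\<alpha> i) (v i)) + (\<Sum>i\<in>?J. \<Sum>j\<in>K. frag_cmul (\<alpha> i * c i j) (v j))"
      by (simp add: w frag_cmul_distrib2 frag_cmul_sum sum.distrib)
    also have "(\<Sum>i\<in>?J. \<Sum>j\<in>K. frag_cmul (\<alpha> i * c i j) (v j)) = (\<Sum>j\<in>K. frag_cmul (\<Sum>i\<in>?J. \<alpha> i * c i j) (v j))"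
    proof -
      have "frag_cmul (sum g A) x = (\<Sum>i\<in>A. frag_cmul (g i) x)" for g :: "nat \<Rightarrow> int" and A and x :: "nat \<Rightarrow>\<^sub>0 int"
        by (induction A rule: infinite_finite_induct) (simp_all add: frag_cmul_distrib)
      then show ?thesis by (simp add: sum.swap[of _ K])
    qed
    finally show ?thesis
      by (simp add: split wK T_def frag_cmul_distrib sum.distrib add_ac)
  qed
  have "w i \<in> Lambda n" if "i < n" for i
  proof (cases "i \<in> K")
    case False
    have "v j \<in> Lambda n" if "j < n" for j
      using v that by (simp add: Lambda_basis_def)
    then show ?thesis
      using False that K by (auto simp: w intro!: Lambda_sum)
  qed (use v that in \<open>simp add: wK Lambda_basis_def\<close>)
  moreover have "\<exists>\<alpha>. d = int_comb n w \<alpha>" if "d \<in> Lambda n" for d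
  proof -
    have "\<exists>\<beta>. d = int_comb n v \<beta>" using v that by (simp add: Lambda_basis_def)
    then obtain \<beta> where \<beta>: "d = int_comb n v \<beta>" by blast
    let ?\<alpha> = "\<lambda>j. if j \<in> K then \<beta> j - (\<Sum>i\<in>?J. \<beta> i * c i j) else \<beta> j"
    have "T ?\<alpha> = \<beta>" by (auto simp: T_def fun_eq_iff)
    then have "d = int_comb n w ?\<alpha>" using \<beta> wT[of ?\<alpha>] by simp
    then show ?thesis by blast
  qed
  moreover have "\<alpha> i = 0" if \<alpha>: "int_comb n w \<alpha> = 0" and i: "i < n" for \<alpha> i
  proof -
    have T0: "T \<alpha> i = 0" if "i < n" for i
      using v \<alpha> that by (simp add: wT Lambda_basis_def)
    have J: "\<alpha> i = 0" if "i \<in> ?J" for i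
      using T0[of i] that by (simp add: T_def)
    then show ?thesis
      using T0[OF i] i by (cases "i \<in> K") (auto simp: T_def)
  qed
  ultimately show ?thesis by (auto simp: Lambda_basis_def)
qed

lemma Lambda_basis_permute:
  assumes v: "Lambda_basis n v" and \<pi>: "bij_betw \<pi> {..<n} {..<n}"
  shows "Lambda_basis n (v \<circ> \<pi>)"
proof -
  let ?p = "inv_into {..<n} \<pi>"
  have p: "?p (\<pi> i) = i" "\<pi> (?p i) = i" "?p i < n" "\<pi> i < n" if "i < n" for i
    using that bij_betw_inv_into_left[OF \<pi>, of i] bij_betw_inv_into_right[OF \<pi>, of i]
      bij_betw_apply[OF bij_betw_inv_into[OF \<pi>], of i] bij_betw_apply[OF \<pi>, of i] by auto
  have w: "int_comb n (v \<circ> \<pi>) \<alpha> = int_comb n v (\<alpha> \<circ> ?p)" for \<alpha>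
    unfolding int_comb_def sum.reindex_bij_betw[OF \<pi>, symmetric, of "\<lambda>i. frag_cmul ((\<alpha> \<circ> ?p) i) (v i)"]
    by (rule sum.cong) (use p in auto)
  have "\<exists>\<alpha>. d = int_comb n (v \<circ> \<pi>) \<alpha>" if "d \<in> Lambda n" for d
  proof -
    have "\<exists>\<beta>. d = int_comb n v \<beta>" using v that by (simp add: Lambda_basis_def)
    then obtain \<beta> where "d = int_comb n v \<beta>" by blast
    also have "\<dots> = int_comb n v ((\<beta> \<circ> \<pi>) \<circ> ?p)"
      by (rule int_comb_cong) (use p in simp)
    finally show ?thesis using w by metis
  qed
  moreover have "\<alpha> i = 0" if "int_comb n (v \<circ> \<pi>) \<alpha> = 0" and i: "i < n" for \<alpha> i
  proof -
    have "(\<alpha> \<circ> ?p) (\<pi> i) = 0"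
      using v that(1) p(4)[OF i] unfolding w Lambda_basis_def by blast
    then show ?thesis using p(1)[OF i] by simp
  qed
  moreover have "(v \<circ> \<pi>) i \<in> Lambda n" if "i < n" for i
    using v p(4)[OF that] by (simp add: Lambda_basis_def)
  ultimately show ?thesis by (auto simp: Lambda_basis_def)
qed

text \<open>The pairing of indices in the blocks of $\mathbf h_{l,n}$, written as an involution.
  It replaces the case distinctions needed when the positions of the blocks are used.\<close>

definition partner :: "nat \<Rightarrow> nat" where
  "partner i = (if even i then i + 1 else i - 1)"

lemma partner_simps [simp]:
  "partner (partner i) = i" "partner i \<noteq> i" "i \<noteq> partner i" "partner i < 2 * l \<longleftrightarrow> i < 2 * l"
  "partner (2 * k) = Suc (2 * k)" "partner (Suc (2 * k)) = 2 * k"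
  unfolding partner_def by (auto elim!: evenE oddE)

lemma partner_eq_iff: "j = partner i \<longleftrightarrow> i \<noteq> j \<and> i div 2 = j div 2"
  unfolding partner_def by (auto elim!: evenE oddE)

lemma partner_eq_swap: "partner i = j \<longleftrightarrow> i = partner j"
  by auto

text \<open>An integer-valued lift of a quadratic form modulo 2 together with its polar form.
  Exact identities over the integers let parities be computed by the simplifier.\<close>

locale quadratic_form =
  fixes Q :: "(nat \<Rightarrow>\<^sub>0 int) \<Rightarrow> int" and P :: "(nat \<Rightarrow>\<^sub>0 int) \<Rightarrow> (nat \<Rightarrow>\<^sub>0 int) \<Rightarrow> int"
  assumes Q_add: "Q (x + y) = Q x + Q y + P x y"
    and P_add_left: "P (x + x') y = P x y + P x' y"
    and P_sym: "P x y = P y x"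
    and P_self: "even (P x x)"
begin

lemma P_add_right: "P x (y + y') = P x y + P x y'"
  using P_add_left P_sym by metis

lemmas parity_simps = Q_add P_add_left P_add_right P_self

lemma P_zero [simp]: "P 0 y = 0" "P x 0 = 0"
  using P_add_left[of 0 0 y] P_add_right[of x 0 0] by simp_all

text \<open>A basis whose first $2k$ vectors form $k$ hyperbolic pairs of the polar form,
  orthogonal to each other and to all the other vectors.\<close>

definition symplectic_upto :: "nat \<Rightarrow> nat \<Rightarrow> (nat \<Rightarrow> nat \<Rightarrow>\<^sub>0 int) \<Rightarrow> bool" where
  "symplectic_upto n k v \<longleftrightarrow> Lambda_basis n v \<and> 2 * k \<le> n \<and>
     (\<forall>i<2*k. \<forall>j<n. i \<noteq> j \<longrightarrow> odd (P (v i) (v j)) = (j = partner i))"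

text \<open>Two vectors outside the existing pairs that are not orthogonal are moved to the
  positions $2k$ and $2k+1$, and every other vector is made orthogonal to both by adding
  combinations of the two.\<close>

lemma symplectic_upto_extend:
  assumes v: "symplectic_upto n k v"
    and ij: "2 * k \<le> i" "i < n" "2 * k \<le> j" "j < n" "odd (P (v i) (v j))"
  shows "\<exists>w. symplectic_upto n (Suc k) w"
proof -
  have "i \<noteq> j" using ij P_self by auto
  \<comment> \<open>The inner transposition takes into account that the outer one may move \<open>j\<close>.\<close>
  define \<pi> where "\<pi> = transpose i (2 * k) \<circ> transpose (transpose i (2 * k) j) (Suc (2 * k))"
  have n: "2 * k + 2 \<le> n" using ij \<open>i \<noteq> j\<close> by linarith
  have \<pi>: "\<pi> (2 * k) = i" "\<pi> (Suc (2 * k)) = j" "\<And>m. m < 2 * k \<Longrightarrow> \<pi> m = m"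
    using ij \<open>i \<noteq> j\<close> by (auto simp: \<pi>_def transpose_def)
  have "bij_betw \<pi> {..<n} {..<n}"
  proof -
    have t: "bij_betw (transpose a b) {..<n} {..<n}" if "a < n" "b < n" for a b
      by (rule bij_betw_byWitness[where f' = "transpose a b"]) (use that in \<open>auto simp: transpose_def\<close>)
    show ?thesis
      unfolding \<pi>_def by (rule bij_betw_trans[OF t t]) (use n ij in \<open>auto simp: transpose_def\<close>)
  qed
  note u_basis = Lambda_basis_permute[OF _ this]
  define u where "u = v \<circ> \<pi>"
  have u_bas: "Lambda_basis n u"
    unfolding u_def using v by (intro u_basis) (simp add: symplectic_upto_def)
  have \<pi>n: "\<pi> m < n" if "m < n" for m
    using that \<open>bij_betw \<pi> {..<n} {..<n}\<close> bij_betw_apply by fastforce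
  have \<pi>_inj: "\<pi> a = \<pi> b \<longleftrightarrow> a = b" if "a < n" "b < n" for a b
    using \<open>bij_betw \<pi> {..<n} {..<n}\<close> that by (auto simp: bij_betw_def inj_on_def)
  have u_pair: "odd (P (u a) (u b)) = (b = partner a)" if "a < 2 * k" "b < n" "a \<noteq> b" for a b
  proof -
    have "odd (P (v a) (v (\<pi> b))) = (\<pi> b = partner a)"
      using v that \<pi>n[of b] \<pi>(3)[of a] \<pi>_inj[of a b] n by (auto simp: symplectic_upto_def)
    moreover have "partner a < n"
      using partner_simps(4)[of a k] that(1) n by linarith
    then have "\<pi> b = partner a \<longleftrightarrow> b = partner a"
      using \<pi>(3)[of "partner a"] \<pi>_inj[of b "partner a"] that(1,2) by simp
    ultimately show ?thesis
      using that \<pi>(3)[of a] by (simp add: u_def)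
  qed
  let ?x = "u (2 * k)" and ?y = "u (Suc (2 * k))"
  have xy: "odd (P ?x ?y)"
    using ij \<pi> by (simp add: u_def)
  let ?K = "{2 * k, Suc (2 * k)}"
  define c where "c a = (if odd (P (u a) ?y) then ?x else 0) + (if odd (P (u a) ?x) then ?y else 0)" for a
  define w where "w a = (if a \<in> ?K then u a else u a + c a)" for a
  have "Lambda_basis n w"
    by (rule Lambda_basis_shear[OF u_bas, of ?K w
          "\<lambda>a b. if b = 2 * k then of_bool (odd (P (u a) ?y)) else of_bool (odd (P (u a) ?x))"])
      (use n in \<open>auto simp: w_def c_def\<close>)
  moreover have "odd (P (w a) (w b)) = (b = partner a)" if a: "a < 2 * Suc k" and b: "b < n" "a \<noteq> b" for a b
  proof -
    have cx: "c a = 0" if "a < 2 * k" for a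
      using u_pair[of a "2 * k"] u_pair[of a "Suc (2 * k)"] that n by (auto simp: c_def partner_eq_iff)
    have px: "even (P (u a + c a) ?x)" "even (P (u a + c a) ?y)" for a
      using xy P_sym[of ?x ?y] by (auto simp: c_def parity_simps)
    show ?thesis
    proof (cases "a < 2 * k")
      case True
      have "even (P (u a) ?x)" "even (P (u a) ?y)"
        using u_pair[of a "2 * k"] u_pair[of a "Suc (2 * k)"] True n by (auto simp: partner_eq_iff)
      then have "even (P (u a) (c b))"
        by (auto simp: c_def parity_simps)
      then show ?thesis
        using u_pair[OF True b] cx[OF True] True by (auto simp: w_def parity_simps)
    next
      case False
      then have "a = 2 * k \<or> a = Suc (2 * k)" using a by arith
      then consider "a = 2 * k" | "a = Suc (2 * k)" by blast
      then show ?thesis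
      proof cases
        case 1
        then show ?thesis
          using xy b px(1)[of b] P_sym[of "?x"] by (auto simp: w_def)
      next
        case 2
        then show ?thesis
          using xy b px(2)[of b] P_sym[of "?y"] by (auto simp: w_def)
      qed
    qed
  qed
  ultimately have "symplectic_upto n (Suc k) w"
    using n by (simp add: symplectic_upto_def)
  then show ?thesis by blast
qed

definition symplectic_basis :: "nat \<Rightarrow> nat \<Rightarrow> (nat \<Rightarrow> nat \<Rightarrow>\<^sub>0 int) \<Rightarrow> bool" where
  "symplectic_basis n l v \<longleftrightarrow> Lambda_basis n v \<and> 2 * l \<le> n \<and>
     (\<forall>i<n. \<forall>j<n. i \<noteq> j \<longrightarrow> odd (P (v i) (v j)) = (i < 2 * l \<and> j = partner i))"

text \<open>Take the largest possible number of pairs; by maximality the vectors outside them are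
  mutually orthogonal.\<close>

lemma symplectic_basis_exists: "\<exists>l v. symplectic_basis n l v"
proof -
  let ?R = "\<lambda>k. \<exists>v. symplectic_upto n k v"
  have "?R 0"
    using Lambda_basis_frag_of by (auto simp: symplectic_upto_def)
  moreover have "k \<le> n" if "?R k" for k
    using that by (auto simp: symplectic_upto_def)
  ultimately obtain l where "?R l" and max: "\<And>k. ?R k \<Longrightarrow> k \<le> l"
    using Nat.ex_has_greatest_nat[of ?R 0 n] by blast
  then obtain v where v: "symplectic_upto n l v" by blast
  have "even (P (v i) (v j))" if "2 * l \<le> i" "i < n" "2 * l \<le> j" "j < n" for i j
    using symplectic_upto_extend[OF v that] max[of "Suc l"] by auto
  moreover have "odd (P (v i) (v j)) = (j = partner i)" if "i < 2 * l" "j < n" "i \<noteq> j" for i j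
    using v that by (simp add: symplectic_upto_def)
  moreover have "odd (P (v i) (v j)) = (j = partner i)" if "j < 2 * l" "i < n" "i \<noteq> j" for i j
    using v that P_sym[of "v i" "v j"] by (auto simp: symplectic_upto_def)
  moreover have "\<not> j = partner i" if "j < 2 * l" "2 * l \<le> i" for i j
    using that partner_simps(4)[of i l] by auto
  ultimately have "symplectic_basis n l v"
    using v unfolding symplectic_basis_def symplectic_upto_def by (metis not_less)
  then show ?thesis by blast
qed

definition odd_set :: "nat \<Rightarrow> (nat \<Rightarrow> nat \<Rightarrow>\<^sub>0 int) \<Rightarrow> nat set" where
  "odd_set n v = {i. i < n \<and> odd (Q (v i))}"

text \<open>If $Q(x)$ is odd, $Q(y)$ is even and $P(x,y)$ is odd, then $Q(x+y)$ is even.\<close>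

lemma symplectic_basis_split_pair:
  assumes v: "symplectic_basis n l v" and i: "i < 2 * l" "i \<in> odd_set n v" "partner i \<notin> odd_set n v"
  shows "\<exists>w. symplectic_basis n l w \<and> odd_set n w = odd_set n v - {i}"
proof -
  let ?p = "partner i"
  define w where "w a = (if a = i then v i + v ?p else v a)" for a
  have n: "2 * l \<le> n" and P: "\<And>a b. a < n \<Longrightarrow> b < n \<Longrightarrow> a \<noteq> b \<Longrightarrow> odd (P (v a) (v b)) = (a < 2 * l \<and> b = partner a)"
    using v by (simp_all add: symplectic_basis_def)
  have p: "?p < 2 * l" "?p < n" "i < n" using i n partner_simps(4)[of i l] by linarith+
  have "Lambda_basis n w"
    by (rule Lambda_basis_shear[of n v "{?p}" w "\<lambda>a b. of_bool (a = i)"])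
      (use v p in \<open>auto simp: w_def symplectic_basis_def\<close>)
  moreover have "odd (P (w a) (w b)) = (a < 2 * l \<and> b = partner a)" if ab: "a < n" "b < n" "a \<noteq> b" for a b
  proof -
    have *: "odd (P (w i) (w b)) = (b = ?p)" if "b < n" "b \<noteq> i" for b
    proof (cases "b = ?p")
      case True
      then show ?thesis using P[of i ?p] p by (simp add: w_def parity_simps)
    next
      case False
      then have "even (P (v i) (v b))" "even (P (v ?p) (v b))"
        using P[of i b] P[of ?p b] p that by auto
      with False that show ?thesis by (simp add: w_def parity_simps)
    qed
    consider "a = i" | "b = i" "a \<noteq> i" | "a \<noteq> i" "b \<noteq> i" by blast
    then show ?thesis
    proof cases
      case 1
      then show ?thesis using *[of b] ab i by simp
    next
      case 2
      then have "odd (P (w a) (w b)) = (a = ?p)"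
        using *[of a] ab P_sym[of "w a"] by simp
      then show ?thesis using 2 p by auto
    next
      case 3
      then show ?thesis using P[OF ab] by (simp add: w_def)
    qed
  qed
  moreover have "odd_set n w = odd_set n v - {i}"
    using i P[of i ?p] p by (auto simp: odd_set_def w_def parity_simps)
  ultimately show ?thesis
    using n unfolding symplectic_basis_def by blast
qed

text \<open>Two pairs $(x,y)$ and $(x',y')$ on which $Q$ is odd: replacing $x$ by $x+x'$ and $y'$
  by $y'+y$ keeps the polar form, and both new vectors have even value. This is the relation
  behind the Arf invariant: two anisotropic planes are isometric to two hyperbolic ones.\<close>

lemma symplectic_basis_cancel_pairs:
  assumes v: "symplectic_basis n l v" and i: "i < 2 * l" "i \<in> odd_set n v" "partner i \<in> odd_set n v"
    and j: "j < 2 * l" "j \<in> odd_set n v" "partner j \<in> odd_set n v" "j \<noteq> i" "j \<noteq> partner i"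
  shows "\<exists>w. symplectic_basis n l w \<and> odd_set n w = odd_set n v - {i, partner j}"
proof -
  let ?p = "partner i" and ?r = "partner j"
  define w where "w a = (if a = i then v i + v j else if a = ?r then v ?r + v ?p else v a)" for a
  have n: "2 * l \<le> n" and P: "\<And>a b. a < n \<Longrightarrow> b < n \<Longrightarrow> a \<noteq> b \<Longrightarrow> odd (P (v a) (v b)) = (a < 2 * l \<and> b = partner a)"
    using v by (simp_all add: symplectic_basis_def)
  have p: "?p < n" "i < n" "?r < n" "j < n" "?p < 2 * l" "?r < 2 * l"
    using i j n partner_simps(4)[of i l] partner_simps(4)[of j l] by linarith+
  have ne: "i \<noteq> ?r" "?p \<noteq> ?r" "?p \<noteq> j" "i \<noteq> j"
    using j by (auto simp: partner_eq_swap)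
  have vb: "Lambda_basis n v" using v by (simp add: symplectic_basis_def)
  have K: "{?p, j} \<subseteq> {..<n}" using p(1,4) by simp
  have "Lambda_basis n w"
    by (rule Lambda_basis_shear[OF vb K, of w
          "\<lambda>a b. of_bool (a = i \<and> b = j \<or> a = ?r \<and> b = ?p)"])
      (use ne in \<open>auto simp: w_def\<close>)
  moreover have "odd (P (w a) (w b)) = (a < 2 * l \<and> b = partner a)" if ab: "a < n" "b < n" "a \<noteq> b" for a b
  proof -
    have sym: "odd (P (v a) (v b)) = odd (P (v b) (v a))" for a b
      using P_sym[of "v a"] by simp
    note facts = P[of i ?p] P[of i ?r] P[of i j] P[of j ?r] P[of j ?p] P[of ?p ?r]
    have *: "odd (P (w i) (w b)) = (b = partner i)" if "b < n" "b \<noteq> i" for b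
      using that P[of i b] P[of j b] facts p ne i j sym[of ?p j] sym[of ?p ?r] sym[of ?r i]
      by (cases "b = ?r"; cases "b = j") (auto simp: w_def parity_simps partner_eq_swap)
    have **: "odd (P (w ?r) (w b)) = (b = j)" if b: "b < n" "b \<noteq> i" "b \<noteq> ?r" for b
    proof -
      have "odd (P (v ?r) (v b)) = (b = j)"
        using P[of ?r b] b p by simp
      moreover have "even (P (v ?p) (v b))"
        using P[of ?p b] P_self[of "v ?p"] b p by (cases "b = ?p") auto
      ultimately show ?thesis
        using b ne by (simp add: w_def parity_simps)
    qed
    have symw: "odd (P (w a) (w b)) = odd (P (w b) (w a))" for a b
      using P_sym[of "w a"] by simp
    consider "a = i" | "b = i" "a \<noteq> i" | "a = ?r" "b \<noteq> i" "a \<noteq> i" | "b = ?r" "a \<noteq> i" "b \<noteq> i" "a \<noteq> ?r"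
      | "a \<noteq> i" "b \<noteq> i" "a \<noteq> ?r" "b \<noteq> ?r" by blast
    then show ?thesis
    proof cases
      case 1
      then show ?thesis using *[of b] ab i by auto
    next
      case 2
      then show ?thesis using *[of a] symw[of a i] ab i p by (auto simp: partner_eq_swap)
    next
      case 3
      then show ?thesis using **[of b] ab p by auto
    next
      case 4
      then show ?thesis using **[of a] symw[of a ?r] ab p j by (auto simp: partner_eq_swap)
    next
      case 5
      then show ?thesis using P[OF ab] by (simp add: w_def)
    qed
  qed
  moreover have "odd_set n w = odd_set n v - {i, ?r}"
    using i j P[of i j] P[of ?r ?p] p ne by (auto simp: odd_set_def w_def parity_simps partner_eq_swap)
  ultimately show ?thesis
    using n unfolding symplectic_basis_def by blast
qed

text \<open>A basis with the least number of odd values is taken. If the odd values include one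
  outside the pairs, that vector is moved to position $2l$ and added to all the others of odd
  value, which does not disturb the polar form. Otherwise minimality excludes a pair with exactly
  one odd value and two pairs with odd values, so that one whole pair at most has odd values; it
  is then moved to the last place.\<close>

theorem quadratic_form_classification:
  "\<exists>l v. symplectic_basis n l v \<and>
     (odd_set n v = {} \<or> (2 * l < n \<and> odd_set n v = {2 * l}) \<or>
      (1 \<le> l \<and> odd_set n v = {2 * l - 2, 2 * l - 1}))"
proof -
  obtain l where "\<exists>v. symplectic_basis n l v"
    using symplectic_basis_exists by blast
  then obtain v where v: "symplectic_basis n l v"
    and min: "\<And>w. symplectic_basis n l w \<Longrightarrow> card (odd_set n v) \<le> card (odd_set n w)"
    using ex_has_least_nat[of "symplectic_basis n l" _ "\<lambda>v. card (odd_set n v)"] by blast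
  let ?O = "odd_set n v"
  have n: "2 * l \<le> n" and P: "\<And>a b. a < n \<Longrightarrow> b < n \<Longrightarrow> a \<noteq> b \<Longrightarrow> odd (P (v a) (v b)) = (a < 2 * l \<and> b = partner a)"
    and vb: "Lambda_basis n v"
    using v by (simp_all add: symplectic_basis_def)
  have fin: "finite ?O" by (simp add: odd_set_def)
  have swap: "symplectic_basis n l (v \<circ> \<pi>) \<and> odd_set n (v \<circ> \<pi>) = {i. i < n \<and> \<pi> i \<in> ?O}"
    if \<pi>: "bij_betw \<pi> {..<n} {..<n}" "\<And>i. i < n \<Longrightarrow> \<pi> i < 2 * l \<longleftrightarrow> i < 2 * l"
      "\<And>i. i < 2 * l \<Longrightarrow> \<pi> (partner i) = partner (\<pi> i)" for \<pi>
  proof -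
    have \<pi>n: "\<pi> i < n" if "i < n" for i using \<pi>(1) that bij_betw_apply by fastforce
    have inj: "\<pi> a = \<pi> b \<longleftrightarrow> a = b" if "a < n" "b < n" for a b
      using \<pi>(1) that by (auto simp: bij_betw_def inj_on_def)
    have "odd (P (v (\<pi> a)) (v (\<pi> b))) = (a < 2 * l \<and> b = partner a)" if "a < n" "b < n" "a \<noteq> b" for a b
    proof (cases "a < 2 * l")
      case True
      then have "partner a < n" using n partner_simps(4)[of a l] by linarith
      then show ?thesis
        using P[of "\<pi> a" "\<pi> b"] \<pi>n inj[of a b] inj[of b "partner a"] \<pi>(2)[of a] \<pi>(3)[of a] that True by auto
    next
      case False
      then show ?thesis
        using P[of "\<pi> a" "\<pi> b"] \<pi>n inj[of a b] \<pi>(2)[of a] that by auto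
    qed
    moreover have "odd_set n (v \<circ> \<pi>) = {i. i < n \<and> \<pi> i \<in> ?O}"
      using \<pi>n by (auto simp: odd_set_def)
    ultimately show ?thesis
      using Lambda_basis_permute[OF vb \<pi>(1)] n by (simp add: symplectic_basis_def)
  qed
  have t: "bij_betw (transpose a b) {..<n} {..<n}" if "a < n" "b < n" for a b
    by (rule bij_betw_byWitness[where f' = "transpose a b"]) (use that in \<open>auto simp: transpose_def\<close>)
  show ?thesis
  proof (cases "\<exists>r\<in>?O. 2 * l \<le> r")
    case True
    then obtain r where r: "2 * l \<le> r" "r \<in> ?O" by blast
    then have rn: "r < n" by (simp add: odd_set_def)
    define u where "u = v \<circ> transpose r (2 * l)"
    have "symplectic_basis n l u \<and> odd_set n u = {i. i < n \<and> transpose r (2 * l) i \<in> ?O}"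
      unfolding u_def
    proof (rule swap)
      show "bij_betw (transpose r (2 * l)) {..<n} {..<n}"
        using t r rn by simp
      show "transpose r (2 * l) i < 2 * l \<longleftrightarrow> i < 2 * l" for i
        using r by (auto simp: transpose_def)
      show "transpose r (2 * l) (partner i) = partner (transpose r (2 * l) i)" if "i < 2 * l" for i
      proof -
        have "partner i < 2 * l" using that by simp
        then have "partner i \<noteq> r" "partner i \<noteq> 2 * l" "i \<noteq> r" "i \<noteq> 2 * l"
          using r(1) that by linarith+
        then show ?thesis by (simp add: transpose_def)
      qed
    qed
    then have u: "symplectic_basis n l u" and uO: "2 * l \<in> odd_set n u"
      using r rn by auto
    define w where "w a = (if a \<noteq> 2 * l \<and> odd (Q (u a)) then u a + u (2 * l) else u a)" for a
    have "Lambda_basis n w"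
      by (rule Lambda_basis_shear[of n u "{2 * l}" w "\<lambda>a b. of_bool (odd (Q (u a)))"])
        (use u r rn in \<open>auto simp: w_def symplectic_basis_def\<close>)
    moreover have rad: "even (P (u (2 * l)) (u a))" "even (P (u a) (u (2 * l)))" if "a < n" for a
    proof -
      have "odd (P (u (2 * l)) (u a)) = (2 * l < 2 * l \<and> a = partner (2 * l))" if "a \<noteq> 2 * l"
        using u that \<open>a < n\<close> r rn unfolding symplectic_basis_def by (metis le_less_trans)
      then show "even (P (u (2 * l)) (u a))"
        using P_self by (cases "a = 2 * l") auto
      then show "even (P (u a) (u (2 * l)))"
        by (subst P_sym)
    qed
    have "odd (P (w a) (w b)) = odd (P (u a) (u b))" if "a < n" "b < n" for a b
      using rad(1)[OF that(2)] rad(2)[OF that(1)] P_self[of "u (2 * l)"]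
      by (simp add: w_def P_add_left P_add_right)
    moreover have "odd_set n w = {2 * l}"
      using uO rad r rn by (auto simp: odd_set_def w_def parity_simps)
    ultimately have "symplectic_basis n l w \<and> 2 * l < n \<and> odd_set n w = {2 * l}"
      using u r rn by (auto simp: symplectic_basis_def)
    then show ?thesis by blast
  next
    case False
    then have small: "i < 2 * l" if "i \<in> ?O" for i
      using that by (meson not_less)
    have less: "card A < card ?O" if "A \<subset> ?O" for A
      using psubset_card_mono[OF fin that] .
    have pair: "partner i \<in> ?O" if i: "i \<in> ?O" for i
    proof (rule ccontr)
      assume "partner i \<notin> ?O"
      then obtain w where w: "symplectic_basis n l w" "odd_set n w = ?O - {i}"
        using symplectic_basis_split_pair[OF v small[OF i] i] by blast
      have "card (?O - {i}) < card ?O"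
        by (rule less) (use i in blast)
      then show False
        using min[OF w(1)] unfolding w(2) by linarith
    qed
    have single: "j = i \<or> j = partner i" if ij: "i \<in> ?O" "j \<in> ?O" for i j
    proof (rule ccontr)
      assume "\<not> (j = i \<or> j = partner i)"
      then obtain w where w: "symplectic_basis n l w" "odd_set n w = ?O - {i, partner j}"
        using symplectic_basis_cancel_pairs[OF v small[OF ij(1)] ij(1) pair[OF ij(1)]
            small[OF ij(2)] ij(2) pair[OF ij(2)]] by blast
      have "card (?O - {i, partner j}) < card ?O"
        by (rule less) (use ij in blast)
      then show False
        using min[OF w(1)] unfolding w(2) by linarith
    qed
    show ?thesis
    proof (cases "?O = {}")
      case True
      then show ?thesis using v by blast
    next
      case False
      then obtain i where i: "i \<in> ?O" by blast
      define k where "k = i div 2"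
      have O: "?O = {2 * k, Suc (2 * k)}"
        using single[OF i] pair[OF i] i unfolding k_def partner_def
        by (auto elim!: evenE oddE split: if_splits)
      have l: "1 \<le> l" "k < l" using small[OF i] by (auto simp: k_def)
      \<comment> \<open>The pairs with numbers \<open>k\<close> and \<open>l - 1\<close> are exchanged as wholes, so partners stay partners.\<close>
      define \<pi> where "\<pi> m = 2 * transpose (l - 1) k (m div 2) + m mod 2" for m
      have \<pi>\<pi>: "\<pi> (\<pi> m) = m" for m
        by (simp add: \<pi>_def)
      have \<pi>l: "\<pi> m < 2 * l \<longleftrightarrow> m < 2 * l" for m
      proof -
        have "transpose (l - 1) k (m div 2) < l \<longleftrightarrow> m div 2 < l"
          using l by (auto simp: transpose_def)
        then show ?thesis unfolding \<pi>_def by linarith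
      qed
      have \<pi>n: "\<pi> m < n" if "m < n" for m
      proof (cases "m < 2 * l")
        case True
        then show ?thesis using \<pi>l n by (meson less_le_trans)
      next
        case False
        then have "m div 2 \<noteq> l - 1" "m div 2 \<noteq> k" using l by linarith+
        then show ?thesis using that by (simp add: \<pi>_def)
      qed
      have "bij_betw \<pi> {..<n} {..<n}"
        by (rule bij_betw_byWitness[where f' = \<pi>]) (use \<pi>\<pi> \<pi>n in auto)
      moreover have "\<pi> (partner m) = partner (\<pi> m)" for m
      proof -
        have "partner (2 * x + m mod 2) = 2 * x + (1 - m mod 2)" for x
          by (cases "even m") (auto simp: partner_def odd_iff_mod_2_eq_one even_iff_mod_2_eq_zero)
        moreover have "partner m div 2 = m div 2" "partner m mod 2 = 1 - m mod 2"
          unfolding partner_def by (auto elim!: evenE oddE)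
        ultimately show ?thesis by (simp add: \<pi>_def)
      qed
      ultimately have "symplectic_basis n l (v \<circ> \<pi>)"
        and O\<pi>: "odd_set n (v \<circ> \<pi>) = {m. m < n \<and> \<pi> m \<in> {2 * k, Suc (2 * k)}}"
        using swap[of \<pi>] \<pi>l O by auto
      moreover have "\<pi> m \<in> {2 * k, Suc (2 * k)} \<longleftrightarrow> m \<in> {2 * l - 2, 2 * l - 1}" for m
      proof -
        have "\<pi> m \<in> {2 * k, Suc (2 * k)} \<longleftrightarrow> transpose (l - 1) k (m div 2) = k"
          unfolding \<pi>_def by auto
        also have "\<dots> \<longleftrightarrow> m div 2 = l - 1"
          by (auto simp: transpose_def)
        also have "\<dots> \<longleftrightarrow> m \<in> {2 * l - 2, 2 * l - 1}"
          using l by auto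
        finally show ?thesis .
      qed
      moreover have "{m. m < n \<and> m \<in> {2 * l - 2, 2 * l - 1}} = {2 * l - 2, 2 * l - 1}"
        using l n by auto
      ultimately have "symplectic_basis n l (v \<circ> \<pi>) \<and> odd_set n (v \<circ> \<pi>) = {2 * l - 2, 2 * l - 1}"
        by simp
      then show ?thesis using l by blast
    qed
  qed
qed

end

definition polar :: "'f::field mat \<Rightarrow> (nat \<Rightarrow>\<^sub>0 int) \<Rightarrow> (nat \<Rightarrow>\<^sub>0 int) \<Rightarrow> int" where
  "polar q x y = bform q x y + bform q y x"

lemma quadratic_form_qform: "quadratic_form (qform q a) (polar q)"
  by unfold_locales (simp_all add: polar_def qform_add bform_add)

lemma polar_frag_of:
  assumes q: "elementary_quantum_matrix n q" and ij: "i < n" "j < n" "i \<noteq> j"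
  shows "polar q (frag_of i) (frag_of j) = eexp q i j"
  using ij elementary_dim[OF q] elementary_eexp[OF q ij(1,2)]
  by (simp add: polar_def bform_frag_of)

text \<open>Modulo 2 a quadratic form is determined by its values and the values of its polar form
  on a basis: the polar forms agree by biadditivity, and then the set of vectors on which the two
  forms agree is closed under differences.\<close>

lemma forms_equivI:
  assumes q: "quadratic_form Q P" and q': "quadratic_form Q' P'" and v: "Lambda_basis n v"
    and Q: "\<And>i. i < n \<Longrightarrow> even (Q' (v i)) = even (Q (frag_of i))"
    and P: "\<And>i j. i < n \<Longrightarrow> j < n \<Longrightarrow> i \<noteq> j \<Longrightarrow> even (P' (v i) (v j)) = even (P (frag_of i) (frag_of j))"
  shows "forms_equiv n Q Q'"
proof -
  interpret A: quadratic_form Q P by (rule q)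
  interpret B: quadratic_form Q' P' by (rule q')
  let ?M = "frag_extend v"
  define D where "D x y = P x y + P' (?M x) (?M y)" for x y
  have D_add: "D (x + x') y = D x y + D x' y" "D x (y + y') = D x y + D x y'" for x x' y y'
    by (simp_all add: D_def frag_extend_add A.P_add_left A.P_add_right B.P_add_left B.P_add_right)
  have "even (D (frag_of i) (frag_of j))" if "i < n" "j < n" for i j
    using P[OF that] A.P_self B.P_self by (cases "i = j") (simp_all add: D_def)
  then have D: "even (D x y)" if xy: "x \<in> Lambda n" "y \<in> Lambda n" for x y
  proof -
    have "D x y = (\<Sum>i<n. lookup x i * D (frag_of i) y)"
      by (rule Lambda_additive_expand[where h = "\<lambda>x. D x y"]) (use D_add xy in auto)
    moreover have "D (frag_of i) y = (\<Sum>j<n. lookup y j * D (frag_of i) (frag_of j))" for i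
      by (rule Lambda_additive_expand) (use D_add xy in auto)
    ultimately show ?thesis
      using \<open>\<And>i j. i < n \<Longrightarrow> j < n \<Longrightarrow> even (D (frag_of i) (frag_of j))\<close>
      by (auto intro!: dvd_sum)
  qed
  have "even (Q x) = even (Q' (?M x))" if "x \<in> Lambda n" for x
  proof -
    have "keys x \<subseteq> {..<n}" using that by (simp add: Lambda_iff)
    then have "x \<in> Lambda n \<and> even (Q x) = even (Q' (?M x))"
    proof (induction rule: frag_induction)
      case zero
      have "Q 0 = 0" "Q' 0 = 0" using A.Q_add[of 0 0] B.Q_add[of 0 0] by simp_all
      then show ?case by simp
    next
      case (one i)
      then show ?case using Q by auto
    next
      case (diff x y)
      then have L: "x - y \<in> Lambda n" by auto
      have "Q x = Q (x - y) + Q y + P (x - y) y" "Q' (?M x) = Q' (?M (x - y)) + Q' (?M y) + P' (?M (x - y)) (?M y)"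
        using A.Q_add[of "x - y" y] B.Q_add[of "?M (x - y)" "?M y"] by (simp_all flip: frag_extend_add)
      then show ?case
        using diff L D[OF L, of y] by (auto simp: D_def)
    qed
    then show ?thesis by blast
  qed
  then show ?thesis
    unfolding forms_equiv_def using Lambda_basis_bij[OF v] frag_extend_add by (intro exI[of _ ?M]) auto
qed

section \<open>Invariants of quadratic forms modulo 2\<close>

text \<open>Subsets of $\{0,\dots,n-1\}$ stand for the classes of $\Lambda$ modulo $2\Lambda$,
  with their characteristic vectors as representatives.\<close>

definition ind_vec :: "nat set \<Rightarrow> nat \<Rightarrow>\<^sub>0 int" where
  "ind_vec X = (\<Sum>i\<in>X. frag_of i)"

lemma vec_simps [simp]:
  "ind_vec {} = 0" "finite X \<Longrightarrow> i \<notin> X \<Longrightarrow> ind_vec (insert i X) = ind_vec X + frag_of i"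
  by (simp_all add: ind_vec_def add.commute)

lemma vec_Lambda: "X \<subseteq> {..<n} \<Longrightarrow> ind_vec X \<in> Lambda n"
  unfolding ind_vec_def by (intro Lambda_sum) auto

lemma lookup_vec: "finite X \<Longrightarrow> lookup (ind_vec X) i = of_bool (i \<in> X)"
  by (induction X rule: finite_induct) (auto simp: lookup_add)

definition odd_part :: "nat \<Rightarrow> (nat \<Rightarrow>\<^sub>0 int) \<Rightarrow> nat set" where
  "odd_part n x = {i. i < n \<and> odd (lookup x i)}"

lemma odd_part_decomp:
  assumes "x \<in> Lambda n"
  shows "\<exists>z\<in>Lambda n. x = ind_vec (odd_part n x) + (z + z)"
proof -
  let ?z = "int_comb n frag_of (\<lambda>i. lookup x i div 2)"
  have "x = ind_vec (odd_part n x) + (?z + ?z)"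
  proof (rule poly_mapping_eqI)
    fix k
    have "finite (odd_part n x)" by (simp add: odd_part_def)
    then have "lookup (ind_vec (odd_part n x) + (?z + ?z)) k
        = of_bool (k \<in> odd_part n x) + 2 * (if k < n then lookup x k div 2 else 0)"
      by (simp only: lookup_add lookup_vec lookup_int_comb mult_2)
    also have "\<dots> = lookup x k"
    proof (cases "k < n")
      case True
      have "of_bool (odd a) + 2 * (a div 2) = a" for a :: int
        by (auto elim!: evenE oddE)
      with True show ?thesis by (simp add: odd_part_def)
    next
      case False
      then have "lookup x k = 0"
        using assms by (auto simp: Lambda_iff in_keys_iff)
      with False show ?thesis by (simp add: odd_part_def)
    qed
    finally show "lookup x k = lookup (ind_vec (odd_part n x) + (?z + ?z)) k" ..
  qed
  moreover have "?z \<in> Lambda n"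
    by (rule int_comb_Lambda) auto
  ultimately show ?thesis by blast
qed

context quadratic_form
begin

lemma Q_odd_part: "x \<in> Lambda n \<Longrightarrow> even (Q (ind_vec (odd_part n x))) = even (Q x)"
  using odd_part_decomp[of x n] by (metis (no_types, lifting) Q_add P_add_right P_self even_add)

lemma P_odd_part: "x \<in> Lambda n \<Longrightarrow> even (P (ind_vec (odd_part n x)) y) = even (P x y)"
  using odd_part_decomp[of x n] by (metis (no_types, lifting) P_add_left even_add)

definition radical :: "nat \<Rightarrow> nat set set" where
  "radical n = {X. X \<subseteq> {..<n} \<and> (\<forall>y\<in>Lambda n. even (P (ind_vec X) y))}"

definition gauss_sum :: "nat \<Rightarrow> int" where
  "gauss_sum n = (\<Sum>X\<in>Pow {..<n}. sg (Q (ind_vec X)))"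

end

text \<open>An automorphism of $\Lambda$ permutes the classes modulo $2\Lambda$, and both
  quantities are defined in terms of classes.\<close>

lemma forms_equiv_invariants:
  assumes q: "quadratic_form Q P" and q': "quadratic_form Q' P'" and eq: "forms_equiv n Q Q'"
  shows "quadratic_form.gauss_sum Q n = quadratic_form.gauss_sum Q' n"
    and "card (quadratic_form.radical P n) = card (quadratic_form.radical P' n)"
proof -
  interpret A: quadratic_form Q P by (rule q)
  interpret B: quadratic_form Q' P' by (rule q')
  obtain M where bij: "bij_betw M (Lambda n) (Lambda n)"
    and add: "\<And>x y. x \<in> Lambda n \<Longrightarrow> y \<in> Lambda n \<Longrightarrow> M (x + y) = M x + M y"
    and QM: "\<And>x. x \<in> Lambda n \<Longrightarrow> even (Q x) = even (Q' (M x))"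
    using eq unfolding forms_equiv_def by blast
  have M: "M x \<in> Lambda n" if "x \<in> Lambda n" for x
    using bij_betw_apply[OF bij that] .
  have PM: "even (P x y) = even (P' (M x) (M y))" if "x \<in> Lambda n" "y \<in> Lambda n" for x y
    using QM[of "x + y"] QM[of x] QM[of y] that by (auto simp: add A.Q_add B.Q_add)
  \<comment> \<open>The permutation of \<open>\<Lambda>/2\<Lambda>\<close> induced by \<open>M\<close>, in terms of subsets.\<close>
  define \<mu> where "\<mu> X = odd_part n (M (ind_vec X))" for X
  have "inj_on \<mu> (Pow {..<n})"
  proof (rule inj_onI)
    fix X Y assume XY: "X \<in> Pow {..<n}" "Y \<in> Pow {..<n}" "\<mu> X = \<mu> Y"
    then have L: "ind_vec X \<in> Lambda n" "ind_vec Y \<in> Lambda n" by (auto intro: vec_Lambda)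
    have fin: "finite X" "finite Y" using XY finite_subset[of _ "{..<n}"] by auto
    obtain z z' where z: "z \<in> Lambda n" "M (ind_vec X) = ind_vec (\<mu> X) + (z + z)"
      and z': "z' \<in> Lambda n" "M (ind_vec Y) = ind_vec (\<mu> X) + (z' + z')"
      using odd_part_decomp[OF M[OF L(1)]] odd_part_decomp[OF M[OF L(2)]] XY(3) unfolding \<mu>_def by metis
    \<comment> \<open>Congruent images have congruent arguments, since \<open>M\<close> is onto.\<close>
    have "z - z' \<in> M ` Lambda n"
      using bij z z' by (simp add: bij_betw_def)
    then obtain d where d: "d \<in> Lambda n" "z - z' = M d" by blast
    have "M (ind_vec Y + (d + d)) = M (ind_vec Y) + (M d + M d)"
      using add[of "ind_vec Y" "d + d"] add[of d d] L d(1) Lambda_closed(2)[OF d(1) d(1)] by (simp only:)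
    then have "M (ind_vec X) = M (ind_vec Y + (d + d))"
      unfolding z(2) z'(2) d(2)[symmetric] by (simp add: algebra_simps)
    then have "ind_vec X = ind_vec Y + (d + d)"
      by (rule inj_onD[OF bij_betw_imp_inj_on[OF bij]]) (intro L d(1) Lambda_closed)+
    then have "lookup (ind_vec X) i = lookup (ind_vec Y) i + 2 * lookup d i" for i
      by (simp only: lookup_add mult_2)
    then have ev: "even (lookup (ind_vec X) i) = even (lookup (ind_vec Y) i)" for i
      by simp
    have "i \<in> X \<longleftrightarrow> i \<in> Y" for i
      using ev[of i] fin by (cases "i \<in> X"; cases "i \<in> Y") (simp_all add: lookup_vec)
    then show "X = Y" by blast
  qed
  moreover have "\<mu> ` Pow {..<n} \<subseteq> Pow {..<n}"
    by (auto simp: \<mu>_def odd_part_def)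
  ultimately have \<mu>: "bij_betw \<mu> (Pow {..<n}) (Pow {..<n})"
    using endo_inj_surj[of "Pow {..<n}" \<mu>] by (simp add: bij_betw_def)
  have "sg (Q (ind_vec X)) = (sg (Q' (ind_vec (\<mu> X))) :: int)" if "X \<in> Pow {..<n}" for X
    using that B.Q_odd_part[OF M[OF vec_Lambda]] QM[OF vec_Lambda] unfolding \<mu>_def
    by (intro sg_cong) simp
  then have "A.gauss_sum n = (\<Sum>X\<in>Pow {..<n}. sg (Q' (ind_vec (\<mu> X))))"
    unfolding A.gauss_sum_def by (rule sum.cong[OF refl])
  also have "\<dots> = B.gauss_sum n"
    unfolding B.gauss_sum_def by (rule sum.reindex_bij_betw[OF \<mu>])
  finally show "A.gauss_sum n = B.gauss_sum n" .
  have rad: "X \<in> A.radical n \<longleftrightarrow> \<mu> X \<in> B.radical n" if X: "X \<in> Pow {..<n}" for X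
  proof -
    have L: "ind_vec X \<in> Lambda n" using X by (auto intro: vec_Lambda)
    have "(\<forall>y\<in>Lambda n. even (P (ind_vec X) y)) \<longleftrightarrow> (\<forall>y\<in>Lambda n. even (P' (M (ind_vec X)) (M y)))"
      using PM[OF L] by blast
    also have "\<dots> \<longleftrightarrow> (\<forall>y\<in>M ` Lambda n. even (P' (M (ind_vec X)) y))" by blast
    also have "\<dots> \<longleftrightarrow> (\<forall>y\<in>Lambda n. even (P' (ind_vec (\<mu> X)) y))"
      using bij B.P_odd_part[OF M[OF L]] unfolding \<mu>_def by (simp add: bij_betw_def)
    finally show ?thesis
      using X \<mu> bij_betw_apply[OF \<mu> X] by (simp add: A.radical_def B.radical_def)
  qed
  have "\<mu> ` A.radical n = B.radical n"
  proof (intro equalityI subsetI)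
    fix Y assume "Y \<in> \<mu> ` A.radical n"
    then show "Y \<in> B.radical n" using rad by (auto simp: A.radical_def)
  next
    fix Y assume Y: "Y \<in> B.radical n"
    then have "Y \<in> \<mu> ` Pow {..<n}" using \<mu> by (simp add: bij_betw_def B.radical_def)
    then show "Y \<in> \<mu> ` A.radical n" using rad Y by blast
  qed
  moreover have "inj_on \<mu> (A.radical n)"
    using \<mu> by (auto simp: bij_betw_def A.radical_def intro: inj_on_subset)
  ultimately show "card (A.radical n) = card (B.radical n)"
    using card_image by metis
qed

lemma sum_Pow_Suc:
  fixes f :: "nat set \<Rightarrow> 'a::comm_monoid_add"
  shows "(\<Sum>X\<in>Pow {..<Suc m}. f X) = (\<Sum>X\<in>Pow {..<m}. f X + f (insert m X))"
proof -
  have "Pow {..<Suc m} = Pow {..<m} \<union> insert m ` Pow {..<m}"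
    by (simp add: lessThan_Suc Pow_insert)
  moreover have "Pow {..<m} \<inter> insert m ` Pow {..<m} = {}" by auto
  moreover have "inj_on (insert m) (Pow {..<m})"
    by (rule inj_onI) (metis PowD insert_ident lessThan_iff less_irrefl subsetD)
  ultimately show ?thesis
    by (simp add: sum.union_disjoint sum.reindex sum.distrib)
qed

text \<open>A form that is standard with respect to the basis $e_0,\dots,e_{n-1}$: the polar form
  pairs the first $2l$ vectors, and $S$ is the set of indices of odd value.\<close>

locale standard_form = quadratic_form +
  fixes n l :: nat and S :: "nat set"
  assumes std: "symplectic_basis n l frag_of" and odds: "odd_set n frag_of = S"
begin

lemma le: "2 * l \<le> n"
  using std by (simp add: symplectic_basis_def)

lemma P_vec:
  assumes "X \<subseteq> {..<n}" "j < n"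
  shows "odd (P (ind_vec X) (frag_of j)) \<longleftrightarrow> j < 2 * l \<and> partner j \<in> X"
proof -
  have "finite X" using assms(1) finite_subset by blast
  then show ?thesis using assms(1)
  proof (induction X rule: finite_induct)
    case (insert i X)
    have "odd (P (frag_of i) (frag_of j)) \<longleftrightarrow> j < 2 * l \<and> i = partner j"
    proof (cases "i = j")
      case False
      then have "odd (P (frag_of i) (frag_of j)) = (i < 2 * l \<and> j = partner i)"
        using std insert.prems assms(2) by (simp add: symplectic_basis_def)
      then show ?thesis by auto
    qed (use P_self in simp)
    then show ?case
      using insert by (auto simp: P_add_left)
  qed simp
qed

lemma Q_frag_of: "i < n \<Longrightarrow> odd (Q (frag_of i)) \<longleftrightarrow> i \<in> S"
  using odds by (auto simp: odd_set_def)

lemma Q_vec_insert: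
  assumes "X \<subseteq> {..<n}" "i < n" "i \<notin> X"
  shows "odd (Q (ind_vec (insert i X))) \<longleftrightarrow> (odd (Q (ind_vec X)) \<noteq> ((i \<in> S) \<noteq> (i < 2 * l \<and> partner i \<in> X)))"
proof -
  have "finite X" using assms(1) finite_subset by blast
  then show ?thesis
    using assms P_vec[OF assms(1,2)] Q_frag_of[OF assms(2)] by (auto simp: Q_add)
qed

text \<open>The radical modulo 2 is spanned by the vectors outside the pairs.\<close>

lemma card_radical: "card (radical n) = 2 ^ (n - 2 * l)"
proof -
  have "radical n = Pow {2 * l..<n}"
  proof (intro equalityI subsetI)
    fix X assume X: "X \<in> radical n"
    then have Xn: "X \<subseteq> {..<n}" by (simp add: radical_def)
    have "\<not> j < 2 * l" if "j \<in> X" for j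
    proof
      assume j: "j < 2 * l"
      then have "partner j < 2 * l" by simp
      then have pn: "partner j < n" using le by linarith
      have "odd (P (ind_vec X) (frag_of (partner j)))"
        using P_vec[OF Xn pn] j that by simp
      then show False using X pn by (auto simp: radical_def)
    qed
    then show "X \<in> Pow {2 * l..<n}" using Xn by (auto simp: not_less)
  next
    fix X assume X: "X \<in> Pow {2 * l..<n}"
    then have Xn: "X \<subseteq> {..<n}" by auto
    have e: "even (P (ind_vec X) (frag_of j))" if "j < n" for j
    proof -
      have "\<not> (j < 2 * l \<and> partner j \<in> X)"
      proof
        assume "j < 2 * l \<and> partner j \<in> X"
        then have "partner j < 2 * l" "2 * l \<le> partner j" using X by auto
        then show False by linarith
      qed
      then show ?thesis using P_vec[OF Xn that] by blast
    qed
    have "even (P (ind_vec X) y)" if y: "y \<in> Lambda n" for y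
    proof -
      have "P (ind_vec X) y = (\<Sum>j<n. lookup y j * P (ind_vec X) (frag_of j))"
        by (rule Lambda_additive_expand) (use P_add_right y in auto)
      then show ?thesis using e by (auto intro!: dvd_sum)
    qed
    then show "X \<in> radical n" using Xn by (simp add: radical_def)
  qed
  then show ?thesis by (simp add: card_Pow)
qed

definition partial_sum :: "nat \<Rightarrow> int" where
  "partial_sum m = (\<Sum>X\<in>Pow {..<m}. sg (Q (ind_vec X)))"

text \<open>A radical vector of odd value makes the terms cancel in pairs, one of even value
  doubles the sum.\<close>

lemma partial_sum_radical:
  assumes "2 * l \<le> m" "m < n"
  shows "partial_sum (Suc m) = (if m \<in> S then 0 else 2 * partial_sum m)"
proof -
  have "sg (Q (ind_vec X)) + sg (Q (ind_vec (insert m X))) = (if m \<in> S then 0 else 2 * sg (Q (ind_vec X)) :: int)"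
    if "X \<in> Pow {..<m}" for X
  proof -
    have "X \<subseteq> {..<n}" "m \<notin> X" using that assms by auto
    then show ?thesis
      using Q_vec_insert[of X m] assms by (auto simp: sg_def)
  qed
  then have "partial_sum (Suc m) = (\<Sum>X\<in>Pow {..<m}. if m \<in> S then 0 else 2 * sg (Q (ind_vec X)))"
    unfolding partial_sum_def sum_Pow_Suc by (rule sum.cong[OF refl])
  then show ?thesis
    by (simp add: partial_sum_def sum_distrib_left)
qed

text \<open>The signs of $Q$ on $0, x, y, x+y$ are $+,+,+,-$ for a hyperbolic pair and $+,-,-,-$
  for an anisotropic one.\<close>

lemma partial_sum_pair:
  assumes "p < l" "2 * p \<in> S \<longleftrightarrow> Suc (2 * p) \<in> S"
  shows "partial_sum (2 * Suc p) = (if 2 * p \<in> S then - 2 else 2) * partial_sum (2 * p)"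
proof -
  let ?a = "2 * p" and ?b = "Suc (2 * p)"
  have n: "?b < n" using assms(1) le by linarith
  have "sg (Q (ind_vec X)) + sg (Q (ind_vec (insert ?a X))) + (sg (Q (ind_vec (insert ?b X))) + sg (Q (ind_vec (insert ?a (insert ?b X)))))
      = (if ?a \<in> S then - 2 else 2) * (sg (Q (ind_vec X)) :: int)"
    if X: "X \<in> Pow {..<?a}" for X
  proof -
    have sub: "X \<subseteq> {..<n}" "insert ?b X \<subseteq> {..<n}" "?a \<notin> X" "?b \<notin> X"
      using X n by auto
    have "odd (Q (ind_vec (insert ?a X))) \<longleftrightarrow> (odd (Q (ind_vec X)) \<noteq> (?a \<in> S))"
      using Q_vec_insert[of X ?a] sub n by simp
    moreover have "odd (Q (ind_vec (insert ?b X))) \<longleftrightarrow> (odd (Q (ind_vec X)) \<noteq> (?b \<in> S))"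
      using Q_vec_insert[of X ?b] sub n by simp
    moreover have "odd (Q (ind_vec (insert ?a (insert ?b X)))) \<longleftrightarrow> (odd (Q (ind_vec (insert ?b X))) \<noteq> (?a \<notin> S))"
      using Q_vec_insert[of "insert ?b X" ?a] sub n assms(1) by simp
    ultimately show ?thesis
      using assms(2) by (auto simp: sg_def)
  qed
  moreover have "partial_sum (2 * Suc p) = (\<Sum>X\<in>Pow {..<?a}. sg (Q (ind_vec X)) + sg (Q (ind_vec (insert ?a X)))
      + (sg (Q (ind_vec (insert ?b X))) + sg (Q (ind_vec (insert ?a (insert ?b X))))))"
  proof -
    have "2 * Suc p = Suc ?b" by simp
    then show ?thesis
      unfolding partial_sum_def by (simp only: sum_Pow_Suc sum.distrib insert_commute[of ?b ?a] add_ac)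
  qed
  ultimately show ?thesis
    by (simp add: partial_sum_def sum_distrib_left)
qed

lemma partial_sum_pairs_pos:
  assumes "p \<le> l" "S \<inter> {..<2 * p} = {}"
  shows "partial_sum (2 * p) > 0"
  using assms
proof (induction p)
  case 0
  have "Q 0 = 0" using Q_add[of 0 0] by simp
  then show ?case by (simp add: partial_sum_def)
next
  case (Suc p)
  have S: "2 * p \<notin> S" "Suc (2 * p) \<notin> S" using Suc.prems by auto
  have "S \<inter> {..<2 * p} = {}" using Suc.prems by auto
  then have "partial_sum (2 * p) > 0" using Suc by simp
  then show ?case
    using partial_sum_pair[of p] S Suc.prems by simp
qed

lemma gauss_sum_sgn:
  assumes "2 * l \<le> m" "m \<le> n" "S \<inter> {m..<n} = {}"
  shows "sgn (gauss_sum n) = sgn (partial_sum m)"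
  using assms(2,1,3)
proof (induction m rule: inc_induct)
  case base
  then show ?case by (simp add: gauss_sum_def partial_sum_def)
next
  case (step m)
  have "S \<inter> {Suc m..<n} = {}" "m \<notin> S" using step.prems step.hyps by auto
  then show ?case
    using step partial_sum_radical[of m] by (simp add: sgn_mult)
qed

lemma gauss_sum_cases:
  shows "S = {} \<Longrightarrow> gauss_sum n > 0"
    and "2 * l < n \<Longrightarrow> S = {2 * l} \<Longrightarrow> gauss_sum n = 0"
    and "1 \<le> l \<Longrightarrow> S = {2 * l - 2, 2 * l - 1} \<Longrightarrow> gauss_sum n < 0"
proof -
  show "gauss_sum n > 0" if "S = {}"
    using gauss_sum_sgn[of "2 * l"] partial_sum_pairs_pos[of l] le that by (simp add: sgn_1_pos)
  show "gauss_sum n = 0" if "2 * l < n" "S = {2 * l}"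
    using gauss_sum_sgn[of "Suc (2 * l)"] partial_sum_radical[of "2 * l"] that by (simp add: sgn_0_0)
  show "gauss_sum n < 0" if l: "1 \<le> l" "S = {2 * l - 2, 2 * l - 1}"
  proof -
    obtain p where p: "l = Suc p" using l(1) by (cases l) auto
    have S: "S = {2 * p, Suc (2 * p)}" using l(2) p by auto
    have "partial_sum (2 * p) > 0"
      by (rule partial_sum_pairs_pos) (use p S in auto)
    then have "partial_sum (2 * l) < 0"
      using partial_sum_pair[of p] S p by simp
    moreover have "S \<inter> {2 * l..<n} = {}" using S p by auto
    ultimately show ?thesis
      using gauss_sum_sgn[of "2 * l"] le by (simp add: sgn_1_neg)
  qed
qed

end

text \<open>The three families: $*$, $\tau_1$ and $\tau_2$, with the sets of generators on which
  the involution is $-1$.\<close>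

definition standard_type :: "nat \<Rightarrow> nat \<Rightarrow> nat set \<Rightarrow> bool" where
  "standard_type n l S \<longleftrightarrow> 2 * l \<le> n \<and>
     (S = {} \<or> 2 * l < n \<and> S = {2 * l} \<or> 1 \<le> l \<and> S = {2 * l - 2, 2 * l - 1})"

text \<open>The radical determines $l$, and then the sign of the Gauss sum determines which of the
  three families is present.\<close>

theorem standard_form_unique:
  assumes q: "standard_form Q P n l S" and q': "standard_form Q' P' n l' S'"
    and S: "standard_type n l S" and S': "standard_type n l' S'" and eq: "forms_equiv n Q Q'"
  shows "l = l' \<and> S = S'"
proof -
  interpret A: standard_form Q P n l S by (rule q)
  interpret B: standard_form Q' P' n l' S' by (rule q')
  note inv = forms_equiv_invariants[OF A.quadratic_form_axioms B.quadratic_form_axioms eq]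
  have "n - 2 * l = n - 2 * l'"
    using inv(2) by (simp add: A.card_radical B.card_radical)
  then have l: "l = l'" using A.le B.le by linarith
  have A: "S = {} \<and> A.gauss_sum n > 0 \<or> S = {2 * l} \<and> A.gauss_sum n = 0 \<or>
      S = {2 * l - 2, 2 * l - 1} \<and> A.gauss_sum n < 0"
    using S A.gauss_sum_cases unfolding standard_type_def by blast
  have B: "S' = {} \<and> B.gauss_sum n > 0 \<or> S' = {2 * l} \<and> B.gauss_sum n = 0 \<or>
      S' = {2 * l - 2, 2 * l - 1} \<and> B.gauss_sum n < 0"
    using S' B.gauss_sum_cases unfolding standard_type_def l by blast
  show ?thesis
    using A B inv(1) l by (elim disjE conjE) simp_all
qed

text \<open>An equivalence is onto, so it cannot map the generators $e_i$ into the proper subgroup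
  of vectors with even first coordinate.\<close>

lemma generators_in_even_hyperplane:
  assumes eq: "forms_equiv n Q Q'" and "1 \<le> n"
    and Q: "\<And>i. i < n \<Longrightarrow> even (Q (frag_of i))"
    and Q': "\<And>y. y \<in> Lambda n \<Longrightarrow> even (Q' y) \<Longrightarrow> even (lookup y 0)"
  shows False
proof -
  obtain M where bij: "bij_betw M (Lambda n) (Lambda n)"
    and add: "\<And>x y. x \<in> Lambda n \<Longrightarrow> y \<in> Lambda n \<Longrightarrow> M (x + y) = M x + M y"
    and QM: "\<And>x. x \<in> Lambda n \<Longrightarrow> even (Q x) = even (Q' (M x))"
    using eq unfolding forms_equiv_def by blast
  have M: "M x \<in> Lambda n" if "x \<in> Lambda n" for x
    using bij_betw_apply[OF bij that] .
  have "even (lookup (M x) 0)" if "x \<in> Lambda n" for x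
  proof -
    have "keys x \<subseteq> {..<n}" using that by (simp add: Lambda_iff)
    then have "x \<in> Lambda n \<and> even (lookup (M x) 0)"
    proof (induction rule: frag_induction)
      case zero
      have "M 0 = 0" using add[of 0 0] by simp
      then show ?case by simp
    next
      case (one i)
      then show ?case using Q QM Q'[OF M] by auto
    next
      case (diff x y)
      then have "lookup (M x) 0 = lookup (M (x - y)) 0 + lookup (M y) 0"
        using add[of "x - y" y] by (auto simp: lookup_add)
      then have "even (lookup (M (x - y)) 0)"
        using diff by (metis even_add)
      then show ?case using diff by auto
    qed
    then show ?thesis by blast
  qed
  moreover have "frag_of 0 \<in> Lambda n"
    by (rule Lambda_closed) (use \<open>1 \<le> n\<close> in simp)
  then obtain x where "x \<in> Lambda n" "M x = frag_of 0"
    using bij unfolding bij_betw_def by (metis imageE)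
  ultimately have "even (lookup (frag_of (0::nat)) 0)" by metis
  then show False by (simp only: lookup_frag_of) simp
qed

text \<open>The forms are $x_0$ and $x_0 + x_1 + x_0x_1$; the second vanishes only when $x_0$ and
  $x_1$ are both even.\<close>

lemma (in standard_form) even_imp_even_first:
  assumes "l = 0 \<and> S = {0} \<or> l = 1 \<and> S = {0, 1}" and y: "y \<in> Lambda n" "even (Q y)" and n: "1 \<le> n"
  shows "even (lookup y 0)"
proof -
  have "odd (Q (ind_vec X)) \<longleftrightarrow> X \<inter> S \<noteq> {}" if "X \<subseteq> {..<n}" for X
  proof -
    have "finite X" using that finite_subset by blast
    then show ?thesis using that
    proof (induction X rule: finite_induct)
      case empty
      have "Q 0 = 0" using Q_add[of 0 0] by simp
      then show ?case by simp
    next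
      case (insert i X)
      have p: "partner 0 = 1" "partner (Suc 0) = 0" by (simp_all add: partner_def)
      have "odd (Q (ind_vec (insert i X))) \<longleftrightarrow> (X \<inter> S \<noteq> {}) \<noteq> ((i \<in> S) \<noteq> (i < 2 * l \<and> partner i \<in> X))"
        using Q_vec_insert[of X i] insert by auto
      moreover have "((X \<inter> S \<noteq> {}) \<noteq> ((i \<in> S) \<noteq> (i < 2 * l \<and> partner i \<in> X))) \<longleftrightarrow> insert i X \<inter> S \<noteq> {}"
        using assms(1)
      proof
        assume "l = 0 \<and> S = {0}"
        then show ?thesis using insert.hyps by auto
      next
        assume lS: "l = 1 \<and> S = {0, 1}"
        consider "i = 0" | "i = 1" | "i \<ge> 2" by linarith
        then show ?thesis
          by cases (use lS insert.hyps p in auto)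
      qed
      ultimately show ?case by simp
    qed
  qed
  from this[of "odd_part n y"] have "odd_part n y \<inter> S = {}"
    using y Q_odd_part[OF y(1)] by (auto simp: odd_part_def)
  then have "0 \<notin> odd_part n y"
    using assms(1) by auto
  then show ?thesis using n by (auto simp: odd_part_def)
qed

section \<open>The standard quantum matrices\<close>

lemma hl_mat_Suc:
  assumes "2 * Suc l \<le> n"
  shows "hl_mat (Suc l) n = block_prod h_mat (hl_mat l (n - 2))"
  using assms by (simp add: hl_mat_def diff_diff_left)

lemma h_mat_simps [simp]:
  "dim_row h_mat = 2" "dim_col h_mat = 2"
  "i < 2 \<Longrightarrow> j < 2 \<Longrightarrow> h_mat $$ (i, j) = (if i = j then 1 else -1)"
  by (auto simp: h_mat_def mat_of_rows_list_def less_2_cases_iff)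

lemma block_prod_dim [simp]:
  "dim_row (block_prod A B) = dim_row A + dim_row B" "dim_col (block_prod A B) = dim_col A + dim_col B"
  by (simp_all add: block_prod_def)

lemma block_prod_index:
  assumes "i < dim_row A + dim_row B" "j < dim_col A + dim_col B"
  shows "block_prod A B $$ (i, j) = (if i < dim_row A \<and> j < dim_col A then A $$ (i, j)
    else if dim_row A \<le> i \<and> dim_col A \<le> j then B $$ (i - dim_row A, j - dim_col A) else 1)"
  using assms by (auto simp: block_prod_def ones_mat_def)

lemma hl_mat_dim_index:
  assumes "2 * l \<le> n"
  shows "dim_row (hl_mat l n :: 'f::field mat) = n \<and> dim_col (hl_mat l n :: 'f mat) = n \<and>
    (\<forall>i<n. \<forall>j<n. (hl_mat l n :: 'f mat) $$ (i, j) = (if i < 2 * l \<and> j = partner i then -1 else 1))"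
  using assms
proof (induction l arbitrary: n)
  case 0
  then show ?case by (simp add: hl_mat_def ones_mat_def)
next
  case (Suc l)
  then have n: "2 * l \<le> n - 2" "2 + (n - 2) = n" by simp_all
  note IH = Suc.IH[OF n(1)]
  have "(hl_mat (Suc l) n :: 'f mat) $$ (i, j) = (if i < 2 * Suc l \<and> j = partner i then -1 else 1)"
    if ij: "i < n" "j < n" for i j
  proof -
    have p: "j - 2 = partner (i - 2) \<longleftrightarrow> j = partner i" if ge: "2 \<le> i" "2 \<le> j"
    proof -
      obtain i' j' where "i = 2 + i'" "j = 2 + j'"
        using le_Suc_ex[OF ge(1)] le_Suc_ex[OF ge(2)] by blast
      then show ?thesis by (auto simp: partner_def)
    qed
    have q: "j = partner i \<longleftrightarrow> i \<noteq> j" if "i < 2" "j < 2"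
      using that by (auto simp: partner_def less_2_cases_iff)
    have r: "j \<noteq> partner i" if "i < 2 \<longleftrightarrow> \<not> j < 2"
      using that partner_simps(4)[of i 1] by auto
    have B: "(hl_mat (Suc l) n :: 'f mat) $$ (i, j) = (if i < 2 \<and> j < 2 then h_mat $$ (i, j)
        else if 2 \<le> i \<and> 2 \<le> j then hl_mat l (n - 2) $$ (i - 2, j - 2) else 1)"
      unfolding hl_mat_Suc[OF Suc.prems]
      using block_prod_index[of i "h_mat :: 'f mat" "hl_mat l (n - 2)" j] ij IH n by simp
    consider "i < 2" "j < 2" | "i < 2" "2 \<le> j" | "2 \<le> i" "j < 2" | "2 \<le> i" "2 \<le> j" by linarith
    then show ?thesis
    proof cases
      case 1
      then show ?thesis using B q by simp
    next
      case 2
      then show ?thesis using B r by simp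
    next
      case 3
      then show ?thesis using B r by simp
    next
      case 4
      then have "i - 2 < n - 2" "j - 2 < n - 2"
        using ij by linarith+
      moreover have "i - 2 < 2 * l \<longleftrightarrow> i < 2 * Suc l"
        using 4 by auto
      ultimately show ?thesis using B 4 p IH by simp
    qed
  qed
  moreover have "dim_row (hl_mat (Suc l) n :: 'f mat) = n" "dim_col (hl_mat (Suc l) n :: 'f mat) = n"
    unfolding hl_mat_Suc[OF Suc.prems] using IH n by simp_all
  ultimately show ?case by simp
qed

lemma elementaryI:
  assumes "q \<in> carrier_mat n n" "\<And>i. i < n \<Longrightarrow> q $$ (i, i) = 1"
    and "\<And>i j. i < n \<Longrightarrow> j < n \<Longrightarrow> q $$ (i, j) \<in> {1, -1}"
    and "\<And>i j. i < n \<Longrightarrow> j < n \<Longrightarrow> q $$ (j, i) = q $$ (i, j)"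
  shows "elementary_quantum_matrix n q"
proof -
  have "q $$ (i, j) * q $$ (j, i) = 1" if "i < n" "j < n" for i j
    using assms(3)[OF that] assms(4)[OF that] by auto
  then show ?thesis
    using assms by (simp add: elementary_quantum_matrix_def quantum_matrix_def)
qed

lemma elementary_hl_mat:
  assumes "2 * l \<le> n"
  shows "elementary_quantum_matrix n (hl_mat l n :: 'f::field mat)"
proof (rule elementaryI)
  note h = hl_mat_dim_index[OF assms, where 'f='f]
  show "(hl_mat l n :: 'f mat) \<in> carrier_mat n n" using h by (intro carrier_matI) simp_all
  show "(hl_mat l n :: 'f mat) $$ (j, i) = hl_mat l n $$ (i, j)" if "i < n" "j < n" for i j
  proof -
    have "i < 2 * l \<and> j = partner i \<longleftrightarrow> j < 2 * l \<and> i = partner j" by auto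
    then show ?thesis using h that by simp
  qed
qed (use hl_mat_dim_index[OF assms, where 'f='f] in auto)

definition sign_type :: "nat set \<Rightarrow> nat \<Rightarrow> 'f::field" where
  "sign_type S i = (if i \<in> S then -1 else 1)"

abbreviation std_form :: "'f::field itself \<Rightarrow> nat \<Rightarrow> nat \<Rightarrow> nat set \<Rightarrow> (nat \<Rightarrow>\<^sub>0 int) \<Rightarrow> int" where
  "std_form _ l n S \<equiv> qform (hl_mat l n) (sign_type S :: nat \<Rightarrow> 'f)"

lemma odd_eexp: "odd (eexp q i j) \<longleftrightarrow> q $$ (i, j) \<noteq> 1"
  by (simp add: eexp_def)

lemma standard_form_hl_mat:
  assumes char: "CHAR('f::field) \<noteq> 2" and l: "2 * l \<le> n" and S: "S \<subseteq> {..<n}"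
  shows "standard_form (std_form TYPE('f) l n S) (polar (hl_mat l n :: 'f mat)) n l S"
proof -
  note ne = neg_one_neq_one[OF char]
  interpret quadratic_form "std_form TYPE('f) l n S" "polar (hl_mat l n :: 'f mat)"
    by (rule quadratic_form_qform)
  have "symplectic_basis n l frag_of"
    unfolding symplectic_basis_def
    using l ne hl_mat_dim_index[OF l, where 'f='f]
    by (simp add: polar_frag_of[OF elementary_hl_mat[OF l]] Lambda_basis_frag_of odd_eexp)
  moreover have "odd_set n frag_of = S"
    using S ne hl_mat_dim_index[OF l, where 'f='f] by (auto simp: odd_set_def qform_frag_of sign_type_def split: if_splits)
  ultimately show ?thesis by unfold_locales
qed

lemma standard_type_subset: "standard_type n l S \<Longrightarrow> S \<subseteq> {..<n}"
  by (auto simp: standard_type_def)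

text \<open>The form of $F_{\mathbf h_{l,n}}$ with the type read off from the basis found above
  has the same values on generators and pairs of generators.\<close>

lemma form_standard_exists:
  fixes q :: "'f::field mat"
  assumes char: "CHAR('f) \<noteq> 2"
  shows "\<exists>l S. standard_type n l S \<and> forms_equiv n (qform q a) (std_form TYPE('f) l n S)"
proof -
  interpret quadratic_form "qform q a" "polar q" by (rule quadratic_form_qform)
  obtain l v where v: "symplectic_basis n l v"
    and S: "odd_set n v = {} \<or> (2 * l < n \<and> odd_set n v = {2 * l}) \<or>
      (1 \<le> l \<and> odd_set n v = {2 * l - 2, 2 * l - 1})"
    using quadratic_form_classification by blast
  have std: "standard_type n l (odd_set n v)"
    using v S by (auto simp: standard_type_def symplectic_basis_def)
  then have l: "2 * l \<le> n" by (simp add: standard_type_def)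
  interpret H: standard_form "std_form TYPE('f) l n (odd_set n v)" "polar (hl_mat l n :: 'f mat)" n l "odd_set n v"
    by (rule standard_form_hl_mat[OF char l standard_type_subset[OF std]])
  have "forms_equiv n (std_form TYPE('f) l n (odd_set n v)) (qform q a)"
  proof (rule forms_equivI[OF H.quadratic_form_axioms quadratic_form_axioms])
    show "Lambda_basis n v" using v by (simp add: symplectic_basis_def)
    show "even (qform q a (v i)) = even (std_form TYPE('f) l n (odd_set n v) (frag_of i))" if "i < n" for i
      using H.Q_frag_of[OF that] that by (auto simp: odd_set_def)
    show "even (polar q (v i) (v j)) = even (polar (hl_mat l n :: 'f mat) (frag_of i) (frag_of j))"
      if "i < n" "j < n" "i \<noteq> j" for i j
      using v H.std that unfolding symplectic_basis_def H.symplectic_basis_def by blast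
  qed
  then show ?thesis using std forms_equiv_sym by blast
qed

lemma m_mat_simps [simp]: "dim_row (m_mat k) = k" "dim_col (m_mat k) = k"
  "i < k \<Longrightarrow> j < k \<Longrightarrow> m_mat k $$ (i, j) = (if i = j then 1 else -1)"
  by (simp_all add: m_mat_def)

lemma elementary_block_m_mat:
  assumes "2 * l + k \<le> n"
  shows "elementary_quantum_matrix n (block_prod (hl_mat l (n - k)) (m_mat k) :: 'f::field mat)"
    and "\<And>i j. i < n \<Longrightarrow> j < n \<Longrightarrow> (block_prod (hl_mat l (n - k)) (m_mat k) :: 'f mat) $$ (i, j)
      = (if i < 2 * l \<and> j = partner i \<or> i \<noteq> j \<and> n - k \<le> i \<and> n - k \<le> j then -1 else 1)"
proof -
  let ?B = "block_prod (hl_mat l (n - k)) (m_mat k) :: 'f mat"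
  have lk: "2 * l \<le> n - k" "n - k + k = n" using assms by simp_all
  note h = hl_mat_dim_index[OF lk(1), where 'f='f]
  show idx: "?B $$ (i, j) = (if i < 2 * l \<and> j = partner i \<or> i \<noteq> j \<and> n - k \<le> i \<and> n - k \<le> j then -1 else 1)"
    if "i < n" "j < n" for i j
  proof -
    have B: "?B $$ (i, j) = (if i < n - k \<and> j < n - k then hl_mat l (n - k) $$ (i, j)
        else if n - k \<le> i \<and> n - k \<le> j then m_mat k $$ (i - (n - k), j - (n - k)) else 1)"
      using block_prod_index[of i "hl_mat l (n - k) :: 'f mat" "m_mat k" j] that h lk(2) by simp
    consider "i < n - k" "j < n - k" | "i < n - k" "n - k \<le> j" | "n - k \<le> i" "j < n - k"
      | "n - k \<le> i" "n - k \<le> j" by linarith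
    then show ?thesis
    proof cases
      case 1
      then show ?thesis using B h by simp
    next
      case 2
      have "\<not> (i < 2 * l \<and> j = partner i)"
      proof
        assume "i < 2 * l \<and> j = partner i"
        then have "j < 2 * l" by simp
        then show False using 2 lk by linarith
      qed
      then show ?thesis using B 2 by auto
    next
      case 3
      then have "\<not> i < 2 * l" using lk by linarith
      then show ?thesis using B 3 by simp
    next
      case 4
      then have "\<not> i < 2 * l" "i - (n - k) < k" "j - (n - k) < k"
        "i - (n - k) = j - (n - k) \<longleftrightarrow> i = j" using lk that by linarith+
      then show ?thesis using B 4 by simp
    qed
  qed
  show "elementary_quantum_matrix n ?B"
  proof (rule elementaryI)
    show "?B \<in> carrier_mat n n" using h lk by (intro carrier_matI) simp_all
    show "?B $$ (i, i) = 1" if "i < n" for i using idx[OF that that] by simp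
    show "?B $$ (i, j) \<in> {1, -1}" if "i < n" "j < n" for i j using idx[OF that] by simp
    show "?B $$ (j, i) = ?B $$ (i, j)" if "i < n" "j < n" for i j
    proof -
      have "i < 2 * l \<and> j = partner i \<longleftrightarrow> j < 2 * l \<and> i = partner j" by auto
      then show ?thesis using idx[OF that] idx[OF that(2,1)] by auto
    qed
  qed
qed

text \<open>The permutation moves the $k$ vectors that are mutually nonorthogonal from the
  positions following the first $l$ pairs to the end, where the block $\mathbf m_k$
  stands.\<close>

lemma forms_equiv_block_m_mat:
  assumes char: "CHAR('f::field) \<noteq> 2" and Q: "quadratic_form Q P" and l: "2 * l + k \<le> n"
    and w: "Lambda_basis n w" and Qw: "\<And>i. i < n \<Longrightarrow> even (Q (w i))"
    and Pw: "\<And>i j. i < n \<Longrightarrow> j < n \<Longrightarrow> i \<noteq> j \<Longrightarrow> odd (P (w i) (w j)) \<longleftrightarrow>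
      i < 2 * l \<and> j = partner i \<or> 2 * l \<le> i \<and> i < 2 * l + k \<and> 2 * l \<le> j \<and> j < 2 * l + k"
  shows "forms_equiv n Q (qform (block_prod (hl_mat l (n - k)) (m_mat k) :: 'f mat) (\<lambda>_. 1))"
proof -
  let ?B = "block_prod (hl_mat l (n - k)) (m_mat k) :: 'f mat"
  note B = elementary_block_m_mat[OF l, where 'f='f]
  define \<pi> where "\<pi> i = (if i < 2 * l then i else if i < n - k then i + k else i - (n - k) + 2 * l)" for i
  define \<rho> where "\<rho> i = (if i < 2 * l then i else if i < 2 * l + k then i - 2 * l + (n - k) else i - k)" for i
  have "bij_betw \<pi> {..<n} {..<n}"
    by (rule bij_betw_byWitness[where f' = \<rho>]) (use l in \<open>auto simp: \<pi>_def \<rho>_def\<close>)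
  then have v: "Lambda_basis n (w \<circ> \<pi>)"
    by (rule Lambda_basis_permute[OF w])
  have \<pi>n: "\<pi> i < n" if "i < n" for i
    using that l by (auto simp: \<pi>_def)
  have \<pi>_inj: "\<pi> i \<noteq> \<pi> j" if "i < n" "j < n" "i \<noteq> j" for i j
    using \<open>bij_betw \<pi> {..<n} {..<n}\<close> that by (auto simp: bij_betw_def inj_on_def)
  have "forms_equiv n (qform ?B (\<lambda>_. 1)) Q"
  proof (rule forms_equivI[OF quadratic_form_qform Q v])
    show "even (Q ((w \<circ> \<pi>) i)) = even (qform ?B (\<lambda>_. 1) (frag_of i))" if "i < n" for i
      using Qw[OF \<pi>n[OF that]] that elementary_dim[OF B(1)] by (simp add: qform_frag_of)
    show "even (P ((w \<circ> \<pi>) i) ((w \<circ> \<pi>) j)) = even (polar ?B (frag_of i) (frag_of j))"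
      if ij: "i < n" "j < n" "i \<noteq> j" for i j
    proof -
      have lt: "\<pi> i < 2 * l \<longleftrightarrow> i < 2 * l" for i by (auto simp: \<pi>_def)
      have mid: "2 * l \<le> \<pi> i \<and> \<pi> i < 2 * l + k \<longleftrightarrow> n - k \<le> i" if "i < n" for i
        using that l by (auto simp: \<pi>_def)
      have "\<pi> j = partner i \<longleftrightarrow> j = partner i" if "i < 2 * l"
      proof -
        have "partner i < 2 * l" using that by simp
        then show ?thesis using lt[of j] by (auto simp: \<pi>_def)
      qed
      then have "\<pi> i < 2 * l \<and> \<pi> j = partner (\<pi> i) \<longleftrightarrow> i < 2 * l \<and> j = partner i"
        by (auto simp: \<pi>_def)
      then have "odd (P (w (\<pi> i)) (w (\<pi> j))) \<longleftrightarrow> i < 2 * l \<and> j = partner i \<or> n - k \<le> i \<and> n - k \<le> j"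
        using Pw[OF \<pi>n[OF ij(1)] \<pi>n[OF ij(2)] \<pi>_inj[OF ij]] mid[OF ij(1)] mid[OF ij(2)] by blast
      moreover have "odd (polar ?B (frag_of i) (frag_of j)) \<longleftrightarrow> i < 2 * l \<and> j = partner i \<or> n - k \<le> i \<and> n - k \<le> j"
        using polar_frag_of[OF B(1) ij] B(2)[OF ij(1,2)] ij(3) neg_one_neq_one[OF char]
        by (simp add: odd_eexp)
      ultimately show ?thesis unfolding comp_apply by blast
    qed
  qed
  then show ?thesis by (rule forms_equiv_sym)
qed

text \<open>The sum $d$ of a hyperbolic pair has odd value, so adding it to the vectors of odd
  value outside the pair makes all values even. The price is that these vectors are no longer
  orthogonal to the pair. With one odd vector this produces the block $\mathbf m_3$, with an
  anisotropic pair the block $\mathbf m_4$.\<close>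

lemma (in standard_form) shifted_basis:
  assumes p: "p < l" "2 * p \<notin> S" "Suc (2 * p) \<notin> S" and S: "S \<subseteq> {..<n}"
  defines "w \<equiv> \<lambda>i. frag_of i + (if i \<in> S then frag_of (2 * p) + frag_of (Suc (2 * p)) else 0)"
  shows "Lambda_basis n w" and "i < n \<Longrightarrow> even (Q (w i))"
    and "i < n \<Longrightarrow> j < n \<Longrightarrow> i \<noteq> j \<Longrightarrow> odd (P (w i) (w j)) \<longleftrightarrow> i < 2 * l \<and> j = partner i \<or>
      i \<in> {2 * p, Suc (2 * p)} \<and> j \<in> S \<or> i \<in> S \<and> j \<in> {2 * p, Suc (2 * p)}"
proof -
  let ?x = "2 * p" and ?y = "Suc (2 * p)"
  define d where "d = frag_of ?x + frag_of ?y"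
  have xy: "?x < n" "?y < n" using p(1) le by linarith+
  have w: "w i = frag_of i + (if i \<in> S then d else 0)" for i
    by (simp add: w_def d_def)
  show "Lambda_basis n w"
    by (rule Lambda_basis_shear[OF Lambda_basis_frag_of, of "{?x, ?y}" n w "\<lambda>a b. of_bool (a \<in> S)"])
      (use xy p in \<open>auto simp: w d_def\<close>)
  have P: "odd (P (frag_of i) (frag_of j)) \<longleftrightarrow> i < 2 * l \<and> j = partner i" if "i < n" "j < n" for i j
  proof (cases "i = j")
    case False
    then show ?thesis using std that by (simp add: symplectic_basis_def)
  qed (use P_self in simp)
  have Pd: "odd (P (frag_of i) d) \<longleftrightarrow> i \<in> {?x, ?y}" if i: "i < n" for i
  proof -
    have "?x = partner i \<longleftrightarrow> i = ?y" "?y = partner i \<longleftrightarrow> i = ?x"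
      by (metis partner_simps(1,5))+
    moreover have "i = ?x \<or> i = ?y \<Longrightarrow> i < 2 * l"
      using p(1) by linarith
    ultimately have "odd (P (frag_of i) (frag_of ?x)) \<longleftrightarrow> i = ?y" "odd (P (frag_of i) (frag_of ?y)) \<longleftrightarrow> i = ?x"
      using P[OF i xy(1)] P[OF i xy(2)] by blast+
    then show ?thesis by (auto simp: d_def P_add_right)
  qed
  have Qd: "odd (Q d)"
    using Q_frag_of[OF xy(1)] Q_frag_of[OF xy(2)] P[OF xy] p by (simp add: d_def Q_add)
  show "even (Q (w i))" if i: "i < n"
  proof (cases "i \<in> S")
    case True
    then have "even (P (frag_of i) d)" using Pd[OF i] p by auto
    then show ?thesis using True Q_frag_of[OF i] Qd by (simp add: w Q_add)
  next
    case False
    then show ?thesis using Q_frag_of[OF i] by (simp add: w)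
  qed
  show "odd (P (w i) (w j)) \<longleftrightarrow> i < 2 * l \<and> j = partner i \<or> i \<in> {?x, ?y} \<and> j \<in> S \<or> i \<in> S \<and> j \<in> {?x, ?y}"
    if ij: "i < n" "j < n" "i \<noteq> j"
  proof -
    have "odd (P (w i) (w j)) \<longleftrightarrow> ((i < 2 * l \<and> j = partner i) \<noteq> ((i \<in> {?x, ?y} \<and> j \<in> S) \<noteq> (i \<in> S \<and> j \<in> {?x, ?y})))"
      using P[OF ij(1,2)] Pd[OF ij(1)] Pd[OF ij(2)] P_self[of d] P_sym[of d "frag_of j"]
      by (auto simp: w P_add_left P_add_right)
    moreover have "\<not> (j = partner i \<and> (i \<in> {?x, ?y} \<and> j \<in> S \<or> i \<in> S \<and> j \<in> {?x, ?y}))"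
    proof -
      have "partner k \<in> {?x, ?y}" if "k \<in> {?x, ?y}" for k
        using that by auto
      note pair = this
      have "k \<notin> S" if "k \<in> {?x, ?y}" for k
        using that p by auto
      then show ?thesis
        using pair[of i] pair[of j] by (metis partner_simps(1))
    qed
    moreover have "\<not> (i \<in> {?x, ?y} \<and> i \<in> S)" using p by auto
    ultimately show ?thesis by blast
  qed
qed

lemma tau1_forms_equiv_m3:
  assumes char: "CHAR('f::field) \<noteq> 2" and l: "1 \<le> l" "2 * l < n"
  shows "forms_equiv n (std_form TYPE('f) l n {2 * l})
    (qform (block_prod (hl_mat (l - 1) (n - 3)) (m_mat 3) :: 'f mat) (\<lambda>_. 1))"
proof -
  interpret standard_form "std_form TYPE('f) l n {2 * l}" "polar (hl_mat l n :: 'f mat)" n l "{2 * l}"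
    by (rule standard_form_hl_mat[OF char]) (use l in auto)
  obtain p where p: "l = Suc p" using l(1) by (cases l) auto
  have hyp: "p < l" "2 * p \<notin> {2 * l}" "Suc (2 * p) \<notin> {2 * l}" "{2 * l} \<subseteq> {..<n}"
    using p l by auto
  note w = shifted_basis[OF hyp]
  have n: "2 * (l - 1) + 3 \<le> n" using l by linarith
  show ?thesis
  proof (rule forms_equiv_block_m_mat[OF char quadratic_form_axioms n w(1,2)])
    fix i j assume ij: "i < n" "j < n" "i \<noteq> j"
    have mid: "2 * (l - 1) \<le> k \<and> k < 2 * (l - 1) + 3 \<longleftrightarrow> k \<in> {2 * p, Suc (2 * p)} \<or> k \<in> {2 * l}" for k
      using p by auto
    have "i < 2 * l \<longleftrightarrow> i < 2 * (l - 1) \<or> i \<in> {2 * p, Suc (2 * p)}"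
      using p by auto
    moreover have "i \<in> {2 * p, Suc (2 * p)} \<Longrightarrow> j = partner i \<longleftrightarrow> j \<in> {2 * p, Suc (2 * p)}"
      using ij(3) partner_simps(5,6)[of p] by auto
    ultimately show "odd (polar (hl_mat l n :: 'f mat)
        (frag_of i + (if i \<in> {2 * l} then frag_of (2 * p) + frag_of (Suc (2 * p)) else 0))
        (frag_of j + (if j \<in> {2 * l} then frag_of (2 * p) + frag_of (Suc (2 * p)) else 0))) \<longleftrightarrow>
      i < 2 * (l - 1) \<and> j = partner i \<or>
      2 * (l - 1) \<le> i \<and> i < 2 * (l - 1) + 3 \<and> 2 * (l - 1) \<le> j \<and> j < 2 * (l - 1) + 3"
      using w(3)[OF ij] mid[of i] mid[of j] ij(3) by blast
  qed
qed

lemma tau2_forms_equiv_m4: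
  assumes char: "CHAR('f::field) \<noteq> 2" and l: "2 \<le> l" "2 * l \<le> n"
  shows "forms_equiv n (std_form TYPE('f) l n {2 * l - 2, 2 * l - 1})
    (qform (block_prod (hl_mat (l - 2) (n - 4)) (m_mat 4) :: 'f mat) (\<lambda>_. 1))"
proof -
  let ?S = "{2 * l - 2, 2 * l - 1}"
  interpret standard_form "std_form TYPE('f) l n ?S" "polar (hl_mat l n :: 'f mat)" n l ?S
    by (rule standard_form_hl_mat[OF char]) (use l in auto)
  define p where "p = l - 2"
  have p: "l = Suc (Suc p)" using l by (simp add: p_def)
  have hyp: "p < l" "2 * p \<notin> ?S" "Suc (2 * p) \<notin> ?S" "?S \<subseteq> {..<n}"
    using p l by auto
  note w = shifted_basis[OF hyp]
  have n: "2 * (l - 2) + 4 \<le> n" using l by linarith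
  show ?thesis
  proof (rule forms_equiv_block_m_mat[OF char quadratic_form_axioms n w(1,2)])
    fix i j assume ij: "i < n" "j < n" "i \<noteq> j"
    have mid: "2 * (l - 2) \<le> k \<and> k < 2 * (l - 2) + 4 \<longleftrightarrow> k \<in> {2 * p, Suc (2 * p)} \<or> k \<in> ?S" for k
      using p by auto
    have "i < 2 * l \<longleftrightarrow> i < 2 * (l - 2) \<or> i \<in> {2 * p, Suc (2 * p)} \<or> i \<in> ?S"
      using p by auto
    moreover have "i \<in> {2 * p, Suc (2 * p)} \<Longrightarrow> j = partner i \<longleftrightarrow> j \<in> {2 * p, Suc (2 * p)}"
      using ij(3) partner_simps(5,6)[of p] by auto
    moreover have "i \<in> ?S \<Longrightarrow> j = partner i \<longleftrightarrow> j \<in> ?S"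
      using ij(3) partner_simps(5,6)[of "Suc p"] p by auto
    ultimately show "odd (polar (hl_mat l n :: 'f mat)
        (frag_of i + (if i \<in> ?S then frag_of (2 * p) + frag_of (Suc (2 * p)) else 0))
        (frag_of j + (if j \<in> ?S then frag_of (2 * p) + frag_of (Suc (2 * p)) else 0))) \<longleftrightarrow>
      i < 2 * (l - 2) \<and> j = partner i \<or>
      2 * (l - 2) \<le> i \<and> i < 2 * (l - 2) + 4 \<and> 2 * (l - 2) \<le> j \<and> j < 2 * (l - 2) + 4"
      using w(3)[OF ij] mid[of i] mid[of j] by blast
  qed
qed

lemma has_type_main_involution:
  assumes "elementary_quantum_matrix n q"
  shows "has_type q (\<lambda>_. 1) (main_involution q)"
  unfolding main_involution_def
  by (rule elementary_torus.has_type_involution_of_type[OF elementary_torus.intro[OF assms]]) simp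

lemma sign_type_empty: "sign_type {} = (\<lambda>_. 1)"
  by (simp add: sign_type_def fun_eq_iff)

lemma has_type_hl_mat:
  fixes n l :: nat
  defines "H \<equiv> hl_mat l n :: 'f::field mat"
  assumes "2 * l \<le> n"
  shows "has_type H (sign_type {}) (main_involution H)"
    "has_type H (sign_type {2 * l}) (tau1 l n)"
    "has_type H (sign_type {2 * l - 2, 2 * l - 1}) (tau2 l n)"
proof -
  have s: "sign_type S i \<in> {1, -1 :: 'f}" for S i by (simp add: sign_type_def)
  note t = elementary_torus.has_type_involution_of_type[OF elementary_torus.intro[OF elementary_hl_mat[OF assms(2)]] s]
  show "has_type H (sign_type {}) (main_involution H)"
    unfolding main_involution_def sign_type_empty[symmetric] H_def by (rule t)
  have "sign_type {2 * l} = (\<lambda>i. if i = 2 * l then -1 else 1 :: 'f)"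
    "sign_type {2 * l - 2, 2 * l - 1} = (\<lambda>i. if i = 2 * l - 2 \<or> i = 2 * l - 1 then -1 else 1 :: 'f)"
    by (simp_all add: sign_type_def fun_eq_iff)
  then have "tau1 l n = involution_of_type H (sign_type {2 * l})"
    "tau2 l n = involution_of_type H (sign_type {2 * l - 2, 2 * l - 1})"
    by (simp_all only: tau1_def tau2_def H_def)
  then show "has_type H (sign_type {2 * l}) (tau1 l n)"
    "has_type H (sign_type {2 * l - 2, 2 * l - 1}) (tau2 l n)"
    using t unfolding H_def by simp_all
qed

lemma std_form_unique:
  assumes "CHAR('f::field) \<noteq> 2" "standard_type n l S" "standard_type n l' S'"
    and "forms_equiv n (std_form TYPE('f) l n S) (std_form TYPE('f) l' n S')"
  shows "l = l' \<and> S = S'"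
proof (rule standard_form_unique[OF _ _ assms(2,3,4)])
  have "2 * l \<le> n" "2 * l' \<le> n" using assms(2,3) by (auto simp: standard_type_def)
  then show "standard_form (std_form TYPE('f) l n S) (polar (hl_mat l n :: 'f mat)) n l S"
    "standard_form (std_form TYPE('f) l' n S') (polar (hl_mat l' n :: 'f mat)) n l' S'"
    using assms(1) standard_type_subset[OF assms(2)] standard_type_subset[OF assms(3)]
    by (simp_all add: standard_form_hl_mat)
qed

text \<open>For the main involution the basis of generators consists of zeros.\<close>

lemma main_not_equiv_small_std_form:
  fixes \<eta> :: "'f::field mat"
  assumes char: "CHAR('f) \<noteq> 2" and n: "1 \<le> n" and \<eta>: "elementary_quantum_matrix n \<eta>"
    and lS: "l = 0 \<and> S = {0} \<or> l = 1 \<and> 2 \<le> n \<and> S = {0, 1}"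
  shows "\<not> forms_equiv n (qform \<eta> (\<lambda>_. 1)) (std_form TYPE('f) l n S)"
proof
  assume eq: "forms_equiv n (qform \<eta> (\<lambda>_. 1)) (std_form TYPE('f) l n S)"
  interpret standard_form "std_form TYPE('f) l n S" "polar (hl_mat l n :: 'f mat)" n l S
    by (rule standard_form_hl_mat[OF char]) (use lS n in auto)
  show False
  proof (rule generators_in_even_hyperplane[OF eq n])
    show "even (qform \<eta> (\<lambda>_. 1) (frag_of i))" if "i < n" for i
      using that elementary_dim[OF \<eta>] by (simp add: qform_frag_of)
    show "even (lookup y 0)" if "y \<in> Lambda n" "even (std_form TYPE('f) l n S y)" for y
      using even_imp_even_first[OF _ that n] lS by auto
  qed
qed

section \<open>The classification of tori with involution\<close>

context
  fixes n :: nat and \<epsilon> :: "'f::field mat" and \<tau> :: "'f free_alg set \<Rightarrow> 'f free_alg set" and a :: "nat \<Rightarrow> 'f"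
  assumes char: "CHAR('f) \<noteq> 2" and \<epsilon>: "elementary_quantum_matrix n \<epsilon>" and \<tau>: "has_type \<epsilon> a \<tau>"
begin

lemma graded_iso_hl_mat_iff:
  assumes "2 * l \<le> n"
  shows "graded_iso_inv \<epsilon> \<tau> (hl_mat l n) (main_involution (hl_mat l n)) \<longleftrightarrow>
      forms_equiv n (qform \<epsilon> a) (std_form TYPE('f) l n {})"
    and "graded_iso_inv \<epsilon> \<tau> (hl_mat l n) (tau1 l n) \<longleftrightarrow>
      forms_equiv n (qform \<epsilon> a) (std_form TYPE('f) l n {2 * l})"
    and "graded_iso_inv \<epsilon> \<tau> (hl_mat l n) (tau2 l n) \<longleftrightarrow>
      forms_equiv n (qform \<epsilon> a) (std_form TYPE('f) l n {2 * l - 2, 2 * l - 1})"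
    and "iso_inv \<epsilon> \<tau> (hl_mat l n) (main_involution (hl_mat l n)) \<longleftrightarrow>
      forms_equiv n (qform \<epsilon> a) (std_form TYPE('f) l n {})"
    and "iso_inv \<epsilon> \<tau> (hl_mat l n) (tau1 l n) \<longleftrightarrow>
      forms_equiv n (qform \<epsilon> a) (std_form TYPE('f) l n {2 * l})"
    and "iso_inv \<epsilon> \<tau> (hl_mat l n) (tau2 l n) \<longleftrightarrow>
      forms_equiv n (qform \<epsilon> a) (std_form TYPE('f) l n {2 * l - 2, 2 * l - 1})"
  using iso_iff_forms_equiv[OF \<epsilon> elementary_hl_mat[OF assms] char \<tau>] has_type_hl_mat[OF assms, where 'f='f]
  by blast+

lemma graded_iso_main_iff:
  assumes "elementary_quantum_matrix n \<eta>"
  shows "graded_iso_inv \<epsilon> \<tau> \<eta> (main_involution \<eta>) \<longleftrightarrow> forms_equiv n (qform \<epsilon> a) (qform \<eta> (\<lambda>_. 1))"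
  using iso_iff_forms_equiv(2)[OF \<epsilon> assms char \<tau> has_type_main_involution[OF assms]] .

lemma forms_equiv_std_unique:
  assumes "forms_equiv n (qform \<epsilon> a) (std_form TYPE('f) l n S)" "standard_type n l S"
    and "forms_equiv n (qform \<epsilon> a) (std_form TYPE('f) l' n S')" "standard_type n l' S'"
  shows "l = l' \<and> S = S'"
  using std_form_unique[OF char assms(2,4)] forms_equiv_trans[OF forms_equiv_sym[OF assms(1)] assms(3)]
  by blast

lemma exactly_one_standard:
  "exactly_one
    (\<exists>l. 2 * l \<le> n \<and> graded_iso_inv \<epsilon> \<tau> (hl_mat l n) (main_involution (hl_mat l n)))
    (\<exists>l. 2 * l < n \<and> graded_iso_inv \<epsilon> \<tau> (hl_mat l n) (tau1 l n))
    (\<exists>l. 1 \<le> l \<and> 2 * l \<le> n \<and> graded_iso_inv \<epsilon> \<tau> (hl_mat l n) (tau2 l n))"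
proof -
  let ?G = "\<lambda>l S. forms_equiv n (qform \<epsilon> a) (std_form TYPE('f) l n S)"
  have iff: "(\<exists>l. 2 * l \<le> n \<and> graded_iso_inv \<epsilon> \<tau> (hl_mat l n) (main_involution (hl_mat l n)))
      \<longleftrightarrow> (\<exists>l. 2 * l \<le> n \<and> ?G l {})"
    "(\<exists>l. 2 * l < n \<and> graded_iso_inv \<epsilon> \<tau> (hl_mat l n) (tau1 l n)) \<longleftrightarrow> (\<exists>l. 2 * l < n \<and> ?G l {2 * l})"
    "(\<exists>l. 1 \<le> l \<and> 2 * l \<le> n \<and> graded_iso_inv \<epsilon> \<tau> (hl_mat l n) (tau2 l n))
      \<longleftrightarrow> (\<exists>l. 1 \<le> l \<and> 2 * l \<le> n \<and> ?G l {2 * l - 2, 2 * l - 1})"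
    using graded_iso_hl_mat_iff(1-3) less_imp_le by blast+
  obtain l S where lS: "standard_type n l S" "?G l S"
    using form_standard_exists[OF char] by blast
  have uniq: "l' = l \<and> S' = S" if "standard_type n l' S'" "?G l' S'" for l' S'
    using forms_equiv_std_unique[OF that(2,1) lS(2,1)] .
  have A: "(\<exists>l. 2 * l \<le> n \<and> ?G l {}) \<longleftrightarrow> S = {}"
    using uniq[of _ "{}"] lS unfolding standard_type_def by blast
  have B: "(\<exists>l. 2 * l < n \<and> ?G l {2 * l}) \<longleftrightarrow> 2 * l < n \<and> S = {2 * l}"
  proof
    assume "\<exists>l. 2 * l < n \<and> ?G l {2 * l}"
    then obtain k where k: "2 * k < n" "?G k {2 * k}" by blast
    then have "standard_type n k {2 * k}" by (simp add: standard_type_def)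
    from uniq[OF this k(2)] k(1) show "2 * l < n \<and> S = {2 * l}" by blast
  qed (use lS in blast)
  have C: "(\<exists>l. 1 \<le> l \<and> 2 * l \<le> n \<and> ?G l {2 * l - 2, 2 * l - 1}) \<longleftrightarrow> 1 \<le> l \<and> S = {2 * l - 2, 2 * l - 1}"
  proof
    assume "\<exists>l. 1 \<le> l \<and> 2 * l \<le> n \<and> ?G l {2 * l - 2, 2 * l - 1}"
    then obtain k where k: "1 \<le> k" "2 * k \<le> n" "?G k {2 * k - 2, 2 * k - 1}" by blast
    then have "standard_type n k {2 * k - 2, 2 * k - 1}" by (simp add: standard_type_def)
    from uniq[OF this k(3)] k(1) show "1 \<le> l \<and> S = {2 * l - 2, 2 * l - 1}" by blast
  qed (use lS in \<open>auto simp: standard_type_def\<close>)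
  have "{2 * l} \<noteq> {2 * l - 2, 2 * l - 1}" if "1 \<le> l"
  proof
    assume "{2 * l} = {2 * l - 2, 2 * l - 1}"
    then have "2 * l - 1 = 2 * l" by blast
    then show False using that by simp
  qed
  then show ?thesis
    unfolding iff A B C exactly_one_def using lS(1) unfolding standard_type_def by auto
qed

lemma exactly_one_main:
  assumes n: "1 \<le> n"
  shows "exactly_one
    (graded_iso_inv \<epsilon> \<tau> (hl_mat 0 n) (tau1 0 n))
    (2 \<le> n \<and> graded_iso_inv \<epsilon> \<tau> (hl_mat 1 n) (tau2 1 n))
    (\<exists>\<eta>. elementary_quantum_matrix n \<eta> \<and> graded_iso_inv \<epsilon> \<tau> \<eta> (main_involution \<eta>))"
proof -
  let ?G = "\<lambda>l S. forms_equiv n (qform \<epsilon> a) (std_form TYPE('f) l n S)"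
  have A: "graded_iso_inv \<epsilon> \<tau> (hl_mat 0 n) (tau1 0 n) \<longleftrightarrow> ?G 0 {0}"
    using graded_iso_hl_mat_iff(2)[of 0] by simp
  have B: "2 \<le> n \<and> graded_iso_inv \<epsilon> \<tau> (hl_mat 1 n) (tau2 1 n) \<longleftrightarrow> 2 \<le> n \<and> ?G 1 {0, 1}"
    using graded_iso_hl_mat_iff(3)[of 1] by auto
  have C: "(\<exists>\<eta>. elementary_quantum_matrix n \<eta> \<and> graded_iso_inv \<epsilon> \<tau> \<eta> (main_involution \<eta>))
      \<longleftrightarrow> (\<exists>\<eta> :: 'f mat. elementary_quantum_matrix n \<eta> \<and> forms_equiv n (qform \<epsilon> a) (qform \<eta> (\<lambda>_. 1)))"
    using graded_iso_main_iff by blast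
  have AB: "\<not> (?G 0 {0} \<and> 2 \<le> n \<and> ?G 1 {0, 1})"
    using forms_equiv_std_unique[of 0 "{0}" 1 "{0, 1}"] n by (auto simp: standard_type_def)
  have no: "\<not> ?G l S" if \<eta>: "elementary_quantum_matrix n \<eta>" "forms_equiv n (qform \<epsilon> a) (qform \<eta> (\<lambda>_. 1))"
    and lS: "l = 0 \<and> S = {0} \<or> l = 1 \<and> 2 \<le> n \<and> S = {0, 1}" for \<eta> :: "'f mat" and l S
    using main_not_equiv_small_std_form[OF char n \<eta>(1) lS] forms_equiv_trans[OF forms_equiv_sym[OF \<eta>(2)]]
    by blast
  obtain l S where lS: "standard_type n l S" "?G l S"
    using form_standard_exists[OF char] by blast
  have "?G 0 {0} \<or> 2 \<le> n \<and> ?G 1 {0, 1} \<or>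
      (\<exists>\<eta> :: 'f mat. elementary_quantum_matrix n \<eta> \<and> forms_equiv n (qform \<epsilon> a) (qform \<eta> (\<lambda>_. 1)))"
  proof -
    consider "S = {}" | "l = 0" "S = {0}" | "1 \<le> l" "2 * l < n" "S = {2 * l}" | "l = 1" "2 \<le> n" "S = {0, 1}"
      | "2 \<le> l" "2 * l \<le> n" "S = {2 * l - 2, 2 * l - 1}"
    proof (cases "S = {}")
      case False
      then consider "2 * l < n" "S = {2 * l}" | "1 \<le> l" "2 * l \<le> n" "S = {2 * l - 2, 2 * l - 1}"
        using lS(1) unfolding standard_type_def by blast
      then show ?thesis
      proof cases
        case 1
        then show ?thesis using that(2,3) by (cases "l = 0") auto
      next
        case 2
        then show ?thesis using that(4,5) by (cases "l = 1") auto
      qed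
    qed
    then show ?thesis
    proof cases
      case 1
      have "elementary_quantum_matrix n (hl_mat l n :: 'f mat)"
        using lS(1) by (intro elementary_hl_mat) (simp add: standard_type_def)
      moreover have "forms_equiv n (qform \<epsilon> a) (qform (hl_mat l n :: 'f mat) (\<lambda>_. 1))"
        using lS(2) 1 by (simp add: sign_type_empty)
      ultimately show ?thesis by blast
    next
      case 3
      have "elementary_quantum_matrix n (block_prod (hl_mat (l - 1) (n - 3)) (m_mat 3) :: 'f mat)"
        using 3 by (intro elementary_block_m_mat) linarith
      then show ?thesis
        using forms_equiv_trans[OF _ tau1_forms_equiv_m3[OF char 3(1,2)]] lS(2) 3(3) by blast
    next
      case 5
      have "elementary_quantum_matrix n (block_prod (hl_mat (l - 2) (n - 4)) (m_mat 4) :: 'f mat)"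
        using 5 by (intro elementary_block_m_mat) linarith
      then show ?thesis
        using forms_equiv_trans[OF _ tau2_forms_equiv_m4[OF char 5(1,2)]] lS(2) 5(3) by blast
    qed (use lS(2) in auto)
  qed
  then show ?thesis
    unfolding exactly_one_def A B C using AB no[of _ 0 "{0}"] no[of _ 1 "{0, 1}"] by blast
qed

end

theorem theorem2p7:
  fixes n :: nat and \<epsilon> :: "'f::field mat" and \<tau> :: "'f free_alg set \<Rightarrow> 'f free_alg set"
  assumes "CHAR('f) \<noteq> 2" and "n \<ge> 1"
    and "elementary_quantum_matrix n \<epsilon>" and "graded_involution \<epsilon> \<tau>"
  shows
    "exactly_one
       (\<exists>l. 2 * l \<le> n \<and> graded_iso_inv \<epsilon> \<tau> (hl_mat l n) (main_involution (hl_mat l n)))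
       (\<exists>l. 2 * l < n \<and> graded_iso_inv \<epsilon> \<tau> (hl_mat l n) (tau1 l n))
       (\<exists>l. 1 \<le> l \<and> 2 * l \<le> n \<and> graded_iso_inv \<epsilon> \<tau> (hl_mat l n) (tau2 l n))
     \<and> (\<forall>l l'. 2 * l \<le> n \<and> 2 * l' \<le> n \<and>
          iso_inv (hl_mat l n :: 'f mat) (main_involution (hl_mat l n))
            (hl_mat l' n) (main_involution (hl_mat l' n)) \<longrightarrow> l = l')
     \<and> (\<forall>l l'. 2 * l < n \<and> 2 * l' < n \<and>
          iso_inv (hl_mat l n :: 'f mat) (tau1 l n) (hl_mat l' n) (tau1 l' n) \<longrightarrow> l = l')
     \<and> (\<forall>l l'. 1 \<le> l \<and> 2 * l \<le> n \<and> 1 \<le> l' \<and> 2 * l' \<le> n \<and>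
          iso_inv (hl_mat l n :: 'f mat) (tau2 l n) (hl_mat l' n) (tau2 l' n) \<longrightarrow> l = l')
     \<and> (\<forall>l. 2 * l < n \<and>
          iso_inv \<epsilon> (main_involution \<epsilon>) (hl_mat l n) (tau1 l n) \<longrightarrow> l \<ge> 1)
     \<and> (\<forall>l. 1 \<le> l \<and> 2 * l \<le> n \<and>
          iso_inv \<epsilon> (main_involution \<epsilon>) (hl_mat l n) (tau2 l n) \<longrightarrow> l \<ge> 2)
     \<and> (\<forall>l. 1 \<le> l \<and> 2 * l < n \<longrightarrow>
          graded_iso_inv (hl_mat l n :: 'f mat) (tau1 l n)
            (block_prod (hl_mat (l - 1) (n - 3)) (m_mat 3))
            (main_involution (block_prod (hl_mat (l - 1) (n - 3)) (m_mat 3))))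
     \<and> (\<forall>l. 2 \<le> l \<and> 2 * l \<le> n \<longrightarrow>
          graded_iso_inv (hl_mat l n :: 'f mat) (tau2 l n)
            (block_prod (hl_mat (l - 2) (n - 4)) (m_mat 4))
            (main_involution (block_prod (hl_mat (l - 2) (n - 4)) (m_mat 4))))
     \<and> exactly_one
       (graded_iso_inv \<epsilon> \<tau> (hl_mat 0 n) (tau1 0 n))
       (2 \<le> n \<and> graded_iso_inv \<epsilon> \<tau> (hl_mat 1 n) (tau2 1 n))
       (\<exists>\<eta>. elementary_quantum_matrix n \<eta> \<and>
          graded_iso_inv \<epsilon> \<tau> \<eta> (main_involution \<eta>))"
proof -
  note char = assms(1) and \<epsilon> = assms(3)
  obtain a where \<tau>: "has_type \<epsilon> a \<tau>"
    using elementary_torus.graded_involution_has_type[OF elementary_torus.intro[OF \<epsilon>] assms(4)] by blast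
  note main_\<epsilon> = has_type_main_involution[OF \<epsilon>]
  have st: "2 * l \<le> n \<Longrightarrow> standard_type n l {}" "2 * l < n \<Longrightarrow> standard_type n l {2 * l}"
    "1 \<le> l \<Longrightarrow> 2 * l \<le> n \<Longrightarrow> standard_type n l {2 * l - 2, 2 * l - 1}" for l
    by (auto simp: standard_type_def)
  note uniq = std_form_unique[OF char]
  note h = has_type_hl_mat[where 'f='f and n=n] and hel = elementary_hl_mat[where 'f='f and n=n]
  have "l = l'" if "2 * l \<le> n" "2 * l' \<le> n"
    "iso_inv (hl_mat l n :: 'f mat) (main_involution (hl_mat l n)) (hl_mat l' n) (main_involution (hl_mat l' n))" for l l'
    using that graded_iso_hl_mat_iff(4)[OF char hel h(1) that(2)] uniq[OF st(1) st(1)] by blast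
  moreover have "l = l'" if "2 * l < n" "2 * l' < n"
    "iso_inv (hl_mat l n :: 'f mat) (tau1 l n) (hl_mat l' n) (tau1 l' n)" for l l'
    using that graded_iso_hl_mat_iff(5)[OF char hel h(2), of l l'] uniq[OF st(2) st(2)] by simp
  moreover have "l = l'" if "1 \<le> l" "2 * l \<le> n" "1 \<le> l'" "2 * l' \<le> n"
    "iso_inv (hl_mat l n :: 'f mat) (tau2 l n) (hl_mat l' n) (tau2 l' n)" for l l'
    using that graded_iso_hl_mat_iff(6)[OF char hel h(3), of l l'] uniq[OF st(3) st(3)] by blast
  moreover have "l \<ge> 1" if "2 * l < n" "iso_inv \<epsilon> (main_involution \<epsilon>) (hl_mat l n) (tau1 l n)" for l
    using that graded_iso_hl_mat_iff(5)[OF char \<epsilon> main_\<epsilon>, of l]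
      main_not_equiv_small_std_form[OF char assms(2) \<epsilon>, of 0 "{0}"] by (cases "l = 0") auto
  moreover have "l \<ge> 2" if "1 \<le> l" "2 * l \<le> n" "iso_inv \<epsilon> (main_involution \<epsilon>) (hl_mat l n) (tau2 l n)" for l
    using that graded_iso_hl_mat_iff(6)[OF char \<epsilon> main_\<epsilon>, of l]
      main_not_equiv_small_std_form[OF char assms(2) \<epsilon>, of 1 "{0, 1}"] by (cases "l = 1") auto
  moreover have "graded_iso_inv (hl_mat l n :: 'f mat) (tau1 l n)
      (block_prod (hl_mat (l - 1) (n - 3)) (m_mat 3))
      (main_involution (block_prod (hl_mat (l - 1) (n - 3)) (m_mat 3)))" if l: "1 \<le> l" "2 * l < n" for l
  proof -
    have "elementary_quantum_matrix n (block_prod (hl_mat (l - 1) (n - 3)) (m_mat 3) :: 'f mat)"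
      using l by (intro elementary_block_m_mat) linarith
    with l show ?thesis
      using graded_iso_main_iff[OF char hel h(2)] tau1_forms_equiv_m3[OF char l] by simp
  qed
  moreover have "graded_iso_inv (hl_mat l n :: 'f mat) (tau2 l n)
      (block_prod (hl_mat (l - 2) (n - 4)) (m_mat 4))
      (main_involution (block_prod (hl_mat (l - 2) (n - 4)) (m_mat 4)))" if l: "2 \<le> l" "2 * l \<le> n" for l
  proof -
    have "elementary_quantum_matrix n (block_prod (hl_mat (l - 2) (n - 4)) (m_mat 4) :: 'f mat)"
      using l by (intro elementary_block_m_mat) linarith
    with l show ?thesis
      using graded_iso_main_iff[OF char hel h(3)] tau2_forms_equiv_m4[OF char l] by simp
  qed
  ultimately show ?thesis
    using exactly_one_standard[OF char \<epsilon> \<tau>] exactly_one_main[OF char \<epsilon> \<tau> assms(2)]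
    by (intro conjI allI impI) blast+
qed

end
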